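(* Let $Y$ denote the tree with degree sequence $(1,1,1,2,3)$. If $G$ is a $191$-edge-connected graph whose number of edges is divisible by $4$, then $G$ has a $Y$-decomposition.
   Context: All graphs are finite. $Y$ is the unique tree on 5 vertices having one vertex of degree 3, one vertex of degree 2 and three leaves. A $Y$-decomposition of $G$ is a partition of the edge set of $G$ into subgraphs each isomorphic to $Y$. *)

theory Defs
  imports Main "HOL-Library.Multiset" "HOL-Library.Disjoint_Sets"
begin

type_synonym 'a ugraph = "'a set \<times> 'a set set"

abbreviation uverts :: "'a ugraph \<Rightarrow> 'a set" where
  "uverts G \<equiv> fst G"

abbreviation uedges :: "'a ugraph \<Rightarrow> 'a set set" where
  "uedges G \<equiv> snd G"

definition simple_graph :: "'a ugraph \<Rightarrow> bool" where
  "simple_graph G \<longleftrightarrow> finite (uverts G) \<and> (\<forall>e\<in>uedges G. e \<subseteq> uverts G \<and> card e = 2)"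

definition subgraph_of :: "'a ugraph \<Rightarrow> 'a ugraph \<Rightarrow> bool" where
  "subgraph_of H G \<longleftrightarrow> simple_graph H \<and> uverts H \<subseteq> uverts G \<and> uedges H \<subseteq> uedges G"

definition graph_iso :: "'a ugraph \<Rightarrow> 'b ugraph \<Rightarrow> bool" where
  "graph_iso G H \<longleftrightarrow> (\<exists>f. bij_betw f (uverts G) (uverts H) \<and>
     (\<forall>u\<in>uverts G. \<forall>v\<in>uverts G. {u, v} \<in> uedges G \<longleftrightarrow> {f u, f v} \<in> uedges H))"

definition graph_connected :: "'a ugraph \<Rightarrow> bool" where
  "graph_connected G \<longleftrightarrow> uverts G \<noteq> {} \<and>
     (\<forall>u\<in>uverts G. \<forall>v\<in>uverts G. (u, v) \<in> {(x, y). {x, y} \<in> uedges G}\<^sup>*)"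

text \<open>A one-vertex graph counts as \<open>k\<close>-edge-connected for every \<open>k\<close>.\<close>

definition edge_connected :: "nat \<Rightarrow> 'a ugraph \<Rightarrow> bool" where
  "edge_connected k G \<longleftrightarrow>
     (\<forall>F \<subseteq> uedges G. card F < k \<longrightarrow> graph_connected (uverts G, uedges G - F))"

definition is_cycle :: "'a ugraph \<Rightarrow> 'a list \<Rightarrow> bool" where
  "is_cycle G p \<longleftrightarrow> length p \<ge> 3 \<and> distinct p \<and>
     (\<forall>i<length p. {p ! i, p ! (Suc i mod length p)} \<in> uedges G)"

definition is_tree :: "'a ugraph \<Rightarrow> bool" where
  "is_tree G \<longleftrightarrow> simple_graph G \<and> graph_connected G \<and> (\<nexists>p. is_cycle G p)"

definition vertex_degree :: "'a ugraph \<Rightarrow> 'a \<Rightarrow> nat" where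
  "vertex_degree G v = card {e \<in> uedges G. v \<in> e}"

definition degree_sequence :: "'a ugraph \<Rightarrow> nat multiset" where
  "degree_sequence G = image_mset (vertex_degree G) (mset_set (uverts G))"

definition is_decomposition :: "'b ugraph \<Rightarrow> 'a ugraph \<Rightarrow> 'a ugraph set \<Rightarrow> bool" where
  "is_decomposition T G D \<longleftrightarrow>
     (\<forall>H\<in>D. subgraph_of H G \<and> graph_iso H T) \<and>
     disjoint_family_on uedges D \<and> (\<Union>H\<in>D. uedges H) = uedges G"

definition has_decomposition :: "'b ugraph \<Rightarrow> 'a ugraph \<Rightarrow> bool" where
  "has_decomposition T G \<longleftrightarrow> (\<exists>D. is_decomposition T G D)"

text \<open>A tree on five vertices with this degree sequence exists (and is unique up to isomorphism).\<close>

lemma tree_11123_exists: "\<exists>Y :: nat ugraph. is_tree Y \<and> degree_sequence Y = {#1, 1, 1, 2, 3#}"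
proof -
  define E where "E = {{0,1},{0,2},{0,3},{3,4::nat}}"
  define Y where "Y = ({0,1,2,3,4::nat}, E)"
  have s: "simple_graph Y" by (auto simp: simple_graph_def Y_def E_def)
  have d: "vertex_degree Y 0 = 3" "vertex_degree Y 1 = 1" "vertex_degree Y 2 = 1" "vertex_degree Y 3 = 2" "vertex_degree Y 4 = 1"
  proof -
    have "{e\<in>E. 0 \<in> e} = {{0,1},{0,2},{0,3}}" "{e\<in>E. 1 \<in> e} = {{0,1}}" "{e\<in>E. 2 \<in> e} = {{0,2}}"
      "{e\<in>E. 3 \<in> e} = {{0,3},{3,4}}" "{e\<in>E. 4 \<in> e} = {{3,4}}"
      by (auto simp: E_def)
    then show "vertex_degree Y 0 = 3" "vertex_degree Y 1 = 1" "vertex_degree Y 2 = 1" "vertex_degree Y 3 = 2" "vertex_degree Y 4 = 1"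
      by (auto simp: vertex_degree_def Y_def card_insert_if doubleton_eq_iff)
  qed
  have ds: "degree_sequence Y = {#1, 1, 1, 2, 3#}"
  proof -
    have "mset_set {0,1,2,3,4::nat} = {#0,1,2,3,4#}" by simp
    then show ?thesis using d unfolding degree_sequence_def by (simp add: Y_def)
  qed
  have c: "graph_connected Y"
  proof -
    let ?R = "{(x, y). {x, y} \<in> E}"
    have sy: "sym ?R" by (auto simp: sym_def insert_commute)
    have a: "(0,1) \<in> ?R" "(0,2) \<in> ?R" "(0,3) \<in> ?R" "(3,4) \<in> ?R" by (auto simp: E_def)
    have r: "(0,v) \<in> ?R\<^sup>*" if "v \<in> {0,1,2,3,4}" for v
      using that a by (auto intro: rtrancl_into_rtrancl)
    have "sym (?R\<^sup>*)" using sy by (rule sym_rtrancl)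
    then have "(u,v) \<in> ?R\<^sup>*" if "u \<in> {0,1,2,3,4}" "v \<in> {0,1,2,3,4}" for u v
      using r[OF that(1)] r[OF that(2)] by (blast intro: rtrancl_trans dest: symD)
    then show ?thesis unfolding graph_connected_def Y_def by simp
  qed
  have "\<not> is_cycle Y p" for p
  proof
    assume "is_cycle Y p"
    then have l: "length p \<ge> 3" and di: "distinct p"
      and e: "\<And>i. i < length p \<Longrightarrow> {p ! i, p ! (Suc i mod length p)} \<in> E" by (auto simp: is_cycle_def Y_def)
    have "set p \<subseteq> {0,3}"
    proof
      fix x assume "x \<in> set p"
      then obtain j where j: "j < length p" "x = p!j" by (metis in_set_conv_nth)
      define i where "i = (if j = 0 then length p - 1 else j - 1)"
      have i: "i < length p" "Suc i mod length p = j" using j l by (auto simp: i_def)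
      define k where "k = Suc j mod length p"
      have k: "k < length p" "k \<noteq> i" using l j by (auto simp: k_def i_def mod_Suc)
      have "{p!i, x} \<in> E" "{x, p!k} \<in> E" "p!i \<noteq> p!k" 
        using e[of i] e[of j] i j k di by (auto simp: k_def nth_eq_iff_index_eq)
      then show "x \<in> {0,3}" by (auto simp: E_def doubleton_eq_iff)
    qed
    then have "card (set p) \<le> card {0,3::nat}" by (intro card_mono) auto
    then show False using l di by (simp add: distinct_card)
  qed
  then show ?thesis using s c ds unfolding is_tree_def by blast
qed

end

theory Submission
  imports Defs
begin

text \<open>
  In a copy of \<open>Y\<close> let \<open>cd\<close> be the edge between the vertices of degree 3 and 2, and let the two other
  edges at \<open>c\<close> be owned by \<open>c\<close>, the two edges at \<open>d\<close> by \<open>d\<close>. Conversely, suppose a set \<open>F\<close> of edges and an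
  assignment of owners are given such that every vertex owns twice as many edges as it has edges of
  \<open>F\<close>. Then the owned edges outside \<open>F\<close> can be distributed to the edges of \<open>F\<close> so as to produce copies
  of \<open>Y\<close>; the only obstruction is a triangle (both ends of \<open>cd\<close> contributing edges to the same third
  vertex), and this is avoided by a suitable use of Hall's theorem, as all \<open>F\<close>-degrees are at least 11.

  By Hall's theorem again, owners exist once \<open>F\<close> has a quarter of all edges and
  \<open>\<bar>\<Sum>v\<in>S. 4 d\<^sub>F(v) - d(v)\<bar>\<close> is at most the size of the edge cut of \<open>S\<close>, for every \<open>S\<close>. We take for \<open>F\<close> every
  second edge of an Euler tour of a connected set \<open>Z\<close> with half of the edges, so \<open>Z\<close> needs even
  degrees and \<open>\<bar>\<Sum>v\<in>S. 2 d\<^sub>Z(v) - d(v)\<bar>\<close> has to be bounded by the cut. A maximum cut contains a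
  96-edge-connected bipartite graph and hence 48 disjoint spanning trees. Putting one tree into \<open>Z\<close> and
  another into its complement makes \<open>Z\<close> connected at no cost, since the numbers of edges of two spanning trees
  inside \<open>S\<close> differ by less than the cuts of the trees. The other edges are halved along Euler tours, and
  degree parities are corrected by deviating from strict alternation inside bipartite tours, where
  labellings are orientations and their defects are flows, thus bounded by cuts.
\<close>

section \<open>Disjoint spanning trees\<close>

text \<open>The constant 191 arises backwards from the triangle problem. Three designated neighbours
  suffice for a vertex processed late, because two of them remain when any one is disregarded. Every
  crossing edge of a maximum cut can serve only one of its ends, so 3 such edges per vertex require
  6, and a maximum cut keeps 6 of 11. Degree 11 in \<open>F\<close> is half of degree 21 in
  \<open>Z\<close>, rounded up. One of these 21 comes from the tree inside \<open>Z\<close>, the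
  other 20 are half of what 40 spare trees provide. Eight more trees are reserved for connectivity
  and parity, which makes 48; they need cuts of size 96 inside a maximum cut, hence 191 in the
  graph, again by rounding up. The cut bound leaves no room for an additive error, so every parity
  correction has to be paid by the cut of the edges that it uses. For this reason the edge set is
  split into classes, each with a defect bounded by its own cut, and these bounds are added.\<close>

locale mgraph =
  fixes s t :: "'e \<Rightarrow> 'v"
begin

text \<open>Edges form a type of their own with end maps \<open>s\<close> and \<open>t\<close>,
  instead of being two-element sets, since parallel copies, loops and ordered pairs occur as edges
  below. The direction from \<open>s\<close> to \<open>t\<close> is book-keeping;
  \<open>link\<close> is symmetric.\<close>

definition link :: "'e set \<Rightarrow> ('v \<times> 'v) set" where
  "link X = {(u, v). \<exists>e\<in>X. s e = u \<and> t e = v \<or> s e = v \<and> t e = u}"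

definition conn :: "'e set \<Rightarrow> ('v \<times> 'v) set" where
  "conn X = (link X)\<^sup>*"

text \<open>Acyclicity in terms of bridges. Loops are excluded because \<open>conn\<close> is
  reflexive.\<close>

definition forest :: "'e set \<Rightarrow> bool" where
  "forest X \<longleftrightarrow> (\<forall>e\<in>X. (s e, t e) \<notin> conn (X - {e}))"

definition cut :: "'e set \<Rightarrow> 'v set \<Rightarrow> 'e set" where
  "cut X S = {e \<in> X. (s e \<in> S) \<noteq> (t e \<in> S)}"

text \<open>\<open>vol X {v}\<close> is the degree of \<open>v\<close> in \<open>X\<close>, a loop
  counting twice. Integers are used because defects are differences of such sums.\<close>

definition vol :: "'e set \<Rightarrow> 'v set \<Rightarrow> int" where
  "vol X S = (\<Sum>e\<in>X. of_bool (s e \<in> S) + of_bool (t e \<in> S))"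

section \<open>Connectivity and forests\<close>

lemma conn_refl [simp]: "(u, u) \<in> conn X"
  by (simp add: conn_def)

lemma conn_sym: "(u, v) \<in> conn X \<Longrightarrow> (v, u) \<in> conn X"
proof -
  have "sym (link X)"
    by (auto simp: sym_def link_def)
  then show "(u, v) \<in> conn X \<Longrightarrow> (v, u) \<in> conn X"
    unfolding conn_def by (meson symD sym_rtrancl)
qed

lemma conn_trans: "(u, v) \<in> conn X \<Longrightarrow> (v, w) \<in> conn X \<Longrightarrow> (u, w) \<in> conn X"
  unfolding conn_def by (rule rtrancl_trans)

lemma conn_edge: "e \<in> X \<Longrightarrow> (s e, t e) \<in> conn X"
  unfolding conn_def link_def by blast

lemma conn_edge': "e \<in> X \<Longrightarrow> (t e, s e) \<in> conn X"
  by (rule conn_sym, rule conn_edge)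

lemma conn_mono: "X \<subseteq> Z \<Longrightarrow> conn X \<subseteq> conn Z"
  unfolding conn_def by (intro rtrancl_mono) (auto simp: link_def)

lemma conn_induct [consumes 1, case_names refl step]:
  assumes "(u, v) \<in> conn X" and "P u"
    and "\<And>e x y. e \<in> X \<Longrightarrow> {x, y} = {s e, t e} \<Longrightarrow> (u, x) \<in> conn X \<Longrightarrow> P x \<Longrightarrow> P y"
  shows "P v"
  using assms(1) unfolding conn_def
proof (induction rule: rtrancl_induct)
  case base
  show ?case by (fact assms(2))
next
  case (step y z)
  then obtain e where "e \<in> X" "{y, z} = {s e, t e}"
    by (auto simp: link_def)
  then show ?case
    using assms(3)[of e y z] step by (simp add: conn_def)
qed

lemma conn_subset:
  assumes "\<And>e. e \<in> X \<Longrightarrow> (s e, t e) \<in> conn Z"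
  shows "conn X \<subseteq> conn Z"
proof clarify
  fix u v assume "(u, v) \<in> conn X"
  then show "(u, v) \<in> conn Z"
  proof (induction rule: conn_induct)
    case (step e x y)
    have "(x, y) \<in> conn Z"
      using assms[OF step(1)] conn_sym step(2) by (auto simp: doubleton_eq_iff)
    then show ?case using step conn_trans by blast
  qed simp
qed

lemma conn_insert:
  assumes "(u, v) \<in> conn (insert e X)"
  shows "(u, v) \<in> conn X \<or> (u, s e) \<in> conn X \<and> (t e, v) \<in> conn X
    \<or> (u, t e) \<in> conn X \<and> (s e, v) \<in> conn X"
  using assms
proof (induction rule: conn_induct)
  case (step e' x y)
  show ?case
  proof (cases "e' = e")
    case True
    then show ?thesis using step by (auto simp: doubleton_eq_iff intro: conn_trans conn_sym)
  next
    case False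
    then have "(x, y) \<in> conn X"
      using step conn_edge[of e' X] conn_edge'[of e' X] by (auto simp: doubleton_eq_iff)
    then show ?thesis using step conn_trans by blast
  qed
qed simp

lemma forest_subset: "forest X \<Longrightarrow> Z \<subseteq> X \<Longrightarrow> forest Z"
proof -
  assume X: "forest X" "Z \<subseteq> X"
  show "forest Z"
    unfolding forest_def
  proof
    fix e assume "e \<in> Z"
    then show "(s e, t e) \<notin> conn (Z - {e})"
      using X conn_mono[of "Z - {e}" "X - {e}"] by (auto simp: forest_def)
  qed
qed

lemma forest_empty [simp]: "forest {}"
  by (simp add: forest_def)

text \<open>If an old edge \<open>f\<close> ceased to be a bridge, the detour around it would run
  through \<open>e\<close>; together with \<open>f\<close> it would join the ends of
  \<open>e\<close> inside \<open>X\<close>.\<close>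

lemma forest_insert:
  assumes "forest X" and "(s e, t e) \<notin> conn X"
  shows "forest (insert e X)"
  unfolding forest_def
proof
  fix f assume f: "f \<in> insert e X"
  show "(s f, t f) \<notin> conn (insert e X - {f})"
  proof (cases "f = e")
    case True
    then show ?thesis using assms(2) conn_mono[of "insert e X - {f}" X] by blast
  next
    case False
    then have fX: "f \<in> X" and eq: "insert e X - {f} = insert e (X - {f})"
      using f by auto
    show ?thesis
    proof
      assume "(s f, t f) \<in> conn (insert e X - {f})"
      then consider "(s f, t f) \<in> conn (X - {f})"
        | "(s f, s e) \<in> conn (X - {f})" "(t e, t f) \<in> conn (X - {f})"
        | "(s f, t e) \<in> conn (X - {f})" "(s e, t f) \<in> conn (X - {f})"
        using conn_insert unfolding eq by blast
      then show False
      proof cases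
        case 1
        then show ?thesis using assms(1) fX by (simp add: forest_def)
      next
        case 2
        then have "(s f, s e) \<in> conn X" "(t e, t f) \<in> conn X"
          using conn_mono[of "X - {f}" X] by blast+
        then show ?thesis using assms(2) conn_edge[OF fX] conn_sym conn_trans by blast
      next
        case 3
        then have "(s f, t e) \<in> conn X" "(s e, t f) \<in> conn X"
          using conn_mono[of "X - {f}" X] by blast+
        then show ?thesis using assms(2) conn_edge'[OF fX] conn_trans by blast
      qed
    qed
  qed
qed

text \<open>The separating edges are those of the tree path from \<open>u\<close> to
  \<open>v\<close>. A minimal connecting set \<open>Q\<close> consists of them: a connection
  avoiding some \<open>e\<close> in \<open>Q\<close>, combined with the two pieces of
  \<open>Q\<close> left by removing \<open>e\<close>, would join the ends of \<open>e\<close>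
  without \<open>e\<close>.\<close>

lemma forest_conn_separating:
  assumes "forest X" and "finite X" and "(u, v) \<in> conn X"
  shows "(u, v) \<in> conn {e \<in> X. (u, v) \<notin> conn (X - {e})}"
proof -
  define M where "M = {Q. Q \<subseteq> X \<and> (u, v) \<in> conn Q}"
  have "finite M" using assms(2) by (auto simp: M_def intro: finite_subset[of _ "Pow X"])
  moreover have "X \<in> M" using assms(3) by (simp add: M_def)
  ultimately obtain Q where QM: "Q \<in> M" and minM: "\<forall>Z\<in>M. Z \<subseteq> Q \<longrightarrow> Q = Z"
    using finite_has_minimal[of M] by blast
  then have Q: "Q \<subseteq> X" "(u, v) \<in> conn Q" by (auto simp: M_def)
  have "Q \<subseteq> {e \<in> X. (u, v) \<notin> conn (X - {e})}"
  proof
    fix e assume e: "e \<in> Q"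
    have n: "(u, v) \<notin> conn (Q - {e})" using minM[rule_format, of "Q - {e}"] Q(1) e by (auto simp: M_def)
    have sub: "conn (Q - {e}) \<subseteq> conn (X - {e})" using Q by (intro conn_mono) auto
    have "(u, v) \<in> conn (insert e (Q - {e}))" using Q e by (simp add: insert_absorb)
    then have *: "(u, s e) \<in> conn (X - {e}) \<and> (t e, v) \<in> conn (X - {e})
      \<or> (u, t e) \<in> conn (X - {e}) \<and> (s e, v) \<in> conn (X - {e})"
      using conn_insert n sub by blast
    have "(u, v) \<notin> conn (X - {e})"
    proof
      assume "(u, v) \<in> conn (X - {e})"
      then have "(s e, t e) \<in> conn (X - {e})" using * conn_sym conn_trans by meson
      then show False using assms(1) Q e by (auto simp: forest_def)
    qed
    then show "e \<in> {e \<in> X. (u, v) \<notin> conn (X - {e})}" using Q e by blast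
  qed
  then show ?thesis using conn_mono Q by blast
qed

section \<open>Counting components\<close>

definition comps :: "'v set \<Rightarrow> 'e set \<Rightarrow> 'v set set" where
  "comps V X = (\<lambda>v. conn X `` {v} \<inter> V) ` V"

lemma finite_comps [simp]: "finite V \<Longrightarrow> finite (comps V X)"
  by (simp add: comps_def)

lemma comps_empty: "comps V {} = (\<lambda>v. {v}) ` V"
  by (auto simp: comps_def conn_def link_def)

lemma class_eq_iff: "u \<in> V \<Longrightarrow> v \<in> V \<Longrightarrow> conn X `` {u} \<inter> V = conn X `` {v} \<inter> V \<longleftrightarrow> (u, v) \<in> conn X"
proof
  assume "u \<in> V" "v \<in> V" "conn X `` {u} \<inter> V = conn X `` {v} \<inter> V"
  then show "(u, v) \<in> conn X" by (metis Image_singleton_iff IntE IntI conn_refl)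
next
  assume "(u, v) \<in> conn X"
  then have "(u, w) \<in> conn X \<longleftrightarrow> (v, w) \<in> conn X" for w
    by (meson conn_sym conn_trans)
  then show "conn X `` {u} \<inter> V = conn X `` {v} \<inter> V" by auto
qed

text \<open>Adding \<open>e\<close> acts on the classes by the map \<open>h\<close>, which merges
  the classes of the two ends and fixes all others. Without the class of \<open>t e\<close> it is
  injective.\<close>

lemma card_comps_insert_le:
  assumes "finite V" and "s e \<in> V" and "t e \<in> V"
  shows "card (comps V X) \<le> card (comps V (insert e X)) + 1"
    and "(s e, t e) \<notin> conn X \<Longrightarrow> card (comps V (insert e X)) < card (comps V X)"
proof -
  define h where "h C = (if s e \<in> C \<or> t e \<in> C then conn (insert e X) `` {s e} \<inter> V else C)" for C
  have mono: "conn X \<subseteq> conn (insert e X)" by (intro conn_mono) auto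
  have h: "conn (insert e X) `` {v} \<inter> V = h (conn X `` {v} \<inter> V)" if v: "v \<in> V" for v
  proof (cases "(v, s e) \<in> conn X \<or> (v, t e) \<in> conn X")
    case True
    then have "(v, s e) \<in> conn (insert e X)"
      using mono conn_edge'[of e "insert e X"] conn_trans by blast
    then have "conn (insert e X) `` {v} \<inter> V = conn (insert e X) `` {s e} \<inter> V"
      using v assms class_eq_iff by blast
    then show ?thesis using True assms by (auto simp: h_def)
  next
    case False
    then have "(v, w) \<in> conn (insert e X) \<longleftrightarrow> (v, w) \<in> conn X" for w
      using conn_insert[of v w e X] mono by blast
    then show ?thesis using False by (auto simp: h_def)
  qed
  have img: "comps V (insert e X) = h ` comps V X"
    unfolding comps_def image_image by (intro image_cong refl) (use h in auto)
  define Cs where "Cs = conn X `` {s e} \<inter> V"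
  define Ct where "Ct = conn X `` {t e} \<inter> V"
  have inC: "Cs \<in> comps V X" "Ct \<in> comps V X"
    using assms by (auto simp: comps_def Cs_def Ct_def)
  have hid: "h C = C" if "C \<in> comps V X - {Cs, Ct}" for C
  proof -
    obtain v where v: "v \<in> V" "C = conn X `` {v} \<inter> V" using \<open>C \<in> _\<close> by (auto simp: comps_def)
    have "(v, s e) \<notin> conn X" "(v, t e) \<notin> conn X"
      using that v assms class_eq_iff[of v V "s e" X] class_eq_iff[of v V "t e" X]
      by (auto simp: Cs_def Ct_def)
    then show ?thesis using v by (auto simp: h_def)
  qed
  have inj: "inj_on h (comps V X - {Ct})"
  proof -
    have "h Cs \<noteq> C" if C: "C \<in> comps V X - {Cs, Ct}" for C
    proof
      assume "h Cs = C"
      then have "s e \<in> C" using assms by (auto simp: h_def Cs_def)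
      then have "C = Cs" using C assms class_eq_iff[of _ V "s e" X]
        by (auto simp: comps_def Cs_def)
      then show False using C by blast
    qed
    then show ?thesis using hid unfolding inj_on_def by (metis Diff_iff insert_iff)
  qed
  have fin: "finite (comps V X)" using assms by simp
  have "card (comps V X) \<le> card (comps V X - {Ct}) + 1"
    using fin inC by (simp add: card_Diff_singleton)
  also have "card (comps V X - {Ct}) = card (h ` (comps V X - {Ct}))"
    using inj by (simp add: card_image)
  also have "\<dots> \<le> card (comps V (insert e X))"
    unfolding img using fin by (intro card_mono) auto
  finally show "card (comps V X) \<le> card (comps V (insert e X)) + 1" by simp
  assume "(s e, t e) \<notin> conn X"
  then have "Cs \<noteq> Ct" unfolding Cs_def Ct_def using class_eq_iff assms by blast
  moreover have "h Cs = h Ct" using assms by (auto simp: h_def Cs_def Ct_def)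
  ultimately have "h ` comps V X = h ` (comps V X - {Ct})" using inC by blast
  then have "card (comps V (insert e X)) \<le> card (comps V X - {Ct})"
    unfolding img using card_image_le fin by (metis finite_Diff)
  then show "card (comps V (insert e X)) < card (comps V X)"
    using fin inC by (metis card_Diff1_less le_less_trans)
qed

lemma card_comps_ge:
  assumes "finite V" and "finite X" and "\<And>e. e \<in> X \<Longrightarrow> s e \<in> V \<and> t e \<in> V"
  shows "card V \<le> card (comps V X) + card X"
  using assms(2,3)
proof (induction X rule: finite_induct)
  case empty
  then show ?case by (simp add: comps_empty card_image)
next
  case (insert e X)
  then show ?case using card_comps_insert_le(1)[OF assms(1), of e X] by fastforce
qed

lemma forest_card_comps:
  assumes "finite V" and "finite X" and "\<And>e. e \<in> X \<Longrightarrow> s e \<in> V \<and> t e \<in> V" and "forest X"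
  shows "card (comps V X) + card X \<le> card V"
  using assms(2,3,4)
proof (induction X rule: finite_induct)
  case empty
  then show ?case by (simp add: comps_empty card_image)
next
  case (insert e X)
  have "forest X" using insert.prems forest_subset by blast
  moreover have "(s e, t e) \<notin> conn X" using insert by (auto simp: forest_def)
  ultimately show ?case using insert card_comps_insert_le(2)[OF assms(1), of e X] by fastforce
qed

lemma forest_card_less:
  assumes "finite V" and "V \<noteq> {}" and "finite X" and "\<And>e. e \<in> X \<Longrightarrow> s e \<in> V \<and> t e \<in> V" and "forest X"
  shows "card X < card V"
proof -
  have "comps V X \<noteq> {}" using assms(2) by (auto simp: comps_def)
  then have "card (comps V X) > 0" using assms(1) by (simp add: card_gt_0_iff)
  then show ?thesis using forest_card_comps[OF assms(1,3,4,5)] by linarith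
qed

section \<open>Packing spanning trees by exchanges\<close>

definition spanning :: "'v set \<Rightarrow> 'e set \<Rightarrow> bool" where
  "spanning V X \<longleftrightarrow> (\<forall>u\<in>V. \<forall>v\<in>V. (u, v) \<in> conn X)"

definition packing :: "'e set \<Rightarrow> nat \<Rightarrow> (nat \<Rightarrow> 'e set) \<Rightarrow> bool" where
  "packing E k F \<longleftrightarrow> (\<forall>i<k. F i \<subseteq> E \<and> forest (F i)) \<and> disjoint_family_on F {..<k}"

text \<open>Exchanges as in matroid union: an uncovered edge \<open>e\<close> enters the forest
  \<open>F i\<close>, and an edge \<open>f\<close> whose removal separates the ends of
  \<open>e\<close> leaves it, so that the total size is kept.\<close>

inductive exch :: "'e set \<Rightarrow> nat \<Rightarrow> (nat \<Rightarrow> 'e set) \<Rightarrow> (nat \<Rightarrow> 'e set) \<Rightarrow> bool"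
  for E k F\<^sub>0 where
  base: "exch E k F\<^sub>0 F\<^sub>0"
| step: "exch E k F\<^sub>0 F \<Longrightarrow> i < k \<Longrightarrow> e \<in> E \<Longrightarrow> e \<notin> (\<Union>j<k. F j) \<Longrightarrow> f \<in> F i \<Longrightarrow>
    (s e, t e) \<notin> conn (F i - {f}) \<Longrightarrow> exch E k F\<^sub>0 (F(i := insert e (F i - {f})))"

lemma packing_upd:
  assumes "packing E k F" and "i < k" and "e \<in> E" and "e \<notin> (\<Union>j<k. F j)" and "Z \<subseteq> F i"
    and "(s e, t e) \<notin> conn Z"
  shows "packing E k (F(i := insert e Z))"
proof -
  have dis: "F a \<inter> F b = {}" if "a < k" "b < k" "a \<noteq> b" for a b
    using assms(1) that by (auto simp: packing_def disjoint_family_on_def)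
  have "forest (insert e Z)"
    using assms forest_insert forest_subset[OF _ assms(5)] by (auto simp: packing_def)
  moreover have "insert e Z \<inter> F j = {}" if "j < k" "j \<noteq> i" for j
    using dis[of j i] assms that by auto
  moreover have "Z \<subseteq> E"
    using assms by (auto simp: packing_def)
  ultimately show ?thesis
    using assms dis unfolding packing_def disjoint_family_on_def by (simp add: Int_commute)
qed

lemma exch_packing:
  assumes "packing E k F\<^sub>0" and "finite E" and "exch E k F\<^sub>0 F"
  shows "packing E k F \<and> (\<Sum>i<k. card (F i)) = (\<Sum>i<k. card (F\<^sub>0 i))"
  using assms(3)
proof (induction rule: exch.induct)
  case (step F i e f)
  have fin: "finite (F i)"
    using step assms(2) by (auto simp: packing_def intro: finite_subset)
  have "packing E k (F(i := insert e (F i - {f})))"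
    using step packing_upd[of E k F i e "F i - {f}"] by blast
  moreover have "card (insert e (F i - {f})) = card (F i)"
  proof -
    have "e \<notin> F i" using step by blast
    then show ?thesis using fin step(5) card_Suc_Diff1[of "F i" f] by simp
  qed
  then have "(\<Sum>j<k. card ((F(i := insert e (F i - {f}))) j)) = (\<Sum>j<k. card (F j))"
    by (intro sum.cong) auto
  ultimately show ?case using conjunct2[OF step.IH] by metis
qed (use assms in auto)

text \<open>The edges uncovered by some sequence of exchanges induce the same components in every forest
  of an optimal packing. Counting the edges between these components shows that there is only one.\<close>

lemma exch_conn:
  assumes "packing E k F\<^sub>0" and "finite E"
    and opt: "\<And>F. packing E k F \<Longrightarrow> (\<Sum>i<k. card (F i)) \<le> (\<Sum>i<k. card (F\<^sub>0 i))"
    and E0: "E\<^sub>0 = {e \<in> E. \<exists>F. exch E k F\<^sub>0 F \<and> e \<notin> (\<Union>j<k. F j)}"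
    and F: "exch E k F\<^sub>0 F" and e: "e \<in> E" "e \<notin> (\<Union>j<k. F j)" and i: "i < k"
  shows "(s e, t e) \<in> conn (F i \<inter> E\<^sub>0)"
proof -
  have p: "packing E k F" and sz: "(\<Sum>i<k. card (F i)) = (\<Sum>i<k. card (F\<^sub>0 i))"
    using exch_packing[OF assms(1,2) F] by auto
  have fin: "finite (F i)" and fo: "forest (F i)" and sub: "F i \<subseteq> E"
    using p i assms(2) by (auto simp: packing_def intro: finite_subset)
  have "(s e, t e) \<in> conn (F i)"
  proof (rule ccontr)
    assume "(s e, t e) \<notin> conn (F i)"
    then have "packing E k (F(i := insert e (F i)))"
      using packing_upd[OF p i e, of "F i"] by blast
    then have "(\<Sum>j<k. card ((F(i := insert e (F i))) j)) \<le> (\<Sum>j<k. card (F j))"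
      using opt sz by fastforce
    moreover have "(\<Sum>j<k. card (F j)) < (\<Sum>j<k. card ((F(i := insert e (F i))) j))"
    proof (rule sum_strict_mono_ex1)
      have "e \<notin> F i" using e i by blast
      then show "\<exists>j\<in>{..<k}. card (F j) < card ((F(i := insert e (F i))) j)"
        using i fin by (intro bexI[of _ i]) auto
    qed (use fin in \<open>auto intro: card_mono\<close>)
    ultimately show False by simp
  qed
  then have c: "(s e, t e) \<in> conn {f \<in> F i. (s e, t e) \<notin> conn (F i - {f})}"
    by (rule forest_conn_separating[OF fo fin])
  \<comment> \<open>Exchanging \<open>e\<close> for an edge \<open>f\<close> of the tree path
    uncovers \<open>f\<close>, which puts \<open>f\<close> into \<open>E\<^sub>0\<close>.\<close>
  have "{f \<in> F i. (s e, t e) \<notin> conn (F i - {f})} \<subseteq> F i \<inter> E\<^sub>0"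
  proof
    fix f assume "f \<in> {f \<in> F i. (s e, t e) \<notin> conn (F i - {f})}"
    then have f: "f \<in> F i" "(s e, t e) \<notin> conn (F i - {f})" by auto
    let ?F = "F(i := insert e (F i - {f}))"
    have "exch E k F\<^sub>0 ?F" using exch.step[OF F i e f] .
    moreover have "f \<notin> (\<Union>j<k. ?F j)"
    proof -
      have "f \<notin> F j" if "j < k" "j \<noteq> i" for j
      proof -
        have "F i \<inter> F j = {}"
          using p i that by (simp add: packing_def disjoint_family_on_def)
        then show ?thesis using f by blast
      qed
      moreover have "f \<noteq> e" using f e i by blast
      ultimately show ?thesis by auto
    qed
    ultimately have "f \<in> E\<^sub>0" using f sub unfolding E0 by blast
    then show "f \<in> F i \<inter> E\<^sub>0" using f by blast
  qed
  then show ?thesis using c conn_mono by blast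
qed

text \<open>An exchange creates no connection inside \<open>E\<^sub>0\<close>, since the ends of the
  entering edge are already joined there by \<open>exch_conn\<close>. Induction leads back to the
  initial packing.\<close>

lemma exch_conn_base:
  assumes "packing E k F\<^sub>0" and "finite E"
    and opt: "\<And>F. packing E k F \<Longrightarrow> (\<Sum>i<k. card (F i)) \<le> (\<Sum>i<k. card (F\<^sub>0 i))"
    and E0: "E\<^sub>0 = {e \<in> E. \<exists>F. exch E k F\<^sub>0 F \<and> e \<notin> (\<Union>j<k. F j)}"
    and F: "exch E k F\<^sub>0 F"
  shows "\<forall>j<k. conn (F j \<inter> E\<^sub>0) \<subseteq> conn (F\<^sub>0 j \<inter> E\<^sub>0)"
  using F
proof (induction rule: exch.induct)
  case (step F i e f)
  have "conn ((F(i := insert e (F i - {f}))) j \<inter> E\<^sub>0) \<subseteq> conn (F j \<inter> E\<^sub>0)" if "j < k" for j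
  proof (cases "j = i")
    case True
    have "(s g, t g) \<in> conn (F i \<inter> E\<^sub>0)" if "g \<in> insert e (F i - {f}) \<inter> E\<^sub>0" for g
    proof (cases "g = e")
      case True
      then show ?thesis
        using exch_conn[OF assms(1,2) opt E0 step(1)] step by blast
    next
      case False
      then show ?thesis using that by (intro conn_edge) auto
    qed
    then have "conn (insert e (F i - {f}) \<inter> E\<^sub>0) \<subseteq> conn (F i \<inter> E\<^sub>0)"
      by (rule conn_subset)
    then show ?thesis using True by simp
  qed simp
  then show ?case using step by blast
qed simp

text \<open>A consequence of the theorem of Nash-Williams and Tutte. Let \<open>P\<close> be the
  components of the edges \<open>E0\<close> that exchanges can uncover. In an optimal packing all
  edges between components are covered, by at most \<open>k * (card P - 1)\<close> forest edges,
  whereas the cuts supply at least \<open>k * card P\<close> of them unless \<open>P\<close> has one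
  member only.\<close>

theorem tree_packing:
  assumes "finite V" and "finite E" and ends: "\<And>e. e \<in> E \<Longrightarrow> s e \<in> V \<and> t e \<in> V"
    and cuts: "\<And>S. S \<subseteq> V \<Longrightarrow> S \<noteq> {} \<Longrightarrow> S \<noteq> V \<Longrightarrow> 2 * k \<le> card (cut E S)"
  obtains F where "packing E k F" and "\<And>i. i < k \<Longrightarrow> spanning V (F i)"
proof (cases "V = {} \<or> k = 0")
  case True
  have "packing E k (\<lambda>_. {})" by (auto simp: packing_def disjoint_family_on_def)
  then show ?thesis using that True by (auto simp: spanning_def)
next
  case False
  then have V: "V \<noteq> {}" and k: "k > 0" by auto
  have "packing E k (\<lambda>_. {})" by (auto simp: packing_def disjoint_family_on_def)
  moreover have "(\<Sum>i<k. card (F i)) \<le> k * card E" if "packing E k F" for F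
    using that sum_bounded_above[of "{..<k}" "\<lambda>i. card (F i)" "card E"] assms(2)
    by (simp add: packing_def card_mono)
  ultimately have "\<exists>F. packing E k F \<and>
      (\<forall>F'. packing E k F' \<longrightarrow> (\<Sum>i<k. card (F' i)) \<le> (\<Sum>i<k. card (F i)))"
    by (intro ex_has_greatest_nat[of _ "\<lambda>_. {}" _ "Suc (k * card E)"]) (auto simp: less_Suc_eq_le)
  then obtain F where F: "packing E k F"
    and opt: "\<And>F'. packing E k F' \<Longrightarrow> (\<Sum>i<k. card (F' i)) \<le> (\<Sum>i<k. card (F i))"
    by auto
  define E0 where "E0 = {e \<in> E. \<exists>F'. exch E k F F' \<and> e \<notin> (\<Union>j<k. F' j)}"
  have conn_i: "conn E0 \<subseteq> conn (F i \<inter> E0)" if i: "i < k" for i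
  proof (rule conn_subset)
    fix e assume "e \<in> E0"
    then obtain F' where F': "exch E k F F'" "e \<in> E" "e \<notin> (\<Union>j<k. F' j)"
      by (auto simp: E0_def)
    then have "(s e, t e) \<in> conn (F' i \<inter> E0)"
      using exch_conn[OF F assms(2) opt E0_def F'] i by blast
    then show "(s e, t e) \<in> conn (F i \<inter> E0)"
      using exch_conn_base[OF F assms(2) opt E0_def F'(1)] i by blast
  qed
  define P where "P = comps V E0"
  define Cr where "Cr = {e \<in> E. (s e, t e) \<notin> conn E0}"
  have finP: "finite P" using assms(1) by (simp add: P_def)
  \<comment> \<open>\<open>F i \<inter> E0\<close> has the components of \<open>E0\<close>, hence at
    least \<open>card V - card P\<close> edges, out of fewer than \<open>card V\<close> edges of
    \<open>F i\<close>.\<close>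
  have card_i: "card (F i - E0) + 1 \<le> card P" if i: "i < k" for i
  proof -
    have fin: "finite (F i)" and fo: "forest (F i)" and sub: "F i \<subseteq> E"
      using F i assms(2) by (auto simp: packing_def intro: finite_subset)
    have "conn (F i \<inter> E0) = conn E0"
      using conn_i[OF i] conn_mono[of "F i \<inter> E0" E0] by blast
    then have "comps V (F i \<inter> E0) = P" by (simp add: comps_def P_def)
    then have "card V \<le> card P + card (F i \<inter> E0)"
      using card_comps_ge[of V "F i \<inter> E0"] assms(1) fin sub ends by auto
    moreover have "card (F i) < card V"
      using forest_card_less[of V "F i"] assms(1) V fin sub ends fo by blast
    moreover have "card (F i) = card (F i \<inter> E0) + card (F i - E0)"
      using fin by (metis card_Int_Diff)
    ultimately show ?thesis by linarith
  qed
  \<comment> \<open>A crossing edge lies outside \<open>E0\<close>, but an edge uncovered by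
    \<open>F\<close> itself would belong to \<open>E0\<close>.\<close>
  have "Cr \<subseteq> (\<Union>i<k. F i - E0)"
  proof
    fix e assume e: "e \<in> Cr"
    then have "e \<notin> E0" using conn_edge[of e E0] by (auto simp: Cr_def)
    then have "e \<in> (\<Union>i<k. F i)" using e exch.base[of E k F] by (auto simp: Cr_def E0_def)
    then show "e \<in> (\<Union>i<k. F i - E0)" using \<open>e \<notin> E0\<close> by blast
  qed
  then have "card Cr \<le> card (\<Union>i<k. F i - E0)"
    using F assms(2) by (intro card_mono) (auto simp: packing_def intro: finite_subset)
  also have "\<dots> \<le> (\<Sum>i<k. card (F i - E0))" by (rule card_UN_le) simp
  also have "\<dots> \<le> (\<Sum>i<k. card P - 1)" using card_i by (intro sum_mono) fastforce
  finally have up: "card Cr \<le> k * (card P - 1)" by simp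
  have PV: "C \<subseteq> V" "C \<noteq> {}" if "C \<in> P" for C
  proof -
    obtain v where "v \<in> V" "C = conn E0 `` {v} \<inter> V"
      using \<open>C \<in> P\<close> by (auto simp: P_def comps_def)
    moreover from this have "v \<in> C" by simp
    ultimately show "C \<subseteq> V" "C \<noteq> {}" by blast+
  qed
  have "card P \<le> 1"
  proof (rule ccontr)
    assume "\<not> card P \<le> 1"
    then have P2: "card P \<ge> 2" by simp
    \<comment> \<open>Double counting of the cuts of all components: only edges of \<open>Cr\<close>
      occur, each in at most two of these cuts.\<close>
    have "(\<Sum>C\<in>P. 2 * k) \<le> (\<Sum>C\<in>P. card (cut E C))"
    proof (rule sum_mono)
      fix C assume C: "C \<in> P"
      have "C \<noteq> V"
      proof
        assume "C = V"
        have "D = V" if "D \<in> P" for D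
        proof -
          obtain u where u: "u \<in> V" "D = conn E0 `` {u} \<inter> V" using \<open>D \<in> P\<close> by (auto simp: P_def comps_def)
          obtain w where w: "w \<in> V" "V = conn E0 `` {w} \<inter> V" using C \<open>C = V\<close> by (auto simp: P_def comps_def)
          then have "(w, u) \<in> conn E0" using u by blast
          then show ?thesis using u w class_eq_iff[of w V u E0] by simp
        qed
        then have "P \<subseteq> {V}" by blast
        then show False using P2 card_mono[of "{V}" P] by simp
      qed
      then show "2 * k \<le> card (cut E C)" using cuts PV[OF C] by blast
    qed
    also have "\<dots> = (\<Sum>C\<in>P. \<Sum>e\<in>E. of_bool ((s e \<in> C) \<noteq> (t e \<in> C)))"
      using assms(2) by (intro sum.cong refl) (simp add: cut_def sum.If_cases Int_def of_bool_def)
    also have "\<dots> = (\<Sum>e\<in>E. \<Sum>C\<in>P. of_bool ((s e \<in> C) \<noteq> (t e \<in> C)))"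
      by (rule sum.swap)
    also have "\<dots> \<le> (\<Sum>e\<in>E. if e \<in> Cr then 2 else 0)"
    proof (rule sum_mono)
      fix e assume e: "e \<in> E"
      have cl: "C = conn E0 `` {u} \<inter> V" if "C \<in> P" "u \<in> C" for C u
        using that class_eq_iff[of _ V u E0] by (auto simp: P_def comps_def)
      have "(\<Sum>C\<in>P. of_bool ((s e \<in> C) \<noteq> (t e \<in> C))) = card {C \<in> P. (s e \<in> C) \<noteq> (t e \<in> C)}"
        using finP by (simp add: sum.If_cases Int_def of_bool_def)
      also have "\<dots> \<le> (if e \<in> Cr then 2 else 0)"
      proof (cases "e \<in> Cr")
        case True
        have "{C \<in> P. (s e \<in> C) \<noteq> (t e \<in> C)} \<subseteq> {conn E0 `` {s e} \<inter> V, conn E0 `` {t e} \<inter> V}"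
          using cl by blast
        then have "card {C \<in> P. (s e \<in> C) \<noteq> (t e \<in> C)} \<le> card {conn E0 `` {s e} \<inter> V, conn E0 `` {t e} \<inter> V}"
          by (intro card_mono) auto
        also have "\<dots> \<le> 2" by (simp add: card_insert_if)
        finally show ?thesis using True by simp
      next
        case False
        then have st: "(s e, t e) \<in> conn E0" using e by (auto simp: Cr_def)
        have "(s e \<in> C) = (t e \<in> C)" if C: "C \<in> P" for C
        proof -
          obtain u where "C = conn E0 `` {u} \<inter> V" using C by (auto simp: P_def comps_def)
          then show ?thesis using ends[OF e] conn_trans[OF _ st] conn_trans[OF _ conn_sym[OF st]] by auto
        qed
        then have "{C \<in> P. (s e \<in> C) \<noteq> (t e \<in> C)} = {}" by auto
        then show ?thesis by (simp only: card.empty)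
      qed
      finally show "(\<Sum>C\<in>P. of_bool ((s e \<in> C) \<noteq> (t e \<in> C))) \<le> (if e \<in> Cr then 2 else 0 :: nat)" .
    qed
    also have "\<dots> = 2 * card Cr"
      using assms(2) by (simp add: sum.If_cases Cr_def Int_def)
    finally have "card P * k \<le> card Cr" by simp
    also note up
    finally show False using P2 k by (cases "card P") auto
  qed
  have "spanning V (F i)" if i: "i < k" for i
    unfolding spanning_def
  proof (intro ballI)
    fix u v assume uv: "u \<in> V" "v \<in> V"
    have "conn E0 `` {u} \<inter> V = conn E0 `` {v} \<inter> V"
    proof (rule ccontr)
      assume ne: "conn E0 `` {u} \<inter> V \<noteq> conn E0 `` {v} \<inter> V"
      have "{conn E0 `` {u} \<inter> V, conn E0 `` {v} \<inter> V} \<subseteq> P" using uv by (auto simp: P_def comps_def)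
      then have "card {conn E0 `` {u} \<inter> V, conn E0 `` {v} \<inter> V} \<le> card P"
        using finP by (intro card_mono)
      then show False using ne \<open>card P \<le> 1\<close> by simp
    qed
    then have "(u, v) \<in> conn E0" using uv class_eq_iff by blast
    then show "(u, v) \<in> conn (F i)" using conn_i[OF i] conn_mono[of "F i \<inter> E0" "F i"] by blast
  qed
  then show ?thesis using that F by blast
qed

section \<open>Degree sums, parity and T-joins\<close>

lemma vol_empty [simp]: "vol {} S = 0"
  by (simp add: vol_def)

lemma vol_insert: "finite X \<Longrightarrow> e \<notin> X \<Longrightarrow>
    vol (insert e X) S = of_bool (s e \<in> S) + of_bool (t e \<in> S) + vol X S"
  by (simp add: vol_def)

lemma vol_nonneg: "0 \<le> vol X S"
  by (simp add: vol_def sum_nonneg)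

lemma vol_Un: "finite X \<Longrightarrow> finite Z \<Longrightarrow> X \<inter> Z = {} \<Longrightarrow> vol (X \<union> Z) S = vol X S + vol Z S"
  by (simp add: vol_def sum.union_disjoint)

lemma vol_mono: "finite Z \<Longrightarrow> X \<subseteq> Z \<Longrightarrow> vol X S \<le> vol Z S"
  unfolding vol_def by (rule sum_mono2) auto

lemma vol_diff: "finite X \<Longrightarrow> Z \<subseteq> X \<Longrightarrow> vol (X - Z) S = vol X S - vol Z S"
  by (simp add: vol_def sum_diff)

lemma vol_sum:
  assumes "finite S"
  shows "vol X S = (\<Sum>v\<in>S. vol X {v})"
proof -
  have *: "of_bool (a \<in> S) = (\<Sum>v\<in>S. of_bool (a \<in> {v}) :: int)" for a
    using assms by (simp add: of_bool_def)
  have "(\<Sum>v\<in>S. vol X {v}) = (\<Sum>e\<in>X. \<Sum>v\<in>S. of_bool (s e \<in> {v}) + of_bool (t e \<in> {v}))"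
    unfolding vol_def by (rule sum.swap)
  then show ?thesis by (simp only: vol_def sum.distrib *)
qed

lemma vol_all: "(\<And>e. e \<in> X \<Longrightarrow> s e \<in> V \<and> t e \<in> V) \<Longrightarrow> vol X V = 2 * int (card X)"
  by (simp add: vol_def)

lemma even_vol_sym_diff:
  assumes "finite J" and "finite K"
  shows "even (vol (sym_diff J K) S) \<longleftrightarrow> even (vol J S) = even (vol K S)"
proof -
  have "vol (sym_diff J K) S = vol (J - J \<inter> K) S + vol (K - J \<inter> K) S"
    using assms by (subst vol_Un[symmetric]) (auto intro: arg_cong[of _ _ "\<lambda>X. vol X S"])
  also have "\<dots> = vol J S + vol K S - 2 * vol (J \<inter> K) S"
    using assms by (simp add: vol_diff)
  finally show ?thesis by auto
qed

lemma handshake: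
  assumes "finite V" and "\<And>e. e \<in> X \<Longrightarrow> s e \<in> V \<and> t e \<in> V"
  shows "even (card {v \<in> V. odd (vol X {v})})"
proof -
  have "even (\<Sum>v\<in>V. vol X {v})"
    using vol_all[of X V] assms vol_sum[OF assms(1), of X] by simp
  then show ?thesis using assms(1) by (simp add: even_sum_iff)
qed

lemma path_join:
  assumes "finite X" and "(u, v) \<in> conn X"
  shows "\<exists>J\<subseteq>X. \<forall>w. odd (vol J {w}) \<longleftrightarrow> (w = u) \<noteq> (w = v)"
  using assms(2)
proof (induction rule: conn_induct)
  case refl
  show ?case by (intro exI[of _ "{}"]) auto
next
  case (step e x y)
  then obtain J where J: "J \<subseteq> X" "\<forall>w. odd (vol J {w}) \<longleftrightarrow> (w = u) \<noteq> (w = x)"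
    by auto
  have "finite J" using J(1) assms(1) finite_subset by auto
  have "odd (vol {e} {w}) \<longleftrightarrow> (w = x) \<noteq> (w = y)" for w
    using step(2) by (auto simp: vol_insert doubleton_eq_iff)
  then have "\<forall>w. odd (vol (sym_diff J {e}) {w}) \<longleftrightarrow> (w = u) \<noteq> (w = y)"
    using J(2) even_vol_sym_diff[OF \<open>finite J\<close>, of "{e}"] by auto
  moreover have "sym_diff J {e} \<subseteq> X" using J(1) step(1) by auto
  ultimately show ?case by blast
qed

text \<open>The members of \<open>T\<close> are paired off. Symmetric differences add parities, so
  each pair can be joined separately.\<close>

lemma T_join:
  assumes "finite X" and "spanning V X" and "finite T" and "T \<subseteq> V" and "even (card T)"
  shows "\<exists>J\<subseteq>X. \<forall>w. odd (vol J {w}) \<longleftrightarrow> w \<in> T"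
  using assms(3,4,5)
proof (induction T rule: finite_psubset_induct)
  case (psubset T)
  show ?case
  proof (cases "T = {}")
    case True
    then show ?thesis by (intro exI[of _ "{}"]) auto
  next
    case False
    then obtain u where u: "u \<in> T" by auto
    have "T \<noteq> {u}" using psubset.prems by auto
    then obtain v where v: "v \<in> T" "v \<noteq> u" using u by auto
    have cT: "card T = card (T - {u, v}) + 2"
    proof -
      have "card (T - {u, v}) = card T - card {u, v}"
        using u v by (intro card_Diff_subset) auto
      moreover have "card {u, v} \<le> card T" using u v psubset.hyps by (intro card_mono) auto
      ultimately show ?thesis using v by simp
    qed
    have "\<exists>J\<subseteq>X. \<forall>w. odd (vol J {w}) \<longleftrightarrow> w \<in> T - {u, v}"
      using u psubset.prems cT by (intro psubset.IH) auto
    then obtain J where J: "J \<subseteq> X" "\<forall>w. odd (vol J {w}) \<longleftrightarrow> w \<in> T - {u, v}" by blast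
    have "(u, v) \<in> conn X" using assms(2) u v psubset.prems by (auto simp: spanning_def)
    from path_join[OF assms(1) this]
    obtain K where K: "K \<subseteq> X" "\<forall>w. odd (vol K {w}) \<longleftrightarrow> (w = u) \<noteq> (w = v)"
      by (elim exE conjE) (rule that)
    have fin: "finite J" "finite K"
      using finite_subset[OF J(1) assms(1)] finite_subset[OF K(1) assms(1)] .
    have "odd (vol (sym_diff J K) {w}) \<longleftrightarrow> w \<in> T" for w
      using J(2) K(2) u v even_vol_sym_diff[OF fin, of "{w}"] by auto
    moreover have "sym_diff J K \<subseteq> X" using J K by auto
    ultimately show ?thesis by blast
  qed
qed

lemma vol_nonzero_edge: "vol X {v} \<noteq> 0 \<Longrightarrow> \<exists>e\<in>X. s e = v \<or> t e = v"
proof (rule ccontr)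
  assume "vol X {v} \<noteq> 0" and "\<not> (\<exists>e\<in>X. s e = v \<or> t e = v)"
  then show False unfolding vol_def by (auto intro: sum.neutral)
qed

end

section \<open>Balanced labels along Euler tours\<close>

context mgraph begin

text \<open>Pairs \<open>(e, b)\<close> are darts, edges with a direction of traversal. A trail is a
  walk \<open>ds\<close> with \<open>distinct (map fst ds)\<close>: no edge is repeated, in whatever
  direction.\<close>

definition dtail :: "'e \<times> bool \<Rightarrow> 'v" where
  "dtail d = (if snd d then s (fst d) else t (fst d))"

definition dhead :: "'e \<times> bool \<Rightarrow> 'v" where
  "dhead d = (if snd d then t (fst d) else s (fst d))"

fun walk :: "'v \<Rightarrow> ('e \<times> bool) list \<Rightarrow> 'v \<Rightarrow> bool" where
  "walk u [] v \<longleftrightarrow> u = v"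
| "walk u (d # ds) v \<longleftrightarrow> dtail d = u \<and> walk (dhead d) ds v"

lemma walk_append: "walk u (xs @ ys) v \<longleftrightarrow> (\<exists>w. walk u xs w \<and> walk w ys v)"
  by (induction xs arbitrary: u) auto

lemma walk_parity:
  assumes "walk u ds v" and "distinct (map fst ds)"
  shows "even (vol (fst ` set ds) {w}) \<longleftrightarrow> (w = u) = (w = v)"
  using assms
proof (induction ds arbitrary: u)
  case (Cons d ds)
  have "vol (fst ` set (d # ds)) {w}
      = of_bool (dtail d = w) + of_bool (dhead d = w) + vol (fst ` set ds) {w}"
    using Cons.prems(2) by (auto simp: vol_insert dtail_def dhead_def)
  moreover have "even (vol (fst ` set ds) {w}) \<longleftrightarrow> (w = dhead d) = (w = v)"
    using Cons by auto
  moreover have "dtail d = u" using Cons.prems by auto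
  ultimately show ?case by auto
qed auto

lemma closed_euler_walk:
  assumes "finite E" and ev: "\<And>v. even (vol E {v})"
    and con: "\<And>e f. e \<in> E \<Longrightarrow> f \<in> E \<Longrightarrow> (s e, s f) \<in> conn E"
  shows "\<exists>u ds. walk u ds u \<and> distinct (map fst ds) \<and> fst ` set ds = E"
proof -
  define tr where "tr ds \<longleftrightarrow> (\<exists>u v. walk u ds v) \<and> distinct (map fst ds) \<and> fst ` set ds \<subseteq> E" for ds
  have "tr []" by (auto simp: tr_def)
  moreover have "length ds \<le> card E" if "tr ds" for ds
  proof -
    have "length ds = card (fst ` set ds)"
      using that distinct_card[of "map fst ds"] by (simp add: tr_def)
    then show ?thesis using that assms(1) by (simp add: tr_def card_mono)
  qed
  ultimately have "\<exists>ds. tr ds \<and> (\<forall>ds'. tr ds' \<longrightarrow> length ds' \<le> length ds)"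
    by (intro ex_has_greatest_nat[of _ "[]" _ "Suc (card E)"]) (auto simp: less_Suc_eq_le)
  then obtain ds where ds: "tr ds" and max: "\<And>ds'. tr ds' \<Longrightarrow> length ds' \<le> length ds"
    by auto
  obtain u v where w: "walk u ds v" and dist: "distinct (map fst ds)" and sub: "fst ` set ds \<subseteq> E"
    using ds by (auto simp: tr_def)
  let ?U = "fst ` set ds"
  have no_ext: False if "walk a xs b" "distinct (map fst xs)" "fst ` set xs = ?U" "length xs = length ds"
    "e \<in> E - ?U" "s e = b \<or> t e = b" for a b xs e
  proof -
    define d where "d = (e, s e = b)"
    have "dtail d = b" using that(6) by (auto simp: d_def dtail_def)
    then have "walk a (xs @ [d]) (dhead d)" using that(1) by (auto simp: walk_append)
    moreover have "fst ` set (xs @ [d]) \<subseteq> E" using that(3,5) sub by (simp add: d_def)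
    moreover have "distinct (map fst (xs @ [d]))" using that(2,3,5) by (simp add: d_def)
    ultimately have "tr (xs @ [d])" unfolding tr_def by blast
    then show False using max[of "xs @ [d]"] that(4) by simp
  qed
  have uv: "u = v"
  proof (rule ccontr)
    assume "u \<noteq> v"
    then have "odd (vol ?U {v})" using walk_parity[OF w dist, of v] by auto
    then have "vol (E - ?U) {v} \<noteq> 0" using ev[of v] vol_diff[OF assms(1) sub, of "{v}"] by auto
    then obtain e where "e \<in> E - ?U" "s e = v \<or> t e = v" using vol_nonzero_edge by blast
    then show False using no_ext[OF w dist] by auto
  qed
  have "?U = E"
  proof (rule ccontr)
    assume "?U \<noteq> E"
    then obtain e where e: "e \<in> E - ?U" using sub by blast
    show False
    proof (cases "ds = []")
      case True
      then show False using no_ext[of "s e" "[]" "s e" e] e by auto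
    next
      case False
      \<comment> \<open>Tails suffice, because in a closed trail every head is the tail of the next
        dart.\<close>
      define Vis where "Vis = dtail ` set ds"
      have no_touch: "x \<notin> Vis" if f: "f \<in> E - ?U" "s f = x \<or> t f = x" for f x
      proof
        assume "x \<in> Vis"
        then obtain xs d ys where sp: "ds = xs @ d # ys" "dtail d = x"
          unfolding Vis_def by (metis imageE split_list)
        then have "walk u xs x" "walk x (d # ys) u"
          using w uv by (auto simp: walk_append)
        then have "walk x (d # ys @ xs) x" by (auto simp: walk_append)
        moreover have "distinct (map fst (d # ys @ xs))" using dist sp by auto
        ultimately show False using no_ext[of x "d # ys @ xs" x f] f sp by auto
      qed
      have heads: "dhead d \<in> Vis" if "d \<in> set ds" for d
      proof -
        obtain xs ys where sp: "ds = xs @ d # ys" using split_list[OF \<open>d \<in> set ds\<close>] by auto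
        show ?thesis
        proof (cases ys)
          case Nil
          then have "dhead d = u" using w uv sp by (auto simp: walk_append)
          moreover have "u \<in> Vis" using w \<open>ds \<noteq> []\<close> by (cases ds) (auto simp: Vis_def)
          ultimately show ?thesis by simp
        next
          case (Cons d' zs)
          then have "dhead d = dtail d'" using w sp by (auto simp: walk_append)
          then show ?thesis using sp Cons by (auto simp: Vis_def)
        qed
      qed
      have used_ends: "s f \<in> Vis \<and> t f \<in> Vis" if "f \<in> ?U" for f
      proof -
        obtain d where d: "d \<in> set ds" "f = fst d" using \<open>f \<in> ?U\<close> by auto
        then have "dtail d \<in> Vis" "dhead d \<in> Vis" using heads by (auto simp: Vis_def)
        then show ?thesis using d by (cases "snd d") (auto simp: dtail_def dhead_def)
      qed
      obtain d where "d \<in> set ds" using False by (cases ds) auto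
      then have f: "fst d \<in> ?U" by auto
      then have "(s (fst d), s e) \<in> conn E" using con sub e by blast
      then have "s e \<in> Vis"
      proof (induction rule: conn_induct)
        case refl
        show ?case using used_ends f by blast
      next
        case (step g x y)
        have "g \<in> ?U"
          using no_touch[of g x] step by (auto simp: doubleton_eq_iff)
        then show ?case using used_ends[of g] step by (auto simp: doubleton_eq_iff)
      qed
      then show False using no_touch[of e "s e"] e by blast
    qed
  qed
  then show ?thesis using w dist uv by blast
qed

text \<open>\<open>z\<close> is the label at the departure from \<open>u\<close>. The two labels at
  every passage cancel, so only those at the ends of the walk survive; from one departure to the
  next the sign flips exactly at the edges in \<open>\<tau>\<close>.\<close>

lemma walk_labels:
  fixes z :: int
  assumes "walk u ds v" and "distinct (map fst ds)" and "z \<in> {1, -1}"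
  shows "\<exists>x y. (\<forall>e\<in>fst ` set ds. x e \<in> {1, -1} \<and> y e = (if \<tau> e then x e else - x e)) \<and>
    (\<forall>w. (\<Sum>e\<in>fst ` set ds. x e * of_bool (s e = w) + y e * of_bool (t e = w))
      = z * of_bool (w = u) - z * (-1) ^ card {e \<in> fst ` set ds. \<tau> e} * of_bool (w = v))"
  using assms
proof (induction ds arbitrary: u z)
  case Nil
  then show ?case by auto
next
  case (Cons d ds)
  define e where "e = fst d"
  let ?U = "fst ` set ds"
  \<comment> \<open>The label at the next departure; the head of \<open>d\<close> therefore gets
    \<open>- z'\<close>.\<close>
  define z' where "z' = (if \<tau> e then - z else z)"
  have w: "walk (dhead d) ds v" "dtail d = u" and e: "e \<notin> ?U"
    using Cons.prems by (auto simp: e_def)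
  have "z' \<in> {1, -1}" using Cons.prems(3) by (auto simp: z'_def)
  have "distinct (map fst ds)" using Cons.prems(2) by simp
  from Cons.IH[OF w(1) this \<open>z' \<in> {1, -1}\<close>]
  obtain x y :: "'e \<Rightarrow> int" where xy: "\<forall>f\<in>?U. x f \<in> {1, -1} \<and> y f = (if \<tau> f then x f else - x f)"
    and sum: "\<forall>w. (\<Sum>f\<in>?U. x f * of_bool (s f = w) + y f * of_bool (t f = w))
      = z' * of_bool (w = dhead d) - z' * (-1) ^ card {f \<in> ?U. \<tau> f} * of_bool (w = v)"
    by (elim exE conjE) (rule that)
  define xe where "xe = (if snd d then z else - z')"
  define ye where "ye = (if snd d then - z' else z)"
  let ?x = "x(e := xe)" and ?y = "y(e := ye)"
  have 1: "\<forall>f\<in>fst ` set (d # ds). ?x f \<in> {1, -1} \<and> ?y f = (if \<tau> f then ?x f else - ?x f)"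
    using xy e Cons.prems(3) by (auto simp: e_def[symmetric] xe_def ye_def z'_def)
  have "(\<Sum>f\<in>fst ` set (d # ds). ?x f * of_bool (s f = w) + ?y f * of_bool (t f = w))
      = z * of_bool (w = u) - z * (-1) ^ card {f \<in> fst ` set (d # ds). \<tau> f} * of_bool (w = v)" for w
  proof -
    have U: "fst ` set (d # ds) = insert e ?U" by (simp add: e_def)
    have "(\<Sum>f\<in>insert e ?U. ?x f * of_bool (s f = w) + ?y f * of_bool (t f = w))
      = xe * of_bool (s e = w) + ye * of_bool (t e = w)
        + (\<Sum>f\<in>?U. ?x f * of_bool (s f = w) + ?y f * of_bool (t f = w))"
      using e by simp
    also have "(\<Sum>f\<in>?U. ?x f * of_bool (s f = w) + ?y f * of_bool (t f = w))
        = (\<Sum>f\<in>?U. x f * of_bool (s f = w) + y f * of_bool (t f = w))"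
      using e by (intro sum.cong) auto
    also have "xe * of_bool (s e = w) + ye * of_bool (t e = w)
        = z * of_bool (w = u) - z' * of_bool (w = dhead d)"
      using w(2) by (cases "snd d") (auto simp: xe_def ye_def dtail_def dhead_def e_def)
    also note spec[OF sum, of w]
    also have "z' * (-1) ^ card {f \<in> ?U. \<tau> f} = z * (-1) ^ card {f \<in> insert e ?U. \<tau> f}"
    proof (cases "\<tau> e")
      case True
      then have "{f \<in> insert e ?U. \<tau> f} = insert e {f \<in> ?U. \<tau> f}" by auto
      then show ?thesis using e True by (simp add: z'_def)
    next
      case False
      then have "{f \<in> insert e ?U. \<tau> f} = {f \<in> ?U. \<tau> f}" by auto
      then show ?thesis using False by (simp add: z'_def)
    qed
    finally show ?thesis unfolding U by simp
  qed
  then show ?case using 1 by blast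
qed

text \<open>Along a closed Euler trail, the label changes its sign at every passage through a vertex and
  along every edge outside \<open>\<tau>\<close>.\<close>

theorem balanced_labels:
  assumes "finite E" and "\<And>v. even (vol E {v})"
    and con: "\<forall>e\<in>E. \<forall>f\<in>E. (s e, s f) \<in> conn E"
    and "even (card {e \<in> E. \<tau> e})"
  shows "\<exists>x y :: 'e \<Rightarrow> int. (\<forall>e\<in>E. x e \<in> {1, -1}) \<and> (\<forall>e\<in>E. y e = (if \<tau> e then x e else - x e)) \<and>
    (\<forall>w. (\<Sum>e\<in>E. x e * of_bool (s e = w) + y e * of_bool (t e = w)) = 0)"
proof -
  obtain u ds where ds: "walk u ds u" "distinct (map fst ds)" "fst ` set ds = E"
    using closed_euler_walk[OF assms(1,2)] con by blast
  have "\<exists>x y :: 'e \<Rightarrow> int. (\<forall>e\<in>E. x e \<in> {1, -1} \<and> y e = (if \<tau> e then x e else - x e)) \<and>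
    (\<forall>w. (\<Sum>e\<in>E. x e * of_bool (s e = w) + y e * of_bool (t e = w))
      = 1 * of_bool (w = u) - 1 * (-1) ^ card {e \<in> E. \<tau> e} * of_bool (w = u))"
    by (rule walk_labels[OF ds(1,2), unfolded ds(3)]) simp
  then obtain x y :: "'e \<Rightarrow> int" where
    xy: "\<forall>e\<in>E. x e \<in> {1, -1} \<and> y e = (if \<tau> e then x e else - x e)"
    and sum: "\<forall>w. (\<Sum>e\<in>E. x e * of_bool (s e = w) + y e * of_bool (t e = w))
      = 1 * of_bool (w = u) - 1 * (-1) ^ card {e \<in> E. \<tau> e} * of_bool (w = u)"
    by (elim exE conjE) (rule that)
  have "(\<Sum>e\<in>E. x e * of_bool (s e = w) + y e * of_bool (t e = w)) = 0" for w
    using spec[OF sum, of w] assms(4) by simp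
  then show ?thesis using xy by blast
qed

end

text \<open>Carries connectivity over to auxiliary graphs with another type of edges, such as the
  sums \<open>X <+> J\<close> and \<open>W <+> T\<close>.\<close>

lemma conn_map:
  assumes "\<And>e. e \<in> X \<Longrightarrow> \<exists>f\<in>Z. s' f = s e \<and> t' f = t e"
  shows "mgraph.conn s t X \<subseteq> mgraph.conn s' t' Z"
proof -
  have "mgraph.link s t X \<subseteq> mgraph.link s' t' Z"
    unfolding mgraph.link_def using assms by fastforce
  then show ?thesis
    unfolding mgraph.conn_def by (rule rtrancl_mono)
qed

context mgraph begin

section \<open>Halving even graphs and bounding the defects\<close>

lemma sum_of_bool_vertices:
  fixes a b :: "'e \<Rightarrow> int"
  assumes "finite S"
  shows "(\<Sum>w\<in>S. \<Sum>e\<in>X. a e * of_bool (s e = w) + b e * of_bool (t e = w))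
    = (\<Sum>e\<in>X. a e * of_bool (s e \<in> S) + b e * of_bool (t e \<in> S))"
proof -
  have *: "(\<Sum>w\<in>S. of_bool (c = w) :: int) = of_bool (c \<in> S)" for c
    using assms by (simp add: of_bool_def)
  show ?thesis
    by (subst sum.swap) (simp only: sum.distrib sum_distrib_left[symmetric] *)
qed

text \<open>Selecting the edges of label 1 turns the deviation from one half into a sum of labels,
  each counted at both ends.\<close>

lemma vol_positive_labels:
  fixes x :: "'e \<Rightarrow> int"
  assumes "finite X" and "\<And>e. e \<in> X \<Longrightarrow> x e \<in> {1, -1}"
  shows "2 * vol {e \<in> X. x e = 1} S - vol X S
    = (\<Sum>e\<in>X. x e * of_bool (s e \<in> S) + x e * of_bool (t e \<in> S))"
proof -
  have "vol {e \<in> X. x e = 1} S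
    = (\<Sum>e\<in>X. if x e = 1 then of_bool (s e \<in> S) + of_bool (t e \<in> S) else 0)"
    unfolding vol_def using assms(1) by (simp add: sum.inter_filter)
  then have "2 * vol {e \<in> X. x e = 1} S - vol X S
    = (\<Sum>e\<in>X. 2 * (if x e = 1 then of_bool (s e \<in> S) + of_bool (t e \<in> S) else 0)
        - (of_bool (s e \<in> S) + of_bool (t e \<in> S)))"
    by (simp add: vol_def sum_subtractf sum_distrib_left)
  also have "\<dots> = (\<Sum>e\<in>X. x e * of_bool (s e \<in> S) + x e * of_bool (t e \<in> S))"
    using assms(2) by (intro sum.cong) fastforce+
  finally show ?thesis .
qed

lemma card_cut_eq_sum: "finite X \<Longrightarrow> int (card (cut X S)) = (\<Sum>e\<in>X. of_bool ((s e \<in> S) \<noteq> (t e \<in> S)))"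
  by (simp add: cut_def of_bool_def sum.inter_filter[symmetric])

text \<open>With all edges in \<open>\<tau>\<close>, labels alternate along a closed tour,
  consistently since its length is even. The edges of label 1 are every second edge of the
  tour.\<close>

lemma half:
  assumes "finite X" and "\<And>v. even (vol X {v})"
    and "\<forall>e\<in>X. \<forall>f\<in>X. (s e, s f) \<in> conn X" and "even (card X)"
  shows "\<exists>F\<subseteq>X. \<forall>v. 2 * vol F {v} = vol X {v}"
proof -
  have "even (card {e \<in> X. True})" using assms(4) by simp
  from balanced_labels[OF assms(1-3) this]
  obtain x y :: "'e \<Rightarrow> int" where x: "\<forall>e\<in>X. x e \<in> {1, -1}" and y: "\<forall>e\<in>X. y e = (if True then x e else - x e)"
    and sum: "\<forall>w. (\<Sum>e\<in>X. x e * of_bool (s e = w) + y e * of_bool (t e = w)) = 0"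
    by (elim exE conjE) (rule that)
  have "2 * vol {e \<in> X. x e = 1} {v} - vol X {v} = 0" for v
  proof -
    have "2 * vol {e \<in> X. x e = 1} {v} - vol X {v}
        = (\<Sum>e\<in>X. x e * of_bool (s e = v) + x e * of_bool (t e = v))"
      using vol_positive_labels[OF assms(1), of x "{v}"] x by simp
    also have "\<dots> = (\<Sum>e\<in>X. x e * of_bool (s e = v) + y e * of_bool (t e = v))"
      using y by (intro sum.cong) auto
    finally show ?thesis using sum by simp
  qed
  then have "\<forall>v. 2 * vol {e \<in> X. x e = 1} {v} = vol X {v}" by simp
  moreover have "{e \<in> X. x e = 1} \<subseteq> X" by blast
  ultimately show ?thesis by blast
qed

text \<open>A second copy of every edge of \<open>J\<close>, carrying opposite labels at its ends, makes all degrees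
  even; the labels of the copies are then an orientation of \<open>J\<close> whose net flow is the defect.\<close>

lemma half_join:
  assumes "finite X" and "J \<subseteq> X" and ev: "\<And>v. even (vol X {v}) = even (vol J {v})"
    and con: "\<forall>e\<in>X. \<forall>f\<in>X. (s e, s f) \<in> conn X" and "even (card X)"
  shows "\<exists>Z\<subseteq>X. \<forall>S. finite S \<longrightarrow> \<bar>2 * vol Z S - vol X S\<bar> \<le> int (card (cut J S))"
proof -
  define s' where "s' = case_sum s s"
  define t' where "t' = case_sum t t"
  \<comment> \<open>Only original edges lie in \<open>\<tau>\<close>, so the parity condition
    concerns \<open>card X\<close> alone.\<close>
  define \<tau> :: "'e + 'e \<Rightarrow> bool" where "\<tau> = case_sum (\<lambda>_. True) (\<lambda>_. False)"
  have finJ: "finite J" using assms(1,2) finite_subset by blast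
  have fin: "finite (X <+> J)" using assms(1) finJ by simp
  have vol': "mgraph.vol s' t' (X <+> J) S = vol X S + vol J S" for S
    unfolding mgraph.vol_def s'_def t'_def using assms(1) finJ by (simp add: sum.Plus)
  have "mgraph.conn s t X \<subseteq> mgraph.conn s' t' (X <+> J)"
    by (rule conn_map) (auto simp: s'_def t'_def intro!: bexI[of _ "Inl _"])
  moreover have "\<exists>h\<in>X. s' e = s h" if "e \<in> X <+> J" for e
    using that assms(2) by (auto simp: s'_def)
  ultimately have con': "\<forall>e\<in>X <+> J. \<forall>f\<in>X <+> J. (s' e, s' f) \<in> mgraph.conn s' t' (X <+> J)"
    using con by (metis subsetD)
  have "{e \<in> X <+> J. \<tau> e} = Inl ` X" by (auto simp: \<tau>_def)
  then have ct: "even (card {e \<in> X <+> J. \<tau> e})" using assms(5) by (simp add: card_image)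
  have ev': "even (mgraph.vol s' t' (X <+> J) {v})" for v using vol' ev by simp
  from mgraph.balanced_labels[OF fin ev' con' ct]
  obtain x y :: "'e + 'e \<Rightarrow> int" where x: "\<forall>e\<in>X <+> J. x e \<in> {1, -1}"
    and y: "\<forall>e\<in>X <+> J. y e = (if \<tau> e then x e else - x e)"
    and sum: "\<forall>w. (\<Sum>e\<in>X <+> J. x e * of_bool (s' e = w) + y e * of_bool (t' e = w)) = 0"
    by (elim exE conjE) (rule that)
  define Z where "Z = {e \<in> X. x (Inl e) = 1}"
  have "\<bar>2 * vol Z S - vol X S\<bar> \<le> int (card (cut J S))" if S: "finite S" for S
  proof -
    have "0 = (\<Sum>e\<in>X <+> J. x e * of_bool (s' e \<in> S) + y e * of_bool (t' e \<in> S))"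
      using mgraph.sum_of_bool_vertices[OF S, of x s' y t' "X <+> J"] sum by simp
    also have "\<dots> = (\<Sum>e\<in>X. x (Inl e) * of_bool (s e \<in> S) + y (Inl e) * of_bool (t e \<in> S))
        + (\<Sum>e\<in>J. x (Inr e) * of_bool (s e \<in> S) + y (Inr e) * of_bool (t e \<in> S))"
      using assms(1) finJ by (simp add: sum.Plus s'_def t'_def)
    also have "(\<Sum>e\<in>X. x (Inl e) * of_bool (s e \<in> S) + y (Inl e) * of_bool (t e \<in> S))
        = (\<Sum>e\<in>X. x (Inl e) * of_bool (s e \<in> S) + x (Inl e) * of_bool (t e \<in> S))"
    proof (intro sum.cong refl)
      fix e assume "e \<in> X"
      then have "y (Inl e) = x (Inl e)" using bspec[OF y InlI] by (simp add: \<tau>_def)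
      then show "x (Inl e) * of_bool (s e \<in> S) + y (Inl e) * of_bool (t e \<in> S)
        = x (Inl e) * of_bool (s e \<in> S) + x (Inl e) * of_bool (t e \<in> S)" by simp
    qed
    also have "\<dots> = 2 * vol Z S - vol X S"
      unfolding Z_def using x by (intro vol_positive_labels[OF assms(1), symmetric]) blast
    finally have "2 * vol Z S - vol X S
        = - (\<Sum>e\<in>J. x (Inr e) * of_bool (s e \<in> S) + y (Inr e) * of_bool (t e \<in> S))"
      by simp
    then have "\<bar>2 * vol Z S - vol X S\<bar>
        \<le> (\<Sum>e\<in>J. \<bar>x (Inr e) * of_bool (s e \<in> S) + y (Inr e) * of_bool (t e \<in> S)\<bar>)"
      using sum_abs by simp
    \<comment> \<open>Opposite labels cancel on a copy with both ends in \<open>S\<close>.\<close>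
    also have "\<dots> \<le> (\<Sum>e\<in>J. of_bool ((s e \<in> S) \<noteq> (t e \<in> S)))"
    proof (rule sum_mono)
      fix e assume "e \<in> J"
      then have "x (Inr e) \<in> {1, -1}" "y (Inr e) = - x (Inr e)"
        using bspec[OF x InrI] bspec[OF y InrI] by (auto simp: \<tau>_def)
      then show "\<bar>x (Inr e) * of_bool (s e \<in> S) + y (Inr e) * of_bool (t e \<in> S)\<bar>
          \<le> of_bool ((s e \<in> S) \<noteq> (t e \<in> S))"
        by auto
    qed
    finally show ?thesis using finJ by (simp add: card_cut_eq_sum)
  qed
  then have "\<forall>S. finite S \<longrightarrow> \<bar>2 * vol Z S - vol X S\<bar> \<le> int (card (cut J S))" by blast
  moreover have "Z \<subseteq> X" by (auto simp: Z_def)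
  ultimately show ?thesis by blast
qed

text \<open>A loop at every vertex of \<open>T\<close> shifts the degrees there by one. Since \<open>T\<close> lies on one side of
  the bipartition, the shifts form the net flow of an orientation of \<open>W\<close>.\<close>

lemma half_bipartite:
  assumes "finite W" and ev: "\<And>v. even (vol W {v})"
    and con: "\<forall>e\<in>W. \<forall>f\<in>W. (s e, s f) \<in> conn W"
    and conT: "\<forall>e\<in>W. \<forall>v\<in>T. (s e, v) \<in> conn W"
    and "W \<noteq> {}" and "even (card W)" and "finite T" and "even (card T)" and TA: "T \<subseteq> A"
    and bip: "\<And>e. e \<in> W \<Longrightarrow> (s e \<in> A) \<noteq> (t e \<in> A)"
  shows "\<exists>Z\<subseteq>W. (\<forall>v. 2 * vol Z {v} - vol W {v} \<in> (if v \<in> T then {2, -2} else {0})) \<and>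
    (\<forall>S. finite S \<longrightarrow> \<bar>2 * vol Z S - vol W S\<bar> \<le> int (card (cut W S)))"
proof -
  define s' where "s' = case_sum s id"
  define t' where "t' = case_sum t id"
  have fin: "finite (W <+> T)" using assms(1,7) by simp
  have ev': "even (mgraph.vol s' t' (W <+> T) {v})" for v
    unfolding mgraph.vol_def s'_def t'_def using assms(1,7) ev[of v, unfolded vol_def]
    by (simp add: sum.Plus even_sum_iff)
  have sub: "mgraph.conn s t W \<subseteq> mgraph.conn s' t' (W <+> T)"
    by (rule conn_map) (auto simp: s'_def t'_def intro!: bexI[of _ "Inl _"])
  have con': "\<forall>e\<in>W <+> T. \<forall>f\<in>W <+> T. (s' e, s' f) \<in> mgraph.conn s' t' (W <+> T)"
  proof (intro ballI)
    fix e f assume ef: "e \<in> W <+> T" "f \<in> W <+> T"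
    obtain g where g: "g \<in> W" using assms(5) by blast
    have "(s g, s' h) \<in> conn W" if "h \<in> W <+> T" for h
      using that bspec[OF con g] bspec[OF conT g] by (auto simp: s'_def)
    then have "(s' e, s' f) \<in> conn W" using ef conn_sym conn_trans by meson
    then show "(s' e, s' f) \<in> mgraph.conn s' t' (W <+> T)" using sub by blast
  qed
  have ct: "even (card {e \<in> W <+> T. True})" using assms by (simp add: card_Plus)
  from mgraph.balanced_labels[OF fin ev' con' ct]
  obtain x y :: "'e + 'v \<Rightarrow> int" where x: "\<forall>e\<in>W <+> T. x e \<in> {1, -1}"
    and y: "\<forall>e\<in>W <+> T. y e = (if True then x e else - x e)"
    and sum: "\<forall>w. (\<Sum>e\<in>W <+> T. x e * of_bool (s' e = w) + y e * of_bool (t' e = w)) = 0"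
    by (elim exE conjE) (rule that)
  define Z where "Z = {e \<in> W. x (Inl e) = 1}"
  define g where "g v = 2 * vol Z {v} - vol W {v}" for v
  have gS: "(\<Sum>v\<in>S. g v) = (\<Sum>e\<in>W. x (Inl e) * of_bool (s e \<in> S) + x (Inl e) * of_bool (t e \<in> S))"
    if "finite S" for S
  proof -
    have "(\<Sum>v\<in>S. g v) = 2 * vol Z S - vol W S"
      unfolding g_def using vol_sum[OF that, of Z] vol_sum[OF that, of W]
      by (simp add: sum_subtractf sum_distrib_left)
    then show ?thesis
      unfolding Z_def using vol_positive_labels[OF assms(1), of "\<lambda>e. x (Inl e)" S] x by auto
  qed
  have g: "g v = (if v \<in> T then - 2 * x (Inr v) else 0)" for v
  proof -
    have "0 = (\<Sum>e\<in>W <+> T. x e * of_bool (s' e = v) + y e * of_bool (t' e = v))"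
      using spec[OF sum, of v] by simp
    also have "\<dots> = (\<Sum>e\<in>W <+> T. x e * of_bool (s' e = v) + x e * of_bool (t' e = v))"
      using y by (intro sum.cong) auto
    also have "\<dots> = (\<Sum>e\<in>W. x (Inl e) * of_bool (s e = v) + x (Inl e) * of_bool (t e = v))
        + (\<Sum>u\<in>T. x (Inr u) * of_bool (u = v) + x (Inr u) * of_bool (u = v))"
      using assms(1,7) by (simp add: sum.Plus s'_def t'_def)
    also have "(\<Sum>u\<in>T. x (Inr u) * of_bool (u = v) + x (Inr u) * of_bool (u = v))
        = (\<Sum>u\<in>T. if u = v then 2 * x (Inr u) else 0)"
      by (intro sum.cong) auto
    also have "\<dots> = (if v \<in> T then 2 * x (Inr v) else 0)"
      using assms(7) by simp
    finally show ?thesis using gS[of "{v}"] by (simp split: if_splits)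
  qed
  have "\<bar>2 * vol Z S - vol W S\<bar> \<le> int (card (cut W S))" if S: "finite S" for S
  proof -
    \<comment> \<open>Defects occur only in \<open>A\<close>, so the part outside \<open>A\<close>
      may be subtracted instead of added. An edge inside \<open>S\<close> then contributes its label
      with both signs, as its ends are on different sides.\<close>
    have "(\<Sum>v\<in>S - A. g v) = 0" using g TA by (intro sum.neutral) auto
    moreover have "2 * vol Z S - vol W S = (\<Sum>v\<in>S. g v)"
      unfolding g_def using vol_sum[OF S, of Z] vol_sum[OF S, of W]
      by (simp add: sum_subtractf sum_distrib_left)
    moreover have "(\<Sum>v\<in>S. g v) = (\<Sum>v\<in>S \<inter> A. g v) + (\<Sum>v\<in>S - A. g v)"
      using S by (rule sum.Int_Diff)
    ultimately have "2 * vol Z S - vol W S = (\<Sum>v\<in>S \<inter> A. g v) - (\<Sum>v\<in>S - A. g v)" by simp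
    also have "\<dots> = (\<Sum>e\<in>W. x (Inl e) * (of_bool (s e \<in> S \<inter> A) + of_bool (t e \<in> S \<inter> A)
        - of_bool (s e \<in> S - A) - of_bool (t e \<in> S - A)))"
      using S by (simp add: gS sum_subtractf[symmetric] algebra_simps)
    finally have "\<bar>2 * vol Z S - vol W S\<bar> \<le> (\<Sum>e\<in>W. \<bar>x (Inl e) * (of_bool (s e \<in> S \<inter> A)
        + of_bool (t e \<in> S \<inter> A) - of_bool (s e \<in> S - A) - of_bool (t e \<in> S - A))\<bar>)"
      using sum_abs by simp
    also have "\<dots> \<le> (\<Sum>e\<in>W. of_bool ((s e \<in> S) \<noteq> (t e \<in> S)))"
    proof (rule sum_mono)
      fix e assume e: "e \<in> W"
      then have "x (Inl e) = 1 \<or> x (Inl e) = -1" using bspec[OF x InlI] by auto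
      then show "\<bar>x (Inl e) * (of_bool (s e \<in> S \<inter> A) + of_bool (t e \<in> S \<inter> A)
          - of_bool (s e \<in> S - A) - of_bool (t e \<in> S - A))\<bar> \<le> of_bool ((s e \<in> S) \<noteq> (t e \<in> S))"
        using bip[OF e] by (auto simp: abs_mult)
    qed
    finally show ?thesis using assms(1) by (simp add: card_cut_eq_sum)
  qed
  moreover have "2 * vol Z {v} - vol W {v} \<in> (if v \<in> T then {2, -2} else {0})" for v
  proof (cases "v \<in> T")
    case True
    then have "x (Inr v) = 1 \<or> x (Inr v) = -1" using bspec[OF x InrI] by auto
    then show ?thesis using g[of v] True by (auto simp: g_def)
  next
    case False
    then show ?thesis using g[of v] by (simp add: g_def)
  qed
  moreover have "Z \<subseteq> W" by (auto simp: Z_def)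
  ultimately show ?thesis by blast
qed

text \<open>Switching the side of every vertex of \<open>S\<close> replaces the cut of
  \<open>A\<close> by its symmetric difference with the cut of \<open>S\<close>. By maximality this
  gains nothing, so at least half of the cut of \<open>S\<close> lies in the cut of
  \<open>A\<close>.\<close>

lemma max_cut:
  assumes "finite V" and "finite E"
  obtains A where "A \<subseteq> V" and "\<And>S. S \<subseteq> V \<Longrightarrow> card (cut E S) \<le> 2 * card (cut (cut E A) S)"
proof -
  have "finite ((\<lambda>A. card (cut E A)) ` Pow V)" "(\<lambda>A. card (cut E A)) ` Pow V \<noteq> {}"
    using assms(1) by auto
  then obtain A where A: "A \<subseteq> V" and max: "\<And>B. B \<subseteq> V \<Longrightarrow> card (cut E B) \<le> card (cut E A)"
    using Max_in[of "(\<lambda>A. card (cut E A)) ` Pow V"] Max_ge[of "(\<lambda>A. card (cut E A)) ` Pow V"]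
    by (smt (verit) PowD PowI imageE imageI)
  have "card (cut E S) \<le> 2 * card (cut (cut E A) S)" if S: "S \<subseteq> V" for S
  proof -
    have fin: "finite (cut E A)" "finite (cut E S)" using assms(2) by (simp_all add: cut_def)
    have I: "cut (cut E A) S = cut E A \<inter> cut E S" by (auto simp: cut_def)
    have "cut E (sym_diff A S) = sym_diff (cut E A) (cut E S)" by (auto simp: cut_def)
    then have "card (sym_diff (cut E A) (cut E S)) \<le> card (cut E A)"
      using max[of "sym_diff A S"] A S by auto
    moreover have "card (sym_diff (cut E A) (cut E S)) = card (cut E A - cut E S) + card (cut E S - cut E A)"
      using fin by (intro card_Un_disjoint) auto
    moreover have "card (cut E A) = card (cut E A \<inter> cut E S) + card (cut E A - cut E S)"
      using fin by (simp add: card_Int_Diff)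
    moreover have "card (cut E S) = card (cut E A \<inter> cut E S) + card (cut E S - cut E A)"
      using fin by (metis Int_commute card_Int_Diff)
    ultimately show ?thesis unfolding I by linarith
  qed
  then show ?thesis using that A by blast
qed

lemma vol_inside:
  assumes "finite X"
  shows "vol X S = 2 * int (card {e \<in> X. s e \<in> S \<and> t e \<in> S}) + int (card (cut X S))"
proof -
  have "int (card {e \<in> X. s e \<in> S \<and> t e \<in> S}) = (\<Sum>e\<in>X. of_bool (s e \<in> S \<and> t e \<in> S))"
    using assms by (simp add: of_bool_def sum.inter_filter[symmetric])
  then show ?thesis
    unfolding vol_def card_cut_eq_sum[OF assms] by (simp only: sum_distrib_left sum.distrib[symmetric])
      (intro sum.cong, auto)
qed

lemma spanning_forest_card:
  assumes "finite V" and "V \<noteq> {}" and "finite X" and "\<And>e. e \<in> X \<Longrightarrow> s e \<in> V \<and> t e \<in> V"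
    and "forest X" and "spanning V X"
  shows "card X + 1 = card V"
proof -
  have "comps V X \<subseteq> {V}" using assms(6) by (auto simp: comps_def spanning_def)
  then have "card (comps V X) \<le> 1" using card_mono[of "{V}"] by simp
  then have "card V \<le> card X + 1" using card_comps_ge[OF assms(1,3,4)] by linarith
  then show ?thesis using forest_card_less[OF assms(1-5)] by simp
qed

lemma forest_inside_less:
  assumes "finite S" and "S \<noteq> {}" and "finite X" and "forest X"
  shows "card {e \<in> X. s e \<in> S \<and> t e \<in> S} < card S"
  using assms forest_subset[OF assms(4), of "{e \<in> X. s e \<in> S \<and> t e \<in> S}"]
  by (intro forest_card_less) auto

text \<open>For nonempty proper \<open>S\<close>, the forest \<open>X\<close> has at most
  \<open>card S - 1\<close> edges inside \<open>S\<close>. The tree \<open>Z\<close> has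
  \<open>card V - 1\<close> edges, at most \<open>card (V - S) - 1\<close> of them inside
  \<open>V - S\<close>, hence at least \<open>card S - card (cut Z S)\<close> inside
  \<open>S\<close>. For \<open>S = V\<close> both volumes agree.\<close>

lemma trees_vol_le:
  assumes "finite V" and "S \<subseteq> V" and X: "finite X" "forest X" "spanning V X"
    "\<And>e. e \<in> X \<Longrightarrow> s e \<in> V \<and> t e \<in> V"
    and Z: "finite Z" "forest Z" "spanning V Z" "\<And>e. e \<in> Z \<Longrightarrow> s e \<in> V \<and> t e \<in> V"
  shows "vol X S - vol Z S \<le> int (card (cut X S)) + int (card (cut Z S))"
proof (cases "S = {} \<or> S = V")
  case True
  have "vol X V = vol Z V" if "V \<noteq> {}"
    using spanning_forest_card[of V X] spanning_forest_card[of V Z] assms that vol_all[of X V] vol_all[of Z V]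
    by simp
  moreover have "vol X {} = 0" "vol Z {} = 0" by (simp_all add: vol_def)
  ultimately show ?thesis using True by (cases "V = {}") auto
next
  case False
  have finS: "finite S" "finite (V - S)" using assms(1,2) finite_subset by auto
  let ?in = "\<lambda>X S. {e \<in> X. s e \<in> S \<and> t e \<in> S}"
  have a: "card (?in X S) < card S" using forest_inside_less[of S X] X finS False by blast
  have b: "card (?in Z (V - S)) < card (V - S)"
    using forest_inside_less[of "V - S" Z] Z finS False assms(2) by blast
  have "Z = ?in Z S \<union> (cut Z S \<union> ?in Z (V - S))" using Z(4) by (auto simp: cut_def)
  then have "card Z = card (?in Z S) + (card (cut Z S) + card (?in Z (V - S)))"
    using Z(1) by (subst card_Un_disjoint[symmetric] | auto simp: cut_def)+
  moreover have "card Z + 1 = card V"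
    using spanning_forest_card[of V Z] assms(1) Z False assms(2) by blast
  moreover have "card V = card S + card (V - S)"
    using assms(1,2) by (metis card_Diff_subset card_mono finS(1) le_add_diff_inverse)
  ultimately have "card S \<le> card (?in Z S) + card (cut Z S)" using b by linarith
  then show ?thesis using a vol_inside[OF X(1), of S] vol_inside[OF Z(1), of S] by linarith
qed

end

section \<open>Hall's theorem\<close>

text \<open>A tight proper subfamily is matched separately, and the rest keeps Hall's condition
  after removal of its union. If there is none, every nonempty proper subfamily has an element to
  spare, so one value may be fixed arbitrarily.\<close>

lemma hall:
  assumes "finite I" and "\<And>i. i \<in> I \<Longrightarrow> finite (A i)"
    and "\<And>K. K \<subseteq> I \<Longrightarrow> card K \<le> card (\<Union>i\<in>K. A i)"
  shows "\<exists>f. inj_on f I \<and> (\<forall>i\<in>I. f i \<in> A i)"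
  using assms
proof (induction I arbitrary: A rule: finite_psubset_induct)
  case (psubset I)
  consider "I = {}" | (tight) K where "K \<subset> I" "K \<noteq> {}" "card (\<Union>i\<in>K. A i) = card K"
    | (slack) "I \<noteq> {}" "\<And>K. K \<subset> I \<Longrightarrow> K \<noteq> {} \<Longrightarrow> card K < card (\<Union>i\<in>K. A i)"
    using psubset.prems(2) by (metis le_neq_implies_less psubset_imp_subset)
  then show ?case
  proof cases
    case 1
    then show ?thesis by simp
  next
    case tight
    let ?U = "\<Union>i\<in>K. A i"
    have "\<exists>f. inj_on f K \<and> (\<forall>i\<in>K. f i \<in> A i)"
      using tight(1) by (intro psubset.IH psubset.prems) auto
    then obtain f where f: "inj_on f K" "\<forall>i\<in>K. f i \<in> A i" by blast
    have "\<exists>g. inj_on g (I - K) \<and> (\<forall>i\<in>I - K. g i \<in> A i - ?U)"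
    proof (rule psubset.IH)
      show "I - K \<subset> I" using tight by auto
      show "finite (A i - ?U)" if "i \<in> I - K" for i using that psubset.prems(1) by auto
      fix L assume L: "L \<subseteq> I - K"
      have fins: "finite L" "finite K" using L tight(1) psubset.hyps finite_subset by blast+
      have "card L + card K = card (L \<union> K)" using L fins by (intro card_Un_disjoint[symmetric]) auto
      also have "\<dots> \<le> card (\<Union>i\<in>L \<union> K. A i)" using L tight(1) by (intro psubset.prems(2)) auto
      also have "(\<Union>i\<in>L \<union> K. A i) = (\<Union>i\<in>L. A i - ?U) \<union> ?U" by auto
      also have "card \<dots> \<le> card (\<Union>i\<in>L. A i - ?U) + card ?U" by (rule card_Un_le)
      finally show "card L \<le> card (\<Union>i\<in>L. A i - ?U)" using tight(3) by simp
    qed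
    then obtain g where g: "inj_on g (I - K)" "\<forall>i\<in>I - K. g i \<in> A i - ?U" by blast
    let ?h = "\<lambda>i. if i \<in> K then f i else g i"
    have "inj_on ?h I"
    proof (rule inj_onI)
      fix i j assume ij: "i \<in> I" "j \<in> I" "?h i = ?h j"
      have ne: "f a \<noteq> g b" if "a \<in> K" "b \<in> I - K" for a b
        using bspec[OF f(2) that(1)] bspec[OF g(2) that(2)] that(1) by auto
      consider "i \<in> K" "j \<in> K" | "i \<in> K" "j \<in> I - K" | "i \<in> I - K" "j \<in> K" | "i \<in> I - K" "j \<in> I - K"
        using ij by blast
      then show "i = j"
      proof cases
        case 1
        then show ?thesis using ij(3) inj_onD[OF f(1)] by simp
      next
        case 2
        then show ?thesis using ij(3) ne[OF 2] by simp
      next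
        case 3
        then show ?thesis using ij(3) ne[OF 3(2,1)] by simp
      next
        case 4
        then show ?thesis using ij(3) inj_onD[OF g(1)] by simp
      qed
    qed
    moreover have "\<forall>i\<in>I. ?h i \<in> A i" using f g by auto
    ultimately show ?thesis by blast
  next
    case slack
    then obtain i where i: "i \<in> I" by blast
    have "card {i} \<le> card (\<Union>j\<in>{i}. A j)" using i by (intro psubset.prems(2)) auto
    then obtain x where x: "x \<in> A i" by fastforce
    have "\<exists>g. inj_on g (I - {i}) \<and> (\<forall>j\<in>I - {i}. g j \<in> A j - {x})"
    proof (rule psubset.IH)
      show "I - {i} \<subset> I" using i by auto
      show "finite (A j - {x})" if "j \<in> I - {i}" for j using that psubset.prems(1) by auto
      fix L assume L: "L \<subseteq> I - {i}"
      show "card L \<le> card (\<Union>j\<in>L. A j - {x})"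
      proof (cases "L = {}")
        case False
        have "L \<subset> I" using L i by blast
        then have "card L < card (\<Union>j\<in>L. A j)" using False slack(2) by blast
        moreover have "(\<Union>j\<in>L. A j - {x}) = (\<Union>j\<in>L. A j) - {x}" by auto
        moreover have "card (\<Union>j\<in>L. A j) \<le> card ((\<Union>j\<in>L. A j) - {x}) + 1"
          using diff_card_le_card_Diff[of "{x}" "\<Union>j\<in>L. A j"] by simp
        ultimately show ?thesis by simp
      qed simp
    qed
    then obtain g where g: "inj_on g (I - {i})" "\<forall>j\<in>I - {i}. g j \<in> A j - {x}" by blast
    have "inj_on (g(i := x)) I"
      using g by (auto simp: inj_on_def)
    moreover have "\<forall>j\<in>I. (g(i := x)) j \<in> A j" using g x by auto
    ultimately show ?thesis by blast
  qed
qed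

lemma card_fibre_sum:
  assumes "finite X" and "finite V" and "\<And>e. e \<in> X \<Longrightarrow> h e \<in> V"
  shows "(\<Sum>v\<in>V. card {e \<in> X. h e = v}) = card X"
proof -
  have "X = (\<Union>v\<in>V. {e \<in> X. h e = v})" using assms(3) by auto
  then have "card X = card (\<Union>v\<in>V. {e \<in> X. h e = v})" by simp
  also have "\<dots> = (\<Sum>v\<in>V. card {e \<in> X. h e = v})"
    using assms(1,2) by (intro card_UN_disjoint) auto
  finally show ?thesis by simp
qed

text \<open>Hall's theorem for \<open>l v\<close> slots at every vertex \<open>v\<close>, to be
  filled with edges at \<open>v\<close>. Edges that fill no slot go to the end
  \<open>s e\<close>.\<close>

lemma (in mgraph) orientation_ge:
  assumes "finite V" and "finite E"
    and "\<And>S. S \<subseteq> V \<Longrightarrow> (\<Sum>v\<in>S. l v) \<le> card {e \<in> E. s e \<in> S \<or> t e \<in> S}"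
  shows "\<exists>own. (\<forall>e\<in>E. own e \<in> {s e, t e}) \<and> (\<forall>v\<in>V. l v \<le> card {e \<in> E. own e = v})"
proof -
  let ?I = "SIGMA v:V. {..<l v}"
  let ?A = "\<lambda>p. {e \<in> E. s e = fst p \<or> t e = fst p}"
  have "\<exists>f. inj_on f ?I \<and> (\<forall>p\<in>?I. f p \<in> ?A p)"
  proof (rule hall)
    show "finite ?I" using assms(1) by auto
    show "finite (?A p)" if "p \<in> ?I" for p using assms(2) by auto
    fix K assume K: "K \<subseteq> ?I"
    then have S: "fst ` K \<subseteq> V" by auto
    have "card K \<le> card (SIGMA v:fst ` K. {..<l v})"
      using K finite_subset[OF S assms(1)] by (intro card_mono finite_SigmaI) force+
    also have "\<dots> = (\<Sum>v\<in>fst ` K. l v)"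
      using finite_subset[OF S assms(1)] by simp
    also have "\<dots> \<le> card {e \<in> E. s e \<in> fst ` K \<or> t e \<in> fst ` K}" by (rule assms(3)[OF S])
    also have "{e \<in> E. s e \<in> fst ` K \<or> t e \<in> fst ` K} = (\<Union>p\<in>K. ?A p)" by force
    finally show "card K \<le> card (\<Union>p\<in>K. ?A p)" .
  qed
  then obtain f where f: "inj_on f ?I" "\<forall>p\<in>?I. f p \<in> ?A p" by blast
  define own where "own e = (if e \<in> f ` ?I then fst (the_inv_into ?I f e) else s e)" for e
  have own_f: "own (f p) = fst p" if "p \<in> ?I" for p
    using that f(1) by (simp add: own_def the_inv_into_f_f)
  have "own e \<in> {s e, t e}" if "e \<in> E" for e
  proof (cases "e \<in> f ` ?I")
    case True
    then obtain p where "p \<in> ?I" "e = f p" by blast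
    then show ?thesis using own_f[of p] bspec[OF f(2), of p] by auto
  qed (simp add: own_def)
  moreover have "l v \<le> card {e \<in> E. own e = v}" if v: "v \<in> V" for v
  proof -
    have "f ` ({v} \<times> {..<l v}) \<subseteq> {e \<in> E. own e = v}"
      using f(2) own_f v by auto
    moreover have "card (f ` ({v} \<times> {..<l v})) = l v"
      using v by (subst card_image[OF inj_on_subset[OF f(1)]]) auto
    ultimately show ?thesis using card_mono assms(2) by (metis (no_types, lifting) finite_Collect_conjI finite_subset mem_Collect_eq subsetI)
  qed
  ultimately show ?thesis by blast
qed

text \<open>The lower bounds already add up to \<open>card E\<close>, so none of them is
  exceeded.\<close>

lemma (in mgraph) orientation_eq:
  assumes "finite V" and "finite E" and ends: "\<And>e. e \<in> E \<Longrightarrow> s e \<in> V \<and> t e \<in> V"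
    and "\<And>S. S \<subseteq> V \<Longrightarrow> (\<Sum>v\<in>S. l v) \<le> card {e \<in> E. s e \<in> S \<or> t e \<in> S}"
    and "(\<Sum>v\<in>V. l v) = card E"
  shows "\<exists>own. (\<forall>e\<in>E. own e \<in> {s e, t e}) \<and> (\<forall>v\<in>V. card {e \<in> E. own e = v} = l v)"
proof -
  obtain own where own: "\<forall>e\<in>E. own e \<in> {s e, t e}" "\<forall>v\<in>V. l v \<le> card {e \<in> E. own e = v}"
    using orientation_ge[OF assms(1,2,4)] by blast
  have "(\<Sum>v\<in>V. card {e \<in> E. own e = v}) = card E"
    using own(1) ends assms(1,2) by (intro card_fibre_sum) fastforce+
  then have "\<not> (\<exists>v\<in>V. l v < card {e \<in> E. own e = v})"
    using sum_strict_mono_ex1[OF assms(1), of l "\<lambda>v. card {e \<in> E. own e = v}"] own(2) assms(5) by auto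
  then show ?thesis using own by (meson antisym not_le)
qed

text \<open>Hall's condition is immediate for all but the two largest sizes of slot sets, since a slot
  forbids at most two targets.\<close>

lemma slot_assignment:
  fixes m :: "'f \<Rightarrow> nat"
  assumes "finite Tg" and "finite Fs" and m: "\<And>f. f \<in> Fs \<Longrightarrow> m f \<in> {1, 2}"
    and sum: "(\<Sum>f\<in>Fs. m f) = card Tg"
    and forb: "\<And>f. f \<in> Fs \<Longrightarrow> finite (Forb f) \<and> card (Forb f) \<le> 2"
    and a: "\<And>a. a \<in> Tg \<Longrightarrow> \<exists>f\<in>Fs. a \<notin> Forb f"
    and b: "\<And>a a' f\<^sub>0. a \<in> Tg \<Longrightarrow> a' \<in> Tg \<Longrightarrow> a \<noteq> a' \<Longrightarrow> f\<^sub>0 \<in> Fs \<Longrightarrow>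
      \<exists>f\<in>Fs - {f\<^sub>0}. a \<notin> Forb f \<or> a' \<notin> Forb f"
  shows "\<exists>\<phi>. (\<forall>a\<in>Tg. \<phi> a \<in> Fs \<and> a \<notin> Forb (\<phi> a)) \<and> (\<forall>f\<in>Fs. card {a \<in> Tg. \<phi> a = f} = m f)"
proof -
  let ?I = "SIGMA f:Fs. {..<m f}"
  let ?A = "\<lambda>p. Tg - Forb (fst p)"
  have cI: "card ?I = card Tg" using assms(2) sum by simp
  have finI: "finite ?I" using assms(2) by auto
  have "\<exists>h. inj_on h ?I \<and> (\<forall>p\<in>?I. h p \<in> ?A p)"
  proof (rule hall)
    show "finite ?I" by (rule finI)
    show "finite (?A p)" for p using assms(1) by auto
    fix K assume K: "K \<subseteq> ?I"
    have fU: "finite (\<Union>p\<in>K. ?A p)" using assms(1) by (auto intro: finite_subset[of _ Tg])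
    have finK: "finite K" using K finI finite_subset by blast
    consider "K = {}" | (small) "K \<noteq> {}" "card K + 2 \<le> card ?I" | (all) "K = ?I"
      | (one) p where "p \<in> ?I" "K = ?I - {p}"
    proof -
      have "\<exists>p. p \<in> ?I \<and> K = ?I - {p}" if "K \<noteq> ?I" "\<not> card K + 2 \<le> card ?I"
      proof -
        have "card (?I - K) = card ?I - card K" using K finK by (intro card_Diff_subset)
        moreover have "card K < card ?I" using K that(1) finI by (intro psubset_card_mono) auto
        ultimately have "card (?I - K) = 1" using that(2) by linarith
        then obtain p where "?I - K = {p}" by (auto simp: card_1_singleton_iff)
        then show ?thesis using K by blast
      qed
      then show ?thesis using that by blast
    qed
    then show "card K \<le> card (\<Union>p\<in>K. ?A p)"
    proof cases
      case small
      then obtain p where p: "p \<in> K" by blast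
      \<comment> \<open>A single slot of \<open>K\<close> already reaches all but at most two
        targets.\<close>
      have "card Tg - card (Forb (fst p)) \<le> card (?A p)"
        using forb[of "fst p"] p K by (intro diff_card_le_card_Diff) auto
      also have "\<dots> \<le> card (\<Union>p\<in>K. ?A p)" using p fU by (intro card_mono) auto
      finally show ?thesis using small(2) cI forb[of "fst p"] p K by fastforce
    next
      case all
      have "Tg \<subseteq> (\<Union>p\<in>K. ?A p)"
      proof
        fix x assume x: "x \<in> Tg"
        then obtain f where f: "f \<in> Fs" "x \<notin> Forb f" using a by blast
        then have "(f, 0) \<in> K" using m[of f] all by auto
        then show "x \<in> (\<Union>p\<in>K. ?A p)" using x f by force
      qed
      then show ?thesis using all cI card_mono[OF fU] by fastforce
    next
      case (one p)
      obtain f0 k0 where p: "p = (f0, k0)" "f0 \<in> Fs" "k0 < m f0" using one(1) by auto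
      \<comment> \<open>Since \<open>m f\<close> is positive, every \<open>f\<close> other than
        \<open>f0\<close> keeps its slot 0. Whether \<open>f0\<close> keeps a slot depends on
        \<open>m f0\<close>, which is why \<open>b\<close> leaves one element out.\<close>
      have other: "(f, 0) \<in> K" if "f \<in> Fs" "f \<noteq> f0" for f
        using that m[of f] p one(2) by auto
      have uniq: "x = x'" if x: "x \<in> Tg - (\<Union>p\<in>K. ?A p)" "x' \<in> Tg - (\<Union>p\<in>K. ?A p)" for x x'
      proof (rule ccontr)
        assume ne: "x \<noteq> x'"
        have fb: "x \<in> Forb f \<and> x' \<in> Forb f" if "(f, k) \<in> K" for f k
          using x that by force
        obtain f where f: "f \<in> Fs - {f0}" "x \<notin> Forb f \<or> x' \<notin> Forb f"
          using b[of x x' f0] x ne p by blast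
        then show False using other[of f] fb by blast
      qed
      have "card (Tg - (\<Union>p\<in>K. ?A p)) \<le> 1"
        using uniq assms(1) by (intro card_le_Suc0_iff_eq[THEN iffD2, simplified One_nat_def[symmetric]]) auto
      moreover have "card Tg \<le> card (Tg - (\<Union>p\<in>K. ?A p)) + card (\<Union>p\<in>K. ?A p)"
      proof -
        have "Tg \<subseteq> (Tg - (\<Union>p\<in>K. ?A p)) \<union> (\<Union>p\<in>K. ?A p)" by blast
        then have "card Tg \<le> card ((Tg - (\<Union>p\<in>K. ?A p)) \<union> (\<Union>p\<in>K. ?A p))"
          using fU assms(1) by (intro card_mono) auto
        then show ?thesis using card_Un_le le_trans by blast
      qed
      moreover have "card K = card ?I - 1" using one finI by simp
      ultimately show ?thesis using cI by linarith
    qed simp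
  qed
  then obtain h where h: "inj_on h ?I" "\<forall>p\<in>?I. h p \<in> ?A p" by blast
  have "h ` ?I \<subseteq> Tg" using h(2) by blast
  moreover have "card (h ` ?I) = card Tg" using h(1) cI by (simp add: card_image)
  \<comment> \<open>There are as many slots as targets, so the injection is onto and its inverse is
    defined on all of \<open>Tg\<close>.\<close>
  ultimately have surj: "h ` ?I = Tg" using assms(1) by (simp add: card_subset_eq)
  define \<phi> where "\<phi> x = fst (the_inv_into ?I h x)" for x
  have \<phi>: "\<phi> (h p) = fst p" if "p \<in> ?I" for p
    using that h(1) by (simp add: \<phi>_def the_inv_into_f_f)
  have "\<phi> x \<in> Fs \<and> x \<notin> Forb (\<phi> x)" if "x \<in> Tg" for x
  proof -
    have "x \<in> h ` ?I" using that surj by simp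
    then obtain p where p: "x = h p" "p \<in> ?I" by (rule imageE)
    then have "\<phi> x = fst p" "fst p \<in> Fs" using \<phi>[OF p(2)] by auto
    moreover have "x \<notin> Forb (fst p)" using bspec[OF h(2) p(2)] p(1) by simp
    ultimately show ?thesis by simp
  qed
  moreover have "card {x \<in> Tg. \<phi> x = f} = m f" if f: "f \<in> Fs" for f
  proof -
    have "{x \<in> Tg. \<phi> x = f} = h ` ({f} \<times> {..<m f})"
    proof (intro equalityI subsetI)
      fix x assume x: "x \<in> {x \<in> Tg. \<phi> x = f}"
      then have "x \<in> h ` ?I" using surj by simp
      then obtain p where p: "x = h p" "p \<in> ?I" by (rule imageE)
      then have "fst p = f" using \<phi>[OF p(2)] x by simp
      then have "p \<in> {f} \<times> {..<m f}" using p(2) by auto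
      then show "x \<in> h ` ({f} \<times> {..<m f})" using p(1) by simp
    next
      fix x assume "x \<in> h ` ({f} \<times> {..<m f})"
      then obtain k where k: "k < m f" "x = h (f, k)" by auto
      then have p: "(f, k) \<in> ?I" using f by simp
      then have "x \<in> h ` ?I" unfolding k(2) by (rule imageI)
      then show "x \<in> {x \<in> Tg. \<phi> x = f}" using \<phi>[OF p] k(2) surj by simp
    qed
    moreover have "inj_on h ({f} \<times> {..<m f})"
      by (rule inj_on_subset[OF h(1)]) (use f in auto)
    ultimately show ?thesis by (simp add: card_image card_cartesian_product)
  qed
  ultimately show ?thesis by blast
qed

section \<open>A quarter of the edges\<close>

context mgraph begin

section \<open>Cuts, spanning sets and bipartite degree sums\<close>

lemma finite_cut [simp]: "finite X \<Longrightarrow> finite (cut X S)"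
  by (simp add: cut_def)

lemma cut_UNIV_ends: "(\<And>e. e \<in> X \<Longrightarrow> s e \<in> V \<and> t e \<in> V) \<Longrightarrow> cut X V = {}"
  by (auto simp: cut_def)

lemma card_cut_le_vol: "finite X \<Longrightarrow> int (card (cut X S)) \<le> vol X S"
  by (simp add: card_cut_eq_sum vol_def sum_mono of_bool_def)

lemma card_cut_Un:
  "finite X \<Longrightarrow> finite Z \<Longrightarrow> X \<inter> Z = {} \<Longrightarrow> card (cut (X \<union> Z) S) = card (cut X S) + card (cut Z S)"
proof -
  assume "finite X" "finite Z" "X \<inter> Z = {}"
  moreover have "cut (X \<union> Z) S = cut X S \<union> cut Z S" by (auto simp: cut_def)
  moreover have "cut X S \<inter> cut Z S \<subseteq> X \<inter> Z" by (auto simp: cut_def)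
  ultimately show ?thesis by (simp add: card_Un_disjoint)
qed

lemma card_cut_mono: "finite Z \<Longrightarrow> X \<subseteq> Z \<Longrightarrow> card (cut X S) \<le> card (cut Z S)"
  by (intro card_mono) (auto simp: cut_def)

lemma spanning_mono: "spanning V X \<Longrightarrow> X \<subseteq> Z \<Longrightarrow> spanning V Z"
  using conn_mono[of X Z] by (auto simp: spanning_def)

lemma vol_outside:
  assumes "\<And>e. e \<in> X \<Longrightarrow> s e \<in> V \<and> t e \<in> V" and "v \<notin> V"
  shows "vol X {v} = 0"
  unfolding vol_def using assms by (intro sum.neutral) auto

lemma spanning_vol_pos:
  assumes "finite X" and "spanning V X" and "v \<in> V" and "u \<in> V" and "u \<noteq> v"
  shows "1 \<le> vol X {v}"
proof (rule ccontr)
  assume "\<not> 1 \<le> vol X {v}"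
  then have "vol X {v} = 0" using vol_nonneg[of X "{v}"] by simp
  then have z: "s e \<noteq> v \<and> t e \<noteq> v" if "e \<in> X" for e
  proof -
    have "of_bool (s e \<in> {v}) + of_bool (t e \<in> {v}) \<le> vol X {v}"
      unfolding vol_def using that assms(1) by (intro member_le_sum) auto
    then show ?thesis using \<open>vol X {v} = 0\<close> by (auto simp: of_bool_def split: if_splits)
  qed
  have "(v, u) \<in> conn X" using assms by (auto simp: spanning_def)
  then have "u = v"
  proof (induction rule: conn_induct)
    case (step e x y)
    then show ?case using z[of e] by (auto simp: doubleton_eq_iff)
  qed simp
  then show False using assms(5) by simp
qed

text \<open>A T-join inside \<open>Z\<close> for the odd vertices of \<open>X\<close> repairs all
  parities.\<close>

lemma even_spanning:
  assumes "finite V" and "finite X" and "finite Z" and "X \<inter> Z = {}"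
    and "spanning V X" and "spanning V Z" and ends: "\<And>e. e \<in> X \<union> Z \<Longrightarrow> s e \<in> V \<and> t e \<in> V"
  obtains W where "X \<subseteq> W" and "W \<subseteq> X \<union> Z" and "\<And>v. even (vol W {v})"
proof -
  have endsX: "\<And>e. e \<in> X \<Longrightarrow> s e \<in> V \<and> t e \<in> V" using ends by blast
  define T where "T = {v \<in> V. odd (vol X {v})}"
  have "even (card T)" unfolding T_def using assms by (intro handshake) auto
  then obtain J where J: "J \<subseteq> Z" "\<forall>w. odd (vol J {w}) \<longleftrightarrow> w \<in> T"
    using T_join[OF assms(3,6), of T] assms(1) by (auto simp: T_def)
  have "even (vol (X \<union> J) {v})" for v
  proof -
    have "vol (X \<union> J) {v} = vol X {v} + vol J {v}"
      using assms(2,3,4) J(1) finite_subset by (intro vol_Un) auto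
    moreover have "odd (vol X {v}) \<longleftrightarrow> v \<in> T"
      using vol_outside[of X V v, OF endsX] by (cases "v \<in> V") (auto simp: T_def)
    ultimately show ?thesis using J(2) by auto
  qed
  then show ?thesis using that[of "X \<union> J"] J(1) by blast
qed

lemma vol_bipartite: "finite X \<Longrightarrow> (\<And>e. e \<in> X \<Longrightarrow> (s e \<in> A) \<noteq> (t e \<in> A)) \<Longrightarrow> vol X A = int (card X)"
proof -
  assume a: "finite X" "\<And>e. e \<in> X \<Longrightarrow> (s e \<in> A) \<noteq> (t e \<in> A)"
  then have "vol X A = (\<Sum>e\<in>X. 1)" unfolding vol_def by (intro sum.cong) auto
  then show ?thesis by simp
qed

text \<open>The degrees on one side of a bipartite graph add up to the number of edges.\<close>

lemma even_card_bipartite: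
  assumes "finite X" and "finite A" and "\<And>e. e \<in> X \<Longrightarrow> (s e \<in> A) \<noteq> (t e \<in> A)" and "\<And>v. even (vol X {v})"
  shows "even (card X)"
proof -
  have "even (vol X A)" unfolding vol_sum[OF assms(2)] using assms(4) by (simp add: dvd_sum)
  then show ?thesis using vol_bipartite[of X A] assms by simp
qed

lemma vol_UN:
  assumes "finite I" and "\<And>i. i \<in> I \<Longrightarrow> finite (F i)" and "disjoint_family_on F I"
  shows "vol (\<Union>i\<in>I. F i) S = (\<Sum>i\<in>I. vol (F i) S)"
  unfolding vol_def using assms by (intro sum.UNION_disjoint) (auto simp: disjoint_family_on_def)

text \<open>The 48 edge-disjoint trees \<open>F i\<close> consist of edges across the cut \<open>A\<close>. The selected half contains
  \<open>F 0\<close> (so it is connected) and avoids \<open>F 1\<close>. Degree parities on the two sides are corrected inside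
  two closed trails built from \<open>F 2\<close>, \<open>F 3\<close> and \<open>F 4\<close>, \<open>F 5\<close>. The path \<open>p\<close> balances the number of
  corrections on either side, and \<open>F 6\<close> connects the rest of the graph.\<close>

lemma even_connected_half:
  assumes finV: "finite V" and finE: "finite E" and ends: "\<And>e. e \<in> E \<Longrightarrow> s e \<in> V \<and> t e \<in> V"
    and V2: "2 \<le> card V"
    and cuts: "\<And>S. S \<subseteq> V \<Longrightarrow> S \<noteq> {} \<Longrightarrow> S \<noteq> V \<Longrightarrow> 191 \<le> card (cut E S)"
    and four: "4 dvd card E"
  obtains Z where "Z \<subseteq> E" and "spanning V Z" and "\<And>v. even (vol Z {v})"
    and "\<And>S. S \<subseteq> V \<Longrightarrow> \<bar>2 * vol Z S - vol E S\<bar> \<le> int (card (cut E S))"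
    and "\<And>v. v \<in> V \<Longrightarrow> 21 \<le> vol Z {v}"
proof -
  obtain A where AV: "A \<subseteq> V" and A: "\<And>S. S \<subseteq> V \<Longrightarrow> card (cut E S) \<le> 2 * card (cut (cut E A) S)"
    by (rule max_cut[OF finV finE]) (rule that)
  define H where "H = cut E A"
  have HE: "H \<subseteq> E" by (auto simp: H_def cut_def)
  have finH: "finite H" using HE finE finite_subset by blast
  have finA: "finite A" using AV finV finite_subset by blast
  have H_cuts: "2 * 48 \<le> card (cut H S)" if "S \<subseteq> V" "S \<noteq> {}" "S \<noteq> V" for S
    using A[OF that(1)] cuts[OF that] by (simp add: H_def)
  have endsH: "\<And>e. e \<in> H \<Longrightarrow> s e \<in> V \<and> t e \<in> V" using ends HE by blast
  obtain F where pF: "packing H 48 F" and spF: "\<And>i. i < 48 \<Longrightarrow> spanning V (F i)"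
    using tree_packing[OF finV finH endsH H_cuts] by blast
  have FH: "F i \<subseteq> H" and forF: "forest (F i)" if "i < 48" for i
    using pF that by (auto simp: packing_def)
  have D: "F i \<inter> F j = {}" if "i < 48" "j < 48" "i \<noteq> j" for i j
    using pF that by (simp add: packing_def disjoint_family_on_def)
  have finF: "finite (F i)" if "i < 48" for i using FH[OF that] finH finite_subset by blast
  have endsF: "s e \<in> V \<and> t e \<in> V" if "i < 48" "e \<in> F i" for i e using FH that endsH by blast
  have bipH: "(s e \<in> A) \<noteq> (t e \<in> A)" if "e \<in> H" for e using that by (auto simp: H_def cut_def)
  have DD: "F 0 \<inter> F 1 = {}" "F 0 \<inter> F 2 = {}" "F 0 \<inter> F 3 = {}" "F 0 \<inter> F 4 = {}" "F 0 \<inter> F 5 = {}"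
    "F 0 \<inter> F 6 = {}" "F 0 \<inter> F 7 = {}" "F 1 \<inter> F 2 = {}" "F 1 \<inter> F 3 = {}" "F 1 \<inter> F 4 = {}"
    "F 1 \<inter> F 5 = {}" "F 1 \<inter> F 6 = {}" "F 1 \<inter> F 7 = {}" "F 2 \<inter> F 3 = {}" "F 2 \<inter> F 4 = {}"
    "F 2 \<inter> F 5 = {}" "F 2 \<inter> F 6 = {}" "F 2 \<inter> F 7 = {}" "F 3 \<inter> F 4 = {}" "F 3 \<inter> F 5 = {}"
    "F 3 \<inter> F 6 = {}" "F 3 \<inter> F 7 = {}" "F 4 \<inter> F 5 = {}" "F 4 \<inter> F 6 = {}" "F 4 \<inter> F 7 = {}"
    "F 5 \<inter> F 6 = {}" "F 5 \<inter> F 7 = {}" "F 6 \<inter> F 7 = {}"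
    by (simp_all add: D)
  have ends23: "\<And>e. e \<in> F 2 \<union> F 3 \<Longrightarrow> s e \<in> V \<and> t e \<in> V" using endsF[of 2] endsF[of 3] by auto
  have ends45: "\<And>e. e \<in> F 4 \<union> F 5 \<Longrightarrow> s e \<in> V \<and> t e \<in> V" using endsF[of 4] endsF[of 5] by auto
  obtain W where W: "F 2 \<subseteq> W" "W \<subseteq> F 2 \<union> F 3" and evW: "\<And>v. even (vol W {v})"
    by (rule even_spanning[OF finV finF[of 2] finF[of 3] D[of 2 3] spF[of 2] spF[of 3] ends23])
      (rule that | simp)+
  obtain W' where W': "F 4 \<subseteq> W'" "W' \<subseteq> F 4 \<union> F 5" and evW': "\<And>v. even (vol W' {v})"
    by (rule even_spanning[OF finV finF[of 4] finF[of 5] D[of 4 5] spF[of 4] spF[of 5] ends45])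
      (rule that | simp)+
  have WH: "W \<subseteq> H" "W' \<subseteq> H" using W W' FH[of 2] FH[of 3] FH[of 4] FH[of 5] by auto
  have finW: "finite W" "finite W'" using WH finH finite_subset by blast+
  have cW: "even (card W)" "even (card W')"
    using even_card_bipartite[OF finW(1) finA _ evW] even_card_bipartite[OF finW(2) finA _ evW'] bipH WH
    by blast+
  \<comment> \<open>If \<open>H\<close> is not all of \<open>E\<close>, an edge \<open>e\<close> not
    crossing \<open>A\<close> and an adjacent crossing edge \<open>f\<close> form \<open>p\<close>.
    Choosing one of the two leaves a defect at the ends of the path only, which its cut bounds.
    Their contributions to the degree sum over \<open>A\<close> have different parity, so the choice
    can adjust that sum.\<close>
  obtain p where p: "p \<subseteq> (E - H) \<union> F 7" "even (card p)"
    and pcase: "E = H \<and> p = {} \<or> (\<exists>e f. p = {e, f} \<and> e \<in> E - H \<and> f \<in> F 7 \<and>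
      (\<forall>S. \<bar>vol {e} S - vol {f} S\<bar> \<le> int (card (cut {e, f} S))))"
  proof (cases "E = H")
    case True
    then show ?thesis using that[of "{}"] by simp
  next
    case False
    then obtain e where e: "e \<in> E - H" using HE by blast
    obtain u where u: "u \<in> V" "u \<noteq> t e"
    proof -
      have "\<not> V \<subseteq> {t e}" using V2 card_mono[of "{t e}" V] by auto
      then show ?thesis using that by blast
    qed
    have "1 \<le> vol (F 7) {t e}"
      using spanning_vol_pos[OF finF[of 7] spF[of 7], of "t e" u] u ends e by auto
    then have "vol (F 7) {t e} \<noteq> 0" by simp
    then obtain f where f: "f \<in> F 7" "s f = t e \<or> t f = t e"
      using vol_nonzero_edge[of "F 7" "t e"] by blast
    have ne: "e \<noteq> f" using e f FH[of 7] by auto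
    have "\<bar>vol {e} S - vol {f} S\<bar> \<le> int (card (cut {e, f} S))" for S
      unfolding card_cut_eq_sum[OF finite.insertI[OF finite.insertI[OF finite.emptyI]]]
      using ne f(2) by (auto simp: vol_def)
    then show ?thesis using that[of "{e, f}"] e f ne by auto
  qed
  have pE: "p \<subseteq> E" using p(1) FH[of 7] HE by auto
  have finp: "finite p" using pE finE finite_subset by blast
  define G where "G = E - (F 0 \<union> F 1 \<union> W \<union> W' \<union> p)"
  have finG: "finite G" using finE by (simp add: G_def)
  have GE: "G \<subseteq> E" by (auto simp: G_def)
  have U_E: "F 0 \<union> F 1 \<union> W \<union> W' \<union> p \<subseteq> E"
    using FH[of 0] FH[of 1] WH HE pE by auto
  have dis: "F 0 \<inter> F 1 = {}" "(F 0 \<union> F 1) \<inter> W = {}" "(F 0 \<union> F 1 \<union> W) \<inter> W' = {}"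
    "(F 0 \<union> F 1 \<union> W \<union> W') \<inter> p = {}" "(F 0 \<union> F 1 \<union> W \<union> W' \<union> p) \<inter> G = {}"
  proof -
    show "F 0 \<inter> F 1 = {}" by (rule DD)
    have "(F 0 \<union> F 1) \<inter> (F 2 \<union> F 3) = {}"
      by (simp add: Int_Un_distrib Int_Un_distrib2 DD del: One_nat_def)
    then show "(F 0 \<union> F 1) \<inter> W = {}" using W(2) by blast
    have "(F 0 \<union> F 1 \<union> (F 2 \<union> F 3)) \<inter> (F 4 \<union> F 5) = {}"
      by (simp add: Int_Un_distrib Int_Un_distrib2 DD del: One_nat_def)
    then show "(F 0 \<union> F 1 \<union> W) \<inter> W' = {}" using W(2) W'(2) by blast
    have "(F 0 \<union> F 1 \<union> (F 2 \<union> F 3) \<union> (F 4 \<union> F 5)) \<inter> F 7 = {}"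
      by (simp add: Int_Un_distrib Int_Un_distrib2 DD del: One_nat_def)
    then have "(F 0 \<union> F 1 \<union> W \<union> W') \<inter> F 7 = {}" using W(2) W'(2) by blast
    moreover have "F 0 \<union> F 1 \<union> W \<union> W' \<subseteq> H" using FH[of 0] FH[of 1] WH by auto
    ultimately show "(F 0 \<union> F 1 \<union> W \<union> W') \<inter> p = {}" using p(1) by blast
    show "(F 0 \<union> F 1 \<union> W \<union> W' \<union> p) \<inter> G = {}" by (auto simp: G_def)
  qed
  have E_eq: "E = F 0 \<union> F 1 \<union> W \<union> W' \<union> p \<union> G" using U_E by (auto simp: G_def)
  have fin01: "finite (F 0)" "finite (F 1)" by (simp_all add: finF)
  note fins = fin01 finW finp finG
  have volE: "vol E S = vol (F 0) S + vol (F 1) S + vol W S + vol W' S + vol p S + vol G S" for S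
    unfolding E_eq using fins dis by (simp add: vol_Un)
  have cutE: "card (cut E S) = card (cut (F 0) S) + card (cut (F 1) S) + card (cut W S)
      + card (cut W' S) + card (cut p S) + card (cut G S)" for S
    unfolding E_eq using fins dis by (simp add: card_cut_Un)
  have cardE: "card E = card (F 0) + card (F 1) + card W + card W' + card p + card G"
    unfolding E_eq using fins dis by (simp add: card_Un_disjoint)
  have Vne: "V \<noteq> {}" using V2 by auto
  have c01: "card (F 0) = card (F 1)"
    using spanning_forest_card[OF finV Vne finF[of 0] endsF[of 0] forF[of 0] spF[of 0]]
      spanning_forest_card[OF finV Vne finF[of 1] endsF[of 1] forF[of 1] spF[of 1]] by simp
  have evG: "even (card G)"
  proof -
    have "even (card E)" using four by auto
    then show ?thesis using cardE c01 cW p(2) by auto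
  qed
  have F6G: "F 6 \<subseteq> G"
  proof -
    have "(F 0 \<union> F 1 \<union> (F 2 \<union> F 3) \<union> (F 4 \<union> F 5)) \<inter> F 6 = {}"
      by (simp add: Int_Un_distrib Int_Un_distrib2 DD del: One_nat_def)
    then have "(F 0 \<union> F 1 \<union> W \<union> W') \<inter> F 6 = {}" using W(2) W'(2) by blast
    moreover have "F 6 \<inter> p = {}" using p(1) DD(28) FH[of 6] by auto
    ultimately show ?thesis using FH[of 6] HE by (auto simp: G_def)
  qed
  have endsG: "s e \<in> V \<and> t e \<in> V" if "e \<in> G" for e using that GE ends by blast
  obtain J where J: "J \<subseteq> F 6" "\<forall>w. odd (vol J {w}) \<longleftrightarrow> w \<in> {v \<in> V. odd (vol G {v})}"
    using T_join[OF finF[of 6] spF[of 6], of "{v \<in> V. odd (vol G {v})}"] finV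
      handshake[OF finV endsG] by auto
  have finJ: "finite J" using J(1) finF[of 6] finite_subset by auto
  have JG: "J \<subseteq> G" using J(1) F6G by blast
  have evGJ: "even (vol G {v}) = even (vol J {v})" for v
    using J(2) vol_outside[of G V v] endsG by (cases "v \<in> V") auto
  have conG: "\<forall>e\<in>G. \<forall>f\<in>G. (s e, s f) \<in> conn G"
    using spanning_mono[OF spF[of 6] F6G] endsG by (simp add: spanning_def)
  obtain K where KG: "K \<subseteq> G"
    and K: "\<forall>S. finite S \<longrightarrow> \<bar>2 * vol K S - vol G S\<bar> \<le> int (card (cut J S))"
    using half_join[OF finG JG evGJ conG evG] by blast
  have finK: "finite K" using KG finG finite_subset by blast
  have endsK: "\<And>e. e \<in> K \<Longrightarrow> s e \<in> V \<and> t e \<in> V" using KG endsG by blast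
  \<comment> \<open>At \<open>S = V\<close> the cut of \<open>J\<close> is empty, so
    \<open>K\<close> is exactly one half of \<open>G\<close>.\<close>
  have cK: "2 * card K = card G"
  proof -
    have "cut J V = {}" using JG endsG by (intro cut_UNIV_ends) blast
    then have "2 * vol K V = vol G V" using spec[OF K, of V] finV by simp
    then show ?thesis using vol_all[of K V, OF endsK] vol_all[of G V, OF endsG] by simp
  qed
  have sumA: "(\<Sum>v\<in>A. vol X {v}) = vol X A" for X using vol_sum[OF finA] by simp
  have divA: "(\<Sum>v\<in>A. (vol W {v} + vol W' {v}) div 2) = (int (card W) + int (card W')) div 2"
  proof -
    have "2 * (\<Sum>v\<in>A. (vol W {v} + vol W' {v}) div 2) = (\<Sum>v\<in>A. vol W {v} + vol W' {v})"
      unfolding sum_distrib_left using evW evW' by (intro sum.cong) auto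
    also have "\<dots> = int (card W) + int (card W')"
      using vol_bipartite[OF finW(1), of A] vol_bipartite[OF finW(2), of A] bipH WH
      by (simp add: sum.distrib sumA subset_iff)
    finally show ?thesis by simp
  qed
  \<comment> \<open>The degrees of the future \<open>Z\<close> if \<open>W\<close> and
    \<open>W'\<close> were halved exactly. Vertices with odd \<open>h\<close> need a correction by
    one, and a closed trail admits only an even number of them; hence \<open>P\<close> has to make
    the sum over \<open>A\<close> even.\<close>
  define h where "h P v = vol (F 0) {v} + vol K {v} + vol P {v} + (vol W {v} + vol W' {v}) div 2" for P v
  have hA: "(\<Sum>v\<in>A. h P v) = vol (F 0) A + vol K A + vol P A + (int (card W) + int (card W')) div 2" for P
    by (simp add: h_def sum.distrib sumA divA)
  obtain P where Pp: "P \<subseteq> p" and Pcut: "\<And>S. \<bar>2 * vol P S - vol p S\<bar> \<le> int (card (cut p S))"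
    and Pev: "even (\<Sum>v\<in>A. h P v)"
  proof -
    from pcase consider "E = H" "p = {}" | (path) e f where "p = {e, f}" "e \<in> E - H" "f \<in> F 7"
        "\<forall>S. \<bar>vol {e} S - vol {f} S\<bar> \<le> int (card (cut {e, f} S))"
      by blast
    then show ?thesis
    proof cases
      case 1
      have "vol (F 0) A = int (card (F 0))" "vol K A = int (card K)"
        using vol_bipartite[of _ A] bipH fin01 finK FH[of 0] KG GE 1(1) by (auto simp: subset_iff)
      \<comment> \<open>All edges cross \<open>A\<close>, so degree sums over \<open>A\<close> are
        edge counts, and divisibility by 4 settles the parity.\<close>
      then have "2 * (\<Sum>v\<in>A. h {} v) = int (card E)"
        using cW 1(2) cK cardE c01 by (simp add: hA)
      then have "even (\<Sum>v\<in>A. h {} v)" using four by presburger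
      then show ?thesis using that[of "{}"] 1 by simp
    next
      case path
      have ne: "e \<noteq> f" using path(2,3) FH[of 7] by auto
      have vp: "vol p S = vol {e} S + vol {f} S" for S using path(1) ne by (simp add: vol_def)
      have "even (vol {e} A)" using path(2) by (auto simp: H_def cut_def vol_def)
      moreover have "odd (vol {f} A)" using bipH[of f] path(3) FH[of 7] by (auto simp: vol_def)
      ultimately have "even (\<Sum>v\<in>A. h {e} v) \<or> even (\<Sum>v\<in>A. h {f} v)" unfolding hA by auto
      then obtain c where c: "c \<in> {e, f}" "even (\<Sum>v\<in>A. h {c} v)" by blast
      have "\<bar>2 * vol {c} S - vol p S\<bar> \<le> int (card (cut p S))" for S
      proof -
        have "c = e \<or> c = f" using c(1) by blast
        then show ?thesis using spec[OF path(4), of S] vp[of S] by (auto simp: path(1)[symmetric])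
      qed
      then show ?thesis using that[of "{c}"] c path(1) by blast
    qed
  qed
  have finP: "finite P" using Pp finp finite_subset by blast
  have endsP: "\<And>e. e \<in> P \<Longrightarrow> s e \<in> V \<and> t e \<in> V" using Pp pE ends by blast
  define B where "B = V - A"
  have finB: "finite B" using finV by (simp add: B_def)
  define T where "T = {v \<in> A. odd (h P v)}"
  define T' where "T' = {v \<in> B. odd (h P v)}"
  have cT: "even (card T)" using Pev finA by (simp add: T_def even_sum_iff)
  \<comment> \<open>The sum of \<open>h P\<close> over \<open>V\<close> is even, so the parity on
    \<open>B\<close> follows from that on \<open>A\<close>.\<close>
  have cT': "even (card T')"
  proof -
    have divV: "2 * (\<Sum>v\<in>V. (vol W {v} + vol W' {v}) div 2) = 2 * (int (card W) + int (card W'))"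
    proof -
      have "2 * (\<Sum>v\<in>V. (vol W {v} + vol W' {v}) div 2) = (\<Sum>v\<in>V. vol W {v} + vol W' {v})"
        unfolding sum_distrib_left using evW evW' by (intro sum.cong) auto
      also have "\<dots> = vol W V + vol W' V"
        using vol_sum[OF finV, of W] vol_sum[OF finV, of W'] by (simp add: sum.distrib)
      finally show ?thesis using vol_all[of W V] vol_all[of W' V] WH endsH by (simp add: subset_iff)
    qed
    have "(\<Sum>v\<in>V. h P v) = vol (F 0) V + vol K V + vol P V + (\<Sum>v\<in>V. (vol W {v} + vol W' {v}) div 2)"
      using vol_sum[OF finV] by (simp add: h_def sum.distrib)
    also have "\<dots> = 2 * int (card (F 0)) + 2 * int (card K) + 2 * int (card P) + (int (card W) + int (card W'))"
      using vol_all[of "F 0" V] vol_all[of K V, OF endsK] vol_all[of P V, OF endsP] divV endsF[of 0] by simp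
    finally have "even (\<Sum>v\<in>V. h P v)" using cW by simp
    moreover have "(\<Sum>v\<in>V. h P v) = (\<Sum>v\<in>A. h P v) + (\<Sum>v\<in>B. h P v)"
      using finV AV by (simp add: B_def sum.subset_diff add.commute)
    ultimately have "even (\<Sum>v\<in>B. h P v)" using Pev by simp
    then show ?thesis using finB by (simp add: T'_def even_sum_iff)
  qed
  have spW: "spanning V W" "spanning V W'"
    using spanning_mono[OF spF[of 2] W(1)] spanning_mono[OF spF[of 4] W'(1)] by simp_all
  have endsW: "s e \<in> V" if "e \<in> W \<union> W'" for e using that WH endsH by blast
  have TV: "T \<subseteq> V" "T' \<subseteq> V" using AV by (auto simp: T_def T'_def B_def)
  have conW: "\<forall>e\<in>W. \<forall>f\<in>W. (s e, s f) \<in> conn W" "\<forall>e\<in>W'. \<forall>f\<in>W'. (s e, s f) \<in> conn W'"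
    using spW endsW by (simp_all add: spanning_def)
  have conT: "\<forall>e\<in>W. \<forall>v\<in>T. (s e, v) \<in> conn W" "\<forall>e\<in>W'. \<forall>v\<in>T'. (s e, v) \<in> conn W'"
    using spW endsW TV by (simp_all add: spanning_def subset_iff)
  obtain v\<^sub>1 where v1: "v\<^sub>1 \<in> V" using Vne by blast
  obtain v\<^sub>2 where v2: "v\<^sub>2 \<in> V" "v\<^sub>1 \<noteq> v\<^sub>2"
  proof -
    have "\<not> V \<subseteq> {v\<^sub>1}" using V2 card_mono[of "{v\<^sub>1}" V] by auto
    then show ?thesis using that by blast
  qed
  have other: "\<exists>u\<in>V. u \<noteq> v" for v using v1 v2 by metis
  have vol_pos: "1 \<le> vol X {v}" if "finite X" "spanning V X" "v \<in> V" for X v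
    using other[of v] spanning_vol_pos[OF that] by blast
  have Wne: "W \<noteq> {}" "W' \<noteq> {}"
    using vol_pos[OF finW(1) spW(1) v1] vol_pos[OF finW(2) spW(2) v1] by auto
  have bipW: "\<And>e. e \<in> W \<Longrightarrow> (s e \<in> A) \<noteq> (t e \<in> A)" "\<And>e. e \<in> W' \<Longrightarrow> (s e \<in> B) \<noteq> (t e \<in> B)"
    using bipH endsH WH by (auto simp: B_def)
  have finT: "finite T" "T \<subseteq> A" "finite T'" "T' \<subseteq> B" using finA finB by (auto simp: T_def T'_def)
  obtain L where L: "L \<subseteq> W" "\<forall>v. 2 * vol L {v} - vol W {v} \<in> (if v \<in> T then {2, -2} else {0})"
    "\<forall>S. finite S \<longrightarrow> \<bar>2 * vol L S - vol W S\<bar> \<le> int (card (cut W S))"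
    using half_bipartite[OF finW(1) evW conW(1) conT(1) Wne(1) cW(1) finT(1) cT finT(2) bipW(1)] by blast
  obtain L' where L': "L' \<subseteq> W'" "\<forall>v. 2 * vol L' {v} - vol W' {v} \<in> (if v \<in> T' then {2, -2} else {0})"
    "\<forall>S. finite S \<longrightarrow> \<bar>2 * vol L' S - vol W' S\<bar> \<le> int (card (cut W' S))"
    using half_bipartite[OF finW(2) evW' conW(2) conT(2) Wne(2) cW(2) finT(3) cT' finT(4) bipW(2)] by blast
  have finL: "finite L" "finite L'" using L(1) L'(1) finW finite_subset by blast+
  define Z where "Z = F 0 \<union> L \<union> L' \<union> P \<union> K"
  have volZ: "vol Z S = vol (F 0) S + vol L S + vol L' S + vol P S + vol K S" for S
  proof -
    have "F 0 \<inter> L = {}" using dis(2) L(1) by blast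
    moreover have "(F 0 \<union> L) \<inter> L' = {}" using dis(3) L(1) L'(1) by blast
    moreover have "(F 0 \<union> L \<union> L') \<inter> P = {}" using dis(4) L(1) L'(1) Pp by blast
    moreover have "(F 0 \<union> L \<union> L' \<union> P) \<inter> K = {}" using dis(5) L(1) L'(1) Pp KG by blast
    ultimately show ?thesis unfolding Z_def using fin01 finL finP finK by (simp add: vol_Un)
  qed
  have ZE: "Z \<subseteq> E" unfolding Z_def using L(1) L'(1) Pp KG E_eq by blast
  show ?thesis
  proof (rule that[OF ZE])
    show "spanning V Z" by (rule spanning_mono[OF spF[of 0]]) (auto simp: Z_def)
    show "even (vol Z {v})" for v
    proof (cases "v \<in> V")
      case False
      then show ?thesis using vol_outside[of Z V v] ZE ends by (auto simp: subset_iff)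
    next
      case True
      obtain a where a: "vol W {v} = 2 * a" using evW[of v] by blast
      obtain b where b: "vol W' {v} = 2 * b" using evW'[of v] by blast
      define \<alpha> where "\<alpha> = vol L {v} - a"
      define \<beta> where "\<beta> = vol L' {v} - b"
      have \<alpha>: "\<alpha> \<in> (if v \<in> T then {1, -1} else {0})"
        using spec[OF L(2), of v] a by (auto simp: \<alpha>_def split: if_splits)
      have \<beta>: "\<beta> \<in> (if v \<in> T' then {1, -1} else {0})"
        using spec[OF L'(2), of v] b by (auto simp: \<beta>_def split: if_splits)
      have "h P v = vol (F 0) {v} + vol K {v} + vol P {v} + (a + b)"
        by (simp add: h_def a b)
      \<comment> \<open>The sides are disjoint, so at most one correction is nonzero, and this
        happens exactly when \<open>h P v\<close> is odd.\<close>
      then have "vol Z {v} = h P v + \<alpha> + \<beta>" by (simp add: volZ \<alpha>_def \<beta>_def)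
      moreover have "odd (h P v) \<longleftrightarrow> (v \<in> T) \<noteq> (v \<in> T')" "\<not> (v \<in> T \<and> v \<in> T')"
        using True by (auto simp: T_def T'_def B_def)
      ultimately show ?thesis using \<alpha> \<beta> by (auto split: if_splits)
    qed
    show "\<bar>2 * vol Z S - vol E S\<bar> \<le> int (card (cut E S))" if S: "S \<subseteq> V" for S
    proof -
      have finS: "finite S" using S finV finite_subset by blast
      \<comment> \<open>The tree \<open>F 0\<close> is taken whole and balanced against
        \<open>F 1\<close>; each of the other classes is halved by itself.\<close>
      have 1: "vol (F 0) S - vol (F 1) S \<le> int (card (cut (F 0) S)) + int (card (cut (F 1) S))"
        "vol (F 1) S - vol (F 0) S \<le> int (card (cut (F 1) S)) + int (card (cut (F 0) S))"
        using trees_vol_le[OF finV S finF[of 0] forF[of 0] spF[of 0] endsF[of 0] finF[of 1] forF[of 1] spF[of 1] endsF[of 1]]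
          trees_vol_le[OF finV S finF[of 1] forF[of 1] spF[of 1] endsF[of 1] finF[of 0] forF[of 0] spF[of 0] endsF[of 0]]
        by simp_all
      have 2: "\<bar>2 * vol K S - vol G S\<bar> \<le> int (card (cut G S))"
        using spec[OF K, of S] finS card_cut_mono[OF finG JG, of S] by simp
      have 3: "\<bar>2 * vol L S - vol W S\<bar> \<le> int (card (cut W S))"
        "\<bar>2 * vol L' S - vol W' S\<bar> \<le> int (card (cut W' S))"
        using L(3) L'(3) finS by blast+
      have abs5: "\<bar>a\<^sub>1 + a\<^sub>2 + a\<^sub>3 + a\<^sub>4 + a\<^sub>5\<bar> \<le> b\<^sub>1 + b\<^sub>2 + b\<^sub>3 + b\<^sub>4 + b\<^sub>5"
        if "\<bar>a\<^sub>1\<bar> \<le> b\<^sub>1" "\<bar>a\<^sub>2\<bar> \<le> b\<^sub>2" "\<bar>a\<^sub>3\<bar> \<le> b\<^sub>3" "\<bar>a\<^sub>4\<bar> \<le> b\<^sub>4" "\<bar>a\<^sub>5\<bar> \<le> b\<^sub>5"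
        for a\<^sub>1 a\<^sub>2 a\<^sub>3 a\<^sub>4 a\<^sub>5 b\<^sub>1 b\<^sub>2 b\<^sub>3 b\<^sub>4 b\<^sub>5 :: int
        using that by linarith
      have eq: "2 * vol Z S - vol E S = (vol (F 0) S - vol (F 1) S) + (2 * vol K S - vol G S)
          + (2 * vol L S - vol W S) + (2 * vol L' S - vol W' S) + (2 * vol P S - vol p S)"
        by (simp add: volZ volE)
      have bd: "\<bar>vol (F 0) S - vol (F 1) S\<bar> \<le> int (card (cut (F 0) S)) + int (card (cut (F 1) S))"
        using 1 by linarith
      show ?thesis
        unfolding eq cutE of_nat_add using abs5[OF bd 2 3 Pcut[of S]] by (simp only: add_ac)
    qed
    show "21 \<le> vol Z {v}" if v: "v \<in> V" for v
    proof -
      \<comment> \<open>The 40 trees kept for the degrees. \<open>K\<close> deviates from half of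
        \<open>G\<close> at \<open>v\<close> by at most half the degree in \<open>J\<close>, and
        \<open>J\<close> is disjoint from \<open>M\<close>; this leaves 20, and \<open>F 0\<close>
        adds 1.\<close>
      define M where "M = (\<Union>i\<in>{8..<48}. F i)"
      have M_dis: "M \<inter> F j = {}" if "j < 8" for j using D[of _ j] that by (fastforce simp: M_def)
      have MG: "M \<subseteq> G"
      proof -
        have "M \<inter> (F 0 \<union> F 1 \<union> (F 2 \<union> F 3) \<union> (F 4 \<union> F 5)) = {}"
          by (simp add: Int_Un_distrib M_dis)
        then have "M \<inter> (F 0 \<union> F 1 \<union> W \<union> W') = {}" using W(2) W'(2) by blast
        moreover have MH: "M \<subseteq> H" using FH by (force simp: M_def)
        moreover have "M \<inter> p = {}" using p(1) MH M_dis[of 7] by auto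
        ultimately show ?thesis using HE by (auto simp: G_def)
      qed
      have finM: "finite M" using finF by (auto simp: M_def)
      have JM: "J \<inter> M = {}" using J(1) M_dis[of 6] by auto
      have "disjoint_family_on F {8..<48}" using D by (auto simp: disjoint_family_on_def)
      then have "vol M {v} = (\<Sum>i\<in>{8..<48}. vol (F i) {v})"
        unfolding M_def using finF by (intro vol_UN) auto
      moreover have "(\<Sum>i\<in>{8..<48::nat}. 1) \<le> (\<Sum>i\<in>{8..<48}. vol (F i) {v})"
        using vol_pos finF spF v by (intro sum_mono) auto
      moreover have "vol J {v} + vol M {v} \<le> vol G {v}"
        using vol_mono[of G "J \<union> M" "{v}"] finG JG MG vol_Un[OF finJ finM JM] by simp
      moreover have "\<bar>2 * vol K {v} - vol G {v}\<bar> \<le> vol J {v}"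
        using spec[OF K, of "{v}"] card_cut_le_vol[OF finJ, of "{v}"] by simp
      moreover have "1 \<le> vol (F 0) {v}" using vol_pos finF spF v by simp
      ultimately show ?thesis
        unfolding volZ using vol_nonneg[of L "{v}"] vol_nonneg[of L' "{v}"] vol_nonneg[of P "{v}"] by simp
    qed
  qed
qed

text \<open>The demand of \<open>v\<close> is \<open>vol Z {v}\<close>, which is
  \<open>2 * vol F {v}\<close> as \<open>F\<close> is every second edge of a closed tour of
  \<open>Z\<close>. Since \<open>vol E S\<close> plus the size of the cut is twice the number of
  edges meeting \<open>S\<close>, the upper bound on the defect of \<open>Z\<close> is Hall's
  condition for these demands.\<close>

theorem quarter:
  assumes finV: "finite V" and finE: "finite E" and ends: "\<And>e. e \<in> E \<Longrightarrow> s e \<in> V \<and> t e \<in> V"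
    and V2: "2 \<le> card V"
    and cuts: "\<And>S. S \<subseteq> V \<Longrightarrow> S \<noteq> {} \<Longrightarrow> S \<noteq> V \<Longrightarrow> 191 \<le> card (cut E S)"
    and four: "4 dvd card E"
  obtains F own where "F \<subseteq> E" and "\<And>e. e \<in> E \<Longrightarrow> own e \<in> {s e, t e}"
    and "\<And>v. v \<in> V \<Longrightarrow> int (card {e \<in> E. own e = v}) = 2 * vol F {v}"
    and "\<And>v. v \<in> V \<Longrightarrow> 11 \<le> vol F {v}"
proof -
  obtain Z where ZE: "Z \<subseteq> E" and sp: "spanning V Z" and ev: "\<And>v. even (vol Z {v})"
    and disc: "\<And>S. S \<subseteq> V \<Longrightarrow> \<bar>2 * vol Z S - vol E S\<bar> \<le> int (card (cut E S))"
    and deg: "\<And>v. v \<in> V \<Longrightarrow> 21 \<le> vol Z {v}"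
    using even_connected_half[OF assms] by blast
  have finZ: "finite Z" using ZE finE finite_subset by blast
  have endsZ: "\<And>e. e \<in> Z \<Longrightarrow> s e \<in> V \<and> t e \<in> V" using ZE ends by blast
  have "cut E V = {}" using ends by (rule cut_UNIV_ends)
  then have cZ: "2 * card Z = card E"
    using disc[of V] vol_all[of Z V, OF endsZ] vol_all[of E V, OF ends] by simp
  then have "even (card Z)" using four by presburger
  moreover have "\<forall>e\<in>Z. \<forall>f\<in>Z. (s e, s f) \<in> conn Z" using sp endsZ by (simp add: spanning_def)
  ultimately obtain F where F: "F \<subseteq> Z" "\<forall>v. 2 * vol F {v} = vol Z {v}"
    using half[OF finZ ev] by blast
  define l where "l v = nat (vol Z {v})" for v
  have lS: "int (\<Sum>v\<in>S. l v) = vol Z S" if "S \<subseteq> V" for S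
    using vol_sum[OF finite_subset[OF that finV], of Z] vol_nonneg by (simp add: l_def)
  have "(\<Sum>v\<in>S. l v) \<le> card {e \<in> E. s e \<in> S \<or> t e \<in> S}" if S: "S \<subseteq> V" for S
  proof -
    have "{e \<in> E. s e \<in> S \<or> t e \<in> S} = {e \<in> E. s e \<in> S \<and> t e \<in> S} \<union> cut E S" by (auto simp: cut_def)
    then have "card {e \<in> E. s e \<in> S \<or> t e \<in> S} = card {e \<in> E. s e \<in> S \<and> t e \<in> S} + card (cut E S)"
      using finE by (simp, intro card_Un_disjoint) (auto simp: cut_def)
    then show ?thesis using disc[OF S] lS[OF S] vol_inside[OF finE, of S] by linarith
  qed
  moreover have "(\<Sum>v\<in>V. l v) = card E"
    using lS[OF order_refl] vol_all[of Z V, OF endsZ] cZ by linarith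
  ultimately obtain own where own: "\<forall>e\<in>E. own e \<in> {s e, t e}" "\<forall>v\<in>V. card {e \<in> E. own e = v} = l v"
    using orientation_eq[OF finV finE ends, of l] by blast
  show ?thesis
  proof (rule that[of F own])
    show "F \<subseteq> E" using F(1) ZE by blast
    show "own e \<in> {s e, t e}" if "e \<in> E" for e using own(1) that by blast
    fix v assume v: "v \<in> V"
    show "int (card {e \<in> E. own e = v}) = 2 * vol F {v}"
      using own(2) v F(2) vol_nonneg[of Z "{v}"] by (simp add: l_def)
    show "11 \<le> vol F {v}" using deg[OF v] F(2)[rule_format, of v] by linarith
  qed
qed

end

section \<open>Avoiding triangles\<close>

text \<open>\<open>N v\<close> are the neighbours of \<open>v\<close> along the selected edges, \<open>Tg v\<close> the other ends of the remaining
  edges owned by \<open>v\<close>. Each selected edge \<open>vu\<close> has to receive \<open>m v u\<close> of the latter, and the targets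
  received at \<open>v\<close> and at \<open>u\<close> have to be disjoint.\<close>

locale slot_system =
  fixes V :: "'a set" and N Tg :: "'a \<Rightarrow> 'a set" and m :: "'a \<Rightarrow> 'a \<Rightarrow> nat"
  assumes finV: "finite V" and N_sub: "\<And>v. N v \<subseteq> V" and N_sym: "\<And>u v. u \<in> N v \<Longrightarrow> v \<in> N u"
    and N_irrefl: "\<And>v. v \<notin> N v" and finTg: "\<And>v. v \<in> V \<Longrightarrow> finite (Tg v)"
    and m: "\<And>u v. u \<in> N v \<Longrightarrow> m v u \<in> {1, 2}"
    and m_sum: "\<And>v. v \<in> V \<Longrightarrow> (\<Sum>u\<in>N v. m v u) = card (Tg v)"
begin

text \<open>\<open>\<psi> v x = u\<close> assigns the remaining edge from \<open>v\<close> to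
  \<open>x\<close> to the copy of \<open>Y\<close> built on the selected edge from \<open>v\<close>
  to \<open>u\<close>; \<open>tau \<psi> v u\<close> consists of the leaves that this copy has at
  \<open>v\<close>.\<close>

definition tau :: "('a \<Rightarrow> 'a \<Rightarrow> 'a) \<Rightarrow> 'a \<Rightarrow> 'a \<Rightarrow> 'a set" where
  "tau \<psi> v u = {x \<in> Tg v. \<psi> v x = u}"

definition valid :: "('a \<Rightarrow> 'a \<Rightarrow> 'a) \<Rightarrow> 'a set \<Rightarrow> bool" where
  "valid \<psi> P \<longleftrightarrow> (\<forall>v\<in>P. (\<forall>x\<in>Tg v. \<psi> v x \<in> N v) \<and> (\<forall>u\<in>N v. card (tau \<psi> v u) = m v u))"

text \<open>A common element would be adjacent to both ends of the selected edge and close a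
  triangle. \<open>P\<close> is the set of vertices processed so far.\<close>

definition free :: "('a \<Rightarrow> 'a \<Rightarrow> 'a) \<Rightarrow> 'a set \<Rightarrow> bool" where
  "free \<psi> P \<longleftrightarrow> (\<forall>v\<in>P. \<forall>u\<in>P. u \<in> N v \<longrightarrow> tau \<psi> v u \<inter> tau \<psi> u v = {})"

lemma finN: "finite (N v)"
  using N_sub finV finite_subset by blast

lemma tau_upd: "tau (\<psi>(v := \<phi>)) w u = (if w = v then {x \<in> Tg v. \<phi> x = u} else tau \<psi> w u)"
  by (auto simp: tau_def)

lemma valid_card: "valid \<psi> P \<Longrightarrow> v \<in> P \<Longrightarrow> u \<in> N v \<Longrightarrow> card (tau \<psi> v u) \<in> {1, 2}"
  using m by (simp add: valid_def)

text \<open>One greedy step, by \<open>slot_assignment\<close> with the selected edges at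
  \<open>v\<close> as slots. For a processed \<open>u\<close>, \<open>Forb u\<close> has to contain
  the targets already placed there; larger sets serve to maintain \<open>spread\<close>.\<close>

lemma extend:
  assumes v: "v \<in> V" "v \<notin> P" and "valid \<psi> P" and "free \<psi> P"
    and old: "\<And>u. u \<in> N v \<Longrightarrow> u \<in> P \<Longrightarrow> tau \<psi> u v \<subseteq> Forb u"
    and Forb: "\<And>u. u \<in> N v \<Longrightarrow> finite (Forb u) \<and> card (Forb u) \<le> 2"
    and a: "\<And>x. x \<in> Tg v \<Longrightarrow> \<exists>u\<in>N v. x \<notin> Forb u"
    and b: "\<And>x y u\<^sub>0. x \<in> Tg v \<Longrightarrow> y \<in> Tg v \<Longrightarrow> x \<noteq> y \<Longrightarrow> u\<^sub>0 \<in> N v \<Longrightarrow>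
      \<exists>u\<in>N v - {u\<^sub>0}. x \<notin> Forb u \<or> y \<notin> Forb u"
  shows "\<exists>\<phi>. valid (\<psi>(v := \<phi>)) (insert v P) \<and> free (\<psi>(v := \<phi>)) (insert v P) \<and>
    (\<forall>u\<in>N v. tau (\<psi>(v := \<phi>)) v u \<inter> Forb u = {})"
proof -
  obtain \<phi> where \<phi>: "\<forall>x\<in>Tg v. \<phi> x \<in> N v \<and> x \<notin> Forb (\<phi> x)"
      "\<forall>u\<in>N v. card {x \<in> Tg v. \<phi> x = u} = m v u"
    using slot_assignment[OF finTg[OF v(1)] finN[of v] m m_sum[OF v(1)] Forb a b] by blast
  let ?\<psi> = "\<psi>(v := \<phi>)"
  have 1: "valid ?\<psi> (insert v P)"
    using assms(2,3) \<phi> by (auto simp: valid_def tau_upd)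
  have 2: "\<forall>u\<in>N v. tau ?\<psi> v u \<inter> Forb u = {}"
    using \<phi>(1) by (auto simp: tau_upd)
  have 3: "tau ?\<psi> v u \<inter> tau ?\<psi> u v = {}" if "u \<in> N v" "u \<in> P" for u
  proof -
    have "u \<noteq> v" using that v(2) by blast
    then have "tau ?\<psi> u v \<subseteq> Forb u" using old[OF that] by (simp add: tau_upd)
    then show ?thesis using 2 that(1) by blast
  qed
  have "free ?\<psi> (insert v P)"
    unfolding free_def
  proof (intro ballI impI)
    fix x y assume xy: "x \<in> insert v P" "y \<in> insert v P" "y \<in> N x"
    consider "x = v" "y \<in> P" | "y = v" "x \<in> P" | "x \<in> P" "y \<in> P" "x \<noteq> v" "y \<noteq> v"
      using xy N_irrefl v(2) by blast
    then show "tau ?\<psi> x y \<inter> tau ?\<psi> y x = {}"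
    proof cases
      case 1
      then show ?thesis using 3 xy by blast
    next
      case 2
      then show ?thesis using 3[of x] N_sym[OF xy(3)] by blast
    next
      case 3
      then show ?thesis using assms(4) xy(3) by (simp add: tau_upd free_def)
    qed
  qed
  then show ?thesis using 1 2 by blast
qed

end

text \<open>When a vertex \<open>w\<close> with designated neighbours \<open>C\<close> is processed, these clauses provide the last two
  assumptions of \<open>slot_assignment\<close>: no target is forbidden by all members of \<open>C\<close>, and no two targets
  are forbidden by two members of \<open>C\<close>. They cost each member of \<open>C\<close> at most two targets.\<close>

definition spread :: "('a \<Rightarrow> 'b set) \<Rightarrow> 'a set \<Rightarrow> bool" where
  "spread f C \<longleftrightarrow> (2 \<le> card C \<longrightarrow> (\<Inter>c\<in>C. f c) = {}) \<and>
    (\<forall>c\<in>C. \<forall>c'\<in>C. c \<noteq> c' \<longrightarrow> (\<forall>x\<in>f c \<inter> f c'. \<forall>y\<in>f c \<inter> f c'. x = y))"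

lemma spread_cong: "(\<And>c. c \<in> C \<Longrightarrow> f c = g c) \<Longrightarrow> spread f C = spread g C"
  unfolding spread_def by (simp cong: INF_cong ball_cong)

text \<open>For a single earlier member all its targets are forbidden. For two of them,
  \<open>c\<close> and \<open>d\<close>, the sets \<open>f c\<close> and \<open>f d\<close> are
  disjoint with at most two elements each; forbidding one element of either leaves at most one in
  common with \<open>X\<close>.\<close>

lemma spread_extend:
  assumes "spread f C" and "finite C" and "card C \<le> 2" and "v \<notin> C" and f: "\<And>c. c \<in> C \<Longrightarrow> card (f c) \<in> {1, 2}"
  shows "\<exists>Fb. finite Fb \<and> card Fb \<le> 2 \<and> (\<forall>X. X \<inter> Fb = {} \<longrightarrow> spread (f(v := X)) (insert v C))"
proof -
  consider "C = {}" | (one) c where "C = {c}" | (two) c d where "C = {c, d}" "c \<noteq> d"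
  proof -
    have "card C = 0 \<or> card C = 1 \<or> card C = 2" using assms(3) by linarith
    then show ?thesis using that assms(2) by (auto simp: card_1_singleton_iff card_2_iff)
  qed
  then show ?thesis
  proof cases
    case 1
    then show ?thesis by (intro exI[of _ "{}"]) (simp add: spread_def)
  next
    case (one c)
    have "spread (f(v := X)) (insert v C)" if "X \<inter> f c = {}" for X
      using that assms(4) one by (auto simp: spread_def)
    moreover have "finite (f c)" "card (f c) \<le> 2" using f[of c] one by (auto intro: card_ge_0_finite)
    ultimately show ?thesis by blast
  next
    case (two c d)
    obtain x where x: "x \<in> f c" using f[of c] two by fastforce
    obtain y where y: "y \<in> f d" using f[of d] two by fastforce
    have cd: "f c \<inter> f d = {}" using assms(1) two by (simp add: spread_def)
    have key: "a = b" if X: "X \<inter> {x, y} = {}" and ab: "a \<in> X \<inter> f e" "b \<in> X \<inter> f e"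
      and e: "e = c \<or> e = d" for X a b e
    proof (rule ccontr)
      assume "a \<noteq> b"
      define z where "z = (if e = c then x else y)"
      have z: "z \<in> f e" "z \<notin> X" using e x y X by (auto simp: z_def)
      moreover have "z \<noteq> a" "z \<noteq> b" using ab z(2) by blast+
      ultimately have "card {a, b, z} = 3" using \<open>a \<noteq> b\<close> by simp
      moreover have "finite (f e)" "card (f e) \<le> 2" using f[of e] two e by (auto intro: card_ge_0_finite)
      moreover have "{a, b, z} \<subseteq> f e" using ab z by blast
      ultimately show False using card_mono[of "f e" "{a, b, z}"] by simp
    qed
    have "spread (f(v := X)) (insert v C)" if X: "X \<inter> {x, y} = {}" for X
      unfolding spread_def
    proof (intro conjI impI ballI)
      show "(\<Inter>c\<in>insert v C. (f(v := X)) c) = {}"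
        using cd two assms(4) by auto
    next
      fix e e' a b assume *: "e \<in> insert v C" "e' \<in> insert v C" "e \<noteq> e'"
        "a \<in> (f(v := X)) e \<inter> (f(v := X)) e'" "b \<in> (f(v := X)) e \<inter> (f(v := X)) e'"
      consider "e = v" "e' = c \<or> e' = d" "e' \<noteq> v" | "e' = v" "e = c \<or> e = d" "e \<noteq> v"
        | "e \<noteq> v" "e' \<noteq> v" "{e, e'} = {c, d}"
        using * two assms(4) by blast
      then show "a = b"
      proof cases
        case 1
        then show ?thesis using *(4,5) key[OF X, of a e' b] by auto
      next
        case 2
        then show ?thesis using *(4,5) key[OF X, of a e b] by auto
      next
        case 3
        then show ?thesis using *(4) cd by (auto simp: doubleton_eq_iff)
      qed
    qed
    moreover have "finite {x, y}" "card {x, y} \<le> 2" by (simp_all add: card_insert_if)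
    ultimately show ?thesis by blast
  qed
qed

text \<open>The vertices of \<open>A\<close> are processed first. Those outside \<open>A\<close> designate three neighbours in \<open>A\<close>,
  in such a way that every \<open>v \<in> A\<close> keeps at least two neighbours \<open>U v\<close> that do not constrain it.\<close>

locale slot_design = slot_system +
  fixes A :: "'a set" and D U :: "'a \<Rightarrow> 'a set"
  assumes A: "A \<subseteq> V" and D: "\<And>w. w \<in> V - A \<Longrightarrow> D w \<subseteq> A \<inter> N w \<and> card (D w) = 3"
    and U: "\<And>v. v \<in> A \<Longrightarrow> U v \<subseteq> N v - A \<and> 2 \<le> card (U v)"
    and DU: "\<And>v w. v \<in> A \<Longrightarrow> w \<in> U v \<Longrightarrow> v \<notin> D w"
begin

lemma finD: "w \<in> V - A \<Longrightarrow> finite (D w)"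
  using D[of w] by (metis card.infinite zero_neq_numeral)

text \<open>Greedy choice over \<open>A\<close>. A neighbour \<open>u\<close> of \<open>v\<close>
  forbids its own targets if it is processed, the set from \<open>spread_extend\<close> if it lies
  outside \<open>A\<close> and designates \<open>v\<close>, and nothing otherwise. The neighbours in
  \<open>U v\<close> forbid nothing and there are two of them, which yields the last two assumptions
  of \<open>extend\<close>.\<close>

lemma first_phase:
  assumes "P \<subseteq> A"
  shows "\<exists>\<psi>. valid \<psi> P \<and> free \<psi> P \<and> (\<forall>w\<in>V - A. spread (\<lambda>c. tau \<psi> c w) (D w \<inter> P))"
proof -
  have "finite P" using finite_subset[OF subset_trans[OF assms A] finV] .
  then show ?thesis using assms
  proof (induction P rule: finite_induct)
    case empty
    show ?case by (auto simp: valid_def free_def spread_def)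
  next
    case (insert v P)
    then obtain \<psi> where \<psi>: "valid \<psi> P" "free \<psi> P"
      and sp: "\<And>w. w \<in> V - A \<Longrightarrow> spread (\<lambda>c. tau \<psi> c w) (D w \<inter> P)"
      by auto
    have v: "v \<in> V" "v \<in> A" using insert.prems A by auto
    have "\<exists>Fb. finite Fb \<and> card Fb \<le> 2 \<and> (u \<in> P \<longrightarrow> tau \<psi> u v \<subseteq> Fb) \<and> (u \<in> U v \<longrightarrow> Fb = {}) \<and>
        (u \<in> V - A \<longrightarrow> v \<in> D u \<longrightarrow> (\<forall>X. X \<inter> Fb = {} \<longrightarrow>
          spread ((\<lambda>c. tau \<psi> c u)(v := X)) (insert v (D u \<inter> P))))" if u: "u \<in> N v" for u
    proof -
      consider "u \<in> P" | "u \<notin> P" "u \<in> V - A" "v \<in> D u" | "u \<notin> P" "\<not> (u \<in> V - A \<and> v \<in> D u)" by blast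
      then show ?thesis
      proof cases
        case 1
        have "card (tau \<psi> u v) \<in> {1, 2}" using valid_card[OF \<psi>(1) 1 N_sym[OF u]] .
        then have "finite (tau \<psi> u v)" "card (tau \<psi> u v) \<le> 2" by (auto intro: card_ge_0_finite)
        moreover have "u \<in> A" using 1 insert.prems by blast
        moreover from this have "u \<notin> U v" using U[OF v(2)] by blast
        ultimately show ?thesis by (intro exI[of _ "tau \<psi> u v"]) auto
      next
        case 2
        have "card (D u \<inter> P) \<le> 2"
        proof -
          have "D u \<inter> P \<subseteq> D u - {v}" using insert.hyps by blast
          then have "card (D u \<inter> P) \<le> card (D u - {v})" using finD[OF 2(2)] by (intro card_mono) auto
          then show ?thesis using D[OF 2(2)] 2(3) finD[OF 2(2)] by simp
        qed
        moreover have "card (tau \<psi> c u) \<in> {1, 2}" if "c \<in> D u \<inter> P" for c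
          using that valid_card[OF \<psi>(1), of c u] N_sym[of c u] D[OF 2(2)] by blast
        ultimately have "\<exists>Fb. finite Fb \<and> card Fb \<le> 2 \<and> (\<forall>X. X \<inter> Fb = {} \<longrightarrow>
            spread ((\<lambda>c. tau \<psi> c u)(v := X)) (insert v (D u \<inter> P)))"
          using finD[OF 2(2)] insert.hyps by (intro spread_extend sp[OF 2(2)]) auto
        moreover have "u \<notin> U v" using DU[OF v(2)] 2(3) by blast
        ultimately show ?thesis using 2(1) by auto
      next
        case 3
        then show ?thesis by (intro exI[of _ "{}"]) auto
      qed
    qed
    then have "\<forall>u\<in>N v. \<exists>Fb. finite Fb \<and> card Fb \<le> 2 \<and> (u \<in> P \<longrightarrow> tau \<psi> u v \<subseteq> Fb) \<and>
        (u \<in> U v \<longrightarrow> Fb = {}) \<and> (u \<in> V - A \<longrightarrow> v \<in> D u \<longrightarrow> (\<forall>X. X \<inter> Fb = {} \<longrightarrow>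
          spread ((\<lambda>c. tau \<psi> c u)(v := X)) (insert v (D u \<inter> P))))" by (rule ballI)
    from bchoice[OF this] obtain Fb where
      all: "\<forall>u\<in>N v. finite (Fb u) \<and> card (Fb u) \<le> 2 \<and> (u \<in> P \<longrightarrow> tau \<psi> u v \<subseteq> Fb u) \<and>
        (u \<in> U v \<longrightarrow> Fb u = {}) \<and> (u \<in> V - A \<longrightarrow> v \<in> D u \<longrightarrow> (\<forall>X. X \<inter> Fb u = {} \<longrightarrow>
          spread ((\<lambda>c. tau \<psi> c u)(v := X)) (insert v (D u \<inter> P))))"
      by (rule exE) (rule that)
    have Fb: "finite (Fb u) \<and> card (Fb u) \<le> 2" if "u \<in> N v" for u
      using bspec[OF all that] by (elim conjE) (intro conjI)
    have Fb_old: "tau \<psi> u v \<subseteq> Fb u" if "u \<in> N v" "u \<in> P" for u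
      using bspec[OF all that(1)] that(2) by (elim conjE) (rule mp)
    have Fb_U: "Fb u = {}" if "u \<in> N v" "u \<in> U v" for u
      using bspec[OF all that(1)] that(2) by (elim conjE) (rule mp)
    have Fb_D: "spread ((\<lambda>c. tau \<psi> c u)(v := X)) (insert v (D u \<inter> P))"
      if "u \<in> N v" "u \<in> V - A" "v \<in> D u" "X \<inter> Fb u = {}" for u X
      using bspec[OF all that(1)] that(2-4) by (elim conjE) (drule (1) mp, drule (1) mp, drule spec, erule (1) mp)
    have U_other: "\<exists>u\<in>N v - {u\<^sub>0}. Fb u = {}" for u\<^sub>0
    proof -
      have "\<not> U v \<subseteq> {u\<^sub>0}" using U[OF v(2)] card_mono[of "{u\<^sub>0}" "U v"] by auto
      then show ?thesis using U[OF v(2)] Fb_U by blast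
    qed
    have "\<exists>\<phi>. valid (\<psi>(v := \<phi>)) (insert v P) \<and> free (\<psi>(v := \<phi>)) (insert v P) \<and>
        (\<forall>u\<in>N v. tau (\<psi>(v := \<phi>)) v u \<inter> Fb u = {})"
    proof (rule extend[OF v(1) insert.hyps(2) \<psi> Fb_old Fb])
      show "\<exists>u\<in>N v. x \<notin> Fb u" for x using U_other by blast
      show "\<exists>u\<in>N v - {u\<^sub>0}. x \<notin> Fb u \<or> y \<notin> Fb u" for x y u\<^sub>0 using U_other[of u\<^sub>0] by blast
    qed
    then obtain \<phi> where \<phi>: "valid (\<psi>(v := \<phi>)) (insert v P)" "free (\<psi>(v := \<phi>)) (insert v P)"
      "\<forall>u\<in>N v. tau (\<psi>(v := \<phi>)) v u \<inter> Fb u = {}" by blast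
    have "spread (\<lambda>c. tau (\<psi>(v := \<phi>)) c w) (D w \<inter> insert v P)" if w: "w \<in> V - A" for w
    proof (cases "v \<in> D w")
      case True
      then have "w \<in> N v" using D[OF w] N_sym by blast
      then have "spread ((\<lambda>c. tau \<psi> c w)(v := tau (\<psi>(v := \<phi>)) v w)) (insert v (D w \<inter> P))"
        using Fb_D[OF _ w True] \<phi>(3) by blast
      moreover have "(\<lambda>c. tau \<psi> c w)(v := tau (\<psi>(v := \<phi>)) v w) = (\<lambda>c. tau (\<psi>(v := \<phi>)) c w)"
        by (auto simp: tau_upd)
      ultimately show ?thesis using True by simp
    next
      case False
      have "spread (\<lambda>c. tau (\<psi>(v := \<phi>)) c w) (D w \<inter> P) = spread (\<lambda>c. tau \<psi> c w) (D w \<inter> P)"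
        using insert.hyps by (intro spread_cong) (auto simp: tau_upd)
      then show ?thesis using sp[OF w] False by simp
    qed
    then show ?case using \<phi> by blast
  qed
qed

text \<open>The three designated neighbours of a vertex outside \<open>A\<close> are already
  processed. By \<open>spread\<close>, no target is forbidden by all three, and when one of them is
  discarded, no two targets are forbidden by both others. Steps outside \<open>A\<close> do not
  affect \<open>spread\<close>, which concerns choices made in \<open>A\<close>.\<close>

lemma second_phase:
  assumes "Q \<subseteq> V - A"
  shows "\<exists>\<psi>. valid \<psi> (A \<union> Q) \<and> free \<psi> (A \<union> Q) \<and> (\<forall>w\<in>V - A. spread (\<lambda>c. tau \<psi> c w) (D w))"
proof -
  have "finite Q" using assms finV finite_subset by blast
  then show ?thesis using assms
  proof (induction Q rule: finite_induct)
    case empty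
    have "D w \<inter> A = D w" if "w \<in> V - A" for w using D[OF that] by blast
    then show ?case using first_phase[of A] by simp
  next
    case (insert v Q)
    then obtain \<psi> where \<psi>: "valid \<psi> (A \<union> Q)" "free \<psi> (A \<union> Q)"
      and sp: "\<And>w. w \<in> V - A \<Longrightarrow> spread (\<lambda>c. tau \<psi> c w) (D w)"
      by auto
    have v: "v \<in> V" "v \<in> V - A" "v \<notin> A \<union> Q" using insert by auto
    define Fb where "Fb u = (if u \<in> A \<union> Q then tau \<psi> u v else {})" for u
    have Fb: "finite (Fb u) \<and> card (Fb u) \<le> 2" if "u \<in> N v" for u
    proof (cases "u \<in> A \<union> Q")
      case True
      then have "card (tau \<psi> u v) \<in> {1, 2}" using valid_card[OF \<psi>(1) True N_sym[OF that]] by simp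
      then show ?thesis using True by (auto simp: Fb_def intro: card_ge_0_finite)
    qed (auto simp: Fb_def)
    have Fb_old: "tau \<psi> u v \<subseteq> Fb u" if "u \<in> N v" "u \<in> A \<union> Q" for u
      using that by (simp add: Fb_def)
    have DN: "D v \<subseteq> N v" "D v \<subseteq> A" "card (D v) = 3" using D[OF v(2)] by auto
    have FbD: "Fb c = tau \<psi> c v" if "c \<in> D v" for c using that DN by (auto simp: Fb_def)
    have "\<exists>\<phi>. valid (\<psi>(v := \<phi>)) (insert v (A \<union> Q)) \<and> free (\<psi>(v := \<phi>)) (insert v (A \<union> Q)) \<and>
        (\<forall>u\<in>N v. tau (\<psi>(v := \<phi>)) v u \<inter> Fb u = {})"
    proof (rule extend[OF v(1,3) \<psi> Fb_old Fb])
      fix x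
      have "(\<Inter>c\<in>D v. tau \<psi> c v) = {}" using sp[OF v(2)] DN(3) by (simp add: spread_def)
      then obtain c where c: "c \<in> D v" "x \<notin> tau \<psi> c v" by blast
      then show "\<exists>u\<in>N v. x \<notin> Fb u" using DN(1) FbD[OF c(1)] by (intro bexI[of _ c]) auto
    next
      fix x y u\<^sub>0 assume xy: "x \<noteq> (y :: 'a)"
      have "2 \<le> card (D v - {u\<^sub>0})" using DN(3) by (simp add: card_Diff_singleton_if)
      then obtain c c' where c: "c \<in> D v - {u\<^sub>0}" "c' \<in> D v - {u\<^sub>0}" "c \<noteq> c'"
        by (metis card_le_Suc0_iff_eq finD v(2) finite_Diff not_less_eq_eq numeral_2_eq_2)
      then have "\<not> (x \<in> tau \<psi> c v \<inter> tau \<psi> c' v \<and> y \<in> tau \<psi> c v \<inter> tau \<psi> c' v)"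
        using sp[OF v(2)] xy by (auto simp: spread_def)
      then have "x \<notin> Fb c \<or> y \<notin> Fb c \<or> x \<notin> Fb c' \<or> y \<notin> Fb c'" using FbD c by auto
      then show "\<exists>u\<in>N v - {u\<^sub>0}. x \<notin> Fb u \<or> y \<notin> Fb u" using c DN by blast
    qed
    then obtain \<phi> where \<phi>: "valid (\<psi>(v := \<phi>)) (insert v (A \<union> Q))" "free (\<psi>(v := \<phi>)) (insert v (A \<union> Q))"
      by blast
    have "spread (\<lambda>c. tau (\<psi>(v := \<phi>)) c w) (D w)" if w: "w \<in> V - A" for w
    proof -
      have "spread (\<lambda>c. tau (\<psi>(v := \<phi>)) c w) (D w) = spread (\<lambda>c. tau \<psi> c w) (D w)"
        using D[OF w] v by (intro spread_cong) (auto simp: tau_upd)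
      then show ?thesis using sp[OF w] by simp
    qed
    then show ?case using \<phi> by auto
  qed
qed

end

text \<open>Every vertex has at least 6 of its 11 neighbours across a maximum cut, and the crossing
  edges can be distributed to their ends with at least 3 for each vertex. Edges owned outside
  \<open>A\<close> yield \<open>D\<close>, those owned in \<open>A\<close> yield \<open>U\<close>;
  as an edge has one owner, \<open>w \<in> U v\<close> excludes \<open>v \<in> D w\<close>.\<close>

theorem (in slot_system) conflict_free_assignment:
  assumes deg: "\<And>v. v \<in> V \<Longrightarrow> 11 \<le> card (N v)"
  shows "\<exists>\<psi>. valid \<psi> V \<and> free \<psi> V"
proof -
  \<comment> \<open>Ordered pairs, so every selected edge occurs twice; this factor appears on both
    sides of the comparison of cuts.\<close>
  define E where "E = {(u, v). v \<in> N u}"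
  have "E \<subseteq> V \<times> V" using N_sub N_sym unfolding E_def by blast
  then have finE: "finite E" using finV finite_subset by blast
  interpret mg: mgraph "fst :: 'a \<times> 'a \<Rightarrow> 'a" "snd :: 'a \<times> 'a \<Rightarrow> 'a" .
  obtain A where A: "A \<subseteq> V" and max: "\<And>S. S \<subseteq> V \<Longrightarrow> card (mg.cut E S) \<le> 2 * card (mg.cut (mg.cut E A) S)"
    by (rule mg.max_cut[OF finV finE]) (rule that)
  have N_V: "\<And>u v. u \<in> N v \<Longrightarrow> u \<in> V" using N_sub by blast
  define X where "X v = {u \<in> N v. (u \<in> A) \<noteq> (v \<in> A)}" for v
  have X6: "6 \<le> card (X v)" if v: "v \<in> V" for v
  proof -
    have 2: "card (Pair v ` M \<union> (\<lambda>u. (u, v)) ` M) = 2 * card M" if "M \<subseteq> N v" for M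
    proof -
      have "finite M" using that finN finite_subset by blast
      moreover have "Pair v ` M \<inter> (\<lambda>u. (u, v)) ` M = {}" using that N_irrefl by auto
      ultimately show ?thesis by (simp add: card_Un_disjoint card_image inj_on_def)
    qed
    have "mg.cut E {v} = Pair v ` N v \<union> (\<lambda>u. (u, v)) ` N v"
      using N_sym N_irrefl by (auto simp: mg.cut_def E_def)
    then have "card (mg.cut E {v}) = 2 * card (N v)" using 2 by simp
    moreover have "mg.cut (mg.cut E A) {v} = Pair v ` X v \<union> (\<lambda>u. (u, v)) ` X v"
      using N_sym N_irrefl by (auto simp: mg.cut_def E_def X_def)
    then have "card (mg.cut (mg.cut E A) {v}) = 2 * card (X v)" using 2[of "X v"] by (simp add: X_def)
    ultimately show ?thesis using max[of "{v}"] deg[OF v] v by simp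
  qed
  define C where "C = {(u, v). u \<in> A \<and> v \<in> V - A \<and> v \<in> N u}"
  have CE: "C \<subseteq> E" by (auto simp: C_def E_def)
  then have finC: "finite C" using finE finite_subset by blast
  have "(\<Sum>v\<in>S. 3) \<le> card {e \<in> C. fst e \<in> S \<or> snd e \<in> S}" if S: "S \<subseteq> V" for S
  proof -
    have finS: "finite S" using S finV finite_subset by blast
    have "6 \<le> mg.vol C {v}" if v: "v \<in> S" for v
    proof -
      have "mg.vol C {v} = (\<Sum>e\<in>C. of_bool (fst e = v \<or> snd e = v))"
        unfolding mg.vol_def by (intro sum.cong) (auto simp: C_def)
      also have "\<dots> = int (card {e \<in> C. fst e = v \<or> snd e = v})"
        using finC by (simp add: of_bool_def sum.inter_filter[symmetric])
      also have "{e \<in> C. fst e = v \<or> snd e = v} = (if v \<in> A then Pair v ` X v else (\<lambda>u. (u, v)) ` X v)"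
        using v S A N_sym N_V by (auto simp: C_def X_def)
      also have "card \<dots> = card (X v)" by (simp add: card_image inj_on_def)
      finally show ?thesis using X6[of v] v S by auto
    qed
    then have "(\<Sum>v\<in>S. 6) \<le> (\<Sum>v\<in>S. mg.vol C {v})" by (rule sum_mono)
    also have "\<dots> = mg.vol C S" using mg.vol_sum[OF finS] by simp
    \<comment> \<open>A crossing edge is counted at most twice, so 6 per vertex turn into 3.\<close>
    also have "\<dots> \<le> (\<Sum>e\<in>C. 2 * of_bool (fst e \<in> S \<or> snd e \<in> S))"
      unfolding mg.vol_def by (intro sum_mono) auto
    also have "\<dots> = 2 * int (card {e \<in> C. fst e \<in> S \<or> snd e \<in> S})"
      using finC by (simp add: of_bool_def sum.inter_filter[symmetric] sum_distrib_left[symmetric])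
    finally show ?thesis by simp
  qed
  then obtain own where own: "\<forall>e\<in>C. own e \<in> {fst e, snd e}" "\<forall>v\<in>V. 3 \<le> card {e \<in> C. own e = v}"
    using mg.orientation_ge[OF finV finC, of "\<lambda>_. 3"] by blast
  have "\<exists>M. M \<subseteq> A \<inter> N w \<and> card M = 3 \<and> (\<forall>v\<in>M. own (v, w) = w)" if w: "w \<in> V - A" for w
  proof -
    have "{e \<in> C. own e = w} \<subseteq> (\<lambda>u. (u, w)) ` {u \<in> A \<inter> N w. own (u, w) = w}"
      using own(1) w N_sym by (fastforce simp: C_def)
    then have "card {e \<in> C. own e = w} \<le> card ((\<lambda>u. (u, w)) ` {u \<in> A \<inter> N w. own (u, w) = w})"
      using finN by (intro card_mono) auto
    also have "\<dots> = card {u \<in> A \<inter> N w. own (u, w) = w}" by (simp add: card_image inj_on_def)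
    finally have "3 \<le> card {u \<in> A \<inter> N w. own (u, w) = w}" using own(2) w by fastforce
    then obtain M where "M \<subseteq> {u \<in> A \<inter> N w. own (u, w) = w}" "card M = 3"
      by (rule obtain_subset_with_card_n)
    then show ?thesis by blast
  qed
  then obtain D where D: "\<And>w. w \<in> V - A \<Longrightarrow> D w \<subseteq> A \<inter> N w \<and> card (D w) = 3"
    and D_own: "\<And>v w. w \<in> V - A \<Longrightarrow> v \<in> D w \<Longrightarrow> own (v, w) = w"
    by metis
  define U where "U v = {w \<in> N v - A. own (v, w) = v}" for v
  have U: "U v \<subseteq> N v - A \<and> 2 \<le> card (U v)" if v: "v \<in> A" for v
  proof -
    have "{e \<in> C. own e = v} \<subseteq> Pair v ` U v"
      using own(1) v by (fastforce simp: C_def U_def)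
    then have "card {e \<in> C. own e = v} \<le> card (Pair v ` U v)"
      using finN by (intro card_mono) (auto simp: U_def)
    also have "\<dots> = card (U v)" by (simp add: card_image inj_on_def)
    finally have "3 \<le> card (U v)" using own(2) v A by fastforce
    then show ?thesis by (auto simp: U_def)
  qed
  have DU: "v \<notin> D w" if "v \<in> A" "w \<in> U v" for v w
  proof
    assume "v \<in> D w"
    moreover have "w \<in> V - A" using that N_sub by (auto simp: U_def)
    ultimately have "own (v, w) = w" using D_own by blast
    moreover have "own (v, w) = v" using that by (simp add: U_def)
    ultimately show False using that N_irrefl[of v] by (simp add: U_def)
  qed
  interpret slot_design V N Tg m A D U
    by unfold_locales (use A D U DU in blast)+
  show ?thesis using second_phase[of "V - A"] A by (auto simp: Un_absorb1)
qed

section \<open>Decomposition into copies of \<open>Y\<close>\<close>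

text \<open>The tree \<open>Y\<close> with named vertices, also known as chair or fork: centre
  \<open>c\<close> with leaves \<open>a\<close> and \<open>b\<close>, and \<open>d\<close> of degree
  2 with leaf \<open>e\<close>.\<close>

definition chair :: "'a \<Rightarrow> 'a \<Rightarrow> 'a \<Rightarrow> 'a \<Rightarrow> 'a \<Rightarrow> 'a ugraph \<Rightarrow> bool" where
  "chair c d a b e G \<longleftrightarrow> distinct [c, d, a, b, e] \<and> uverts G = {c, d, a, b, e} \<and>
    uedges G = {{c, d}, {c, a}, {c, b}, {d, e}}"

lemma chair_iso:
  assumes G: "chair c d a b e G" and H: "chair c' d' a' b' e' H"
  shows "graph_iso G H"
proof -
  define f where "f x = (if x = c then c' else if x = d then d' else if x = a then a'
    else if x = b then b' else e')" for x
  have f: "f c = c'" "f d = d'" "f a = a'" "f b = b'" "f e = e'"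
    using G by (auto simp: f_def chair_def)
  have inj: "inj_on f {c, d, a, b, e}"
    using H G unfolding inj_on_def by (simp add: f) (auto simp: chair_def)
  have "bij_betw f (uverts G) (uverts H)"
    using G H inj by (simp add: bij_betw_def chair_def f)
  moreover have "{u, v} \<in> uedges G \<longleftrightarrow> {f u, f v} \<in> uedges H" if "u \<in> uverts G" "v \<in> uverts G" for u v
  proof -
    have uv: "u \<in> {c, d, a, b, e}" "v \<in> {c, d, a, b, e}" using that G by (auto simp: chair_def)
    have 1: "uedges H = (`) f ` uedges G" using G H by (simp add: chair_def f)
    have 2: "uedges G \<subseteq> Pow {c, d, a, b, e}" using G by (auto simp: chair_def)
    have "{f u, f v} \<in> (`) f ` uedges G \<longleftrightarrow> {u, v} \<in> uedges G"
    proof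
      assume "{f u, f v} \<in> (`) f ` uedges G"
      then obtain g where g: "g \<in> uedges G" "f ` {u, v} = f ` g" by auto
      then have "{u, v} = g" using inj_on_image_eq_iff[OF inj, of "{u, v}" g] uv 2 by blast
      then show "{u, v} \<in> uedges G" using g by simp
    next
      assume "{u, v} \<in> uedges G"
      then show "{f u, f v} \<in> (`) f ` uedges G"
        using imageI[of "{u, v}" "uedges G" "(`) f"] by simp
    qed
    then show ?thesis using 1 by simp
  qed
  ultimately show ?thesis unfolding graph_iso_def by blast
qed

lemma count_degree_sequence:
  "finite (uverts G) \<Longrightarrow> count (degree_sequence G) k = card {v \<in> uverts G. vertex_degree G v = k}"
  by (simp add: degree_sequence_def count_image_mset Int_def vimage_def conj_commute)

text \<open>There are vertices \<open>c\<close> of degree 3, \<open>d\<close> of degree 2 and three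
  leaves. If \<open>c\<close> and \<open>d\<close> were not adjacent, all leaves would hang on
  \<open>c\<close>, leaving no neighbour for \<open>d\<close>. So \<open>c\<close> takes two leaves
  and \<open>d\<close> the third, and no further edge is possible.\<close>

lemma chair_exists:
  fixes Y :: "'b ugraph"
  assumes Y: "simple_graph Y" and ds: "degree_sequence Y = {#1, 1, 1, 2, 3#}"
  shows "\<exists>c d a b e. chair c d a b e Y"
proof -
  define V where "V = uverts Y"
  define E where "E = uedges Y"
  have finV: "finite V" and E: "\<And>g. g \<in> E \<Longrightarrow> g \<subseteq> V \<and> card g = 2"
    using Y by (auto simp: simple_graph_def V_def E_def)
  define N where "N v = {u. {v, u} \<in> E}" for v
  have N_sym: "u \<in> N v \<longleftrightarrow> v \<in> N u" for u v by (simp add: N_def insert_commute)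
  have N_V: "u \<in> V \<and> v \<in> V \<and> u \<noteq> v" if "u \<in> N v" for u v
    using E[of "{v, u}"] that by (auto simp: N_def)
  have edge: "\<exists>u v. g = {u, v} \<and> v \<in> N u" if "g \<in> E" for g
    using E[OF that] that by (auto simp: card_2_iff N_def)
  have deg: "vertex_degree Y v = card (N v)" for v
  proof -
    have "{g \<in> E. v \<in> g} = (\<lambda>u. {v, u}) ` N v"
    proof (intro equalityI subsetI)
      fix g assume g: "g \<in> {g \<in> E. v \<in> g}"
      then obtain x y where "g = {x, y}" "y \<in> N x" using edge by blast
      then show "g \<in> (\<lambda>u. {v, u}) ` N v" using g N_sym by (auto simp: insert_commute)
    qed (auto simp: N_def)
    moreover have "inj_on (\<lambda>u. {v, u}) (N v)" by (auto simp: inj_on_def doubleton_eq_iff)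
    ultimately show ?thesis by (simp add: vertex_degree_def E_def[symmetric] card_image)
  qed
  have cnt: "card {v \<in> V. card (N v) = k} = count {#1, 1, 1, 2, 3#} k" for k
    using count_degree_sequence[of Y k] finV ds by (simp add: deg V_def)
  obtain c where c: "{v \<in> V. card (N v) = 3} = {c}" using cnt[of 3] by (auto simp: card_1_singleton_iff)
  obtain d where d: "{v \<in> V. card (N v) = 2} = {d}" using cnt[of 2] by (auto simp: card_1_singleton_iff)
  define L where "L = {v \<in> V. card (N v) = 1}"
  have cL: "card L = 3" using cnt[of 1] by (simp add: L_def)
  have cV: "card V = 5"
  proof -
    have "size (degree_sequence Y) = card V" using finV by (simp add: degree_sequence_def V_def)
    then show ?thesis using ds by simp
  qed
  have "c \<in> V \<and> card (N c) = 3" "d \<in> V \<and> card (N d) = 2" using c d by blast+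
  then have cd: "c \<in> V" "d \<in> V" "c \<noteq> d" "c \<notin> L" "d \<notin> L" "card (N c) = 3" "card (N d) = 2"
    by (auto simp: L_def)
  have V: "V = insert c (insert d L)"
  proof -
    have "insert c (insert d L) \<subseteq> V" using cd by (auto simp: L_def)
    moreover have "card (insert c (insert d L)) = 5"
      using cd cL finV by (simp add: L_def)
    ultimately show ?thesis using card_subset_eq[OF finV] cV by metis
  qed
  have leaf: "u = w" if "l \<in> L" "u \<in> N l" "w \<in> N l" for l u w
    using that by (auto simp: L_def card_1_singleton_iff)
  have Nc: "N c \<subseteq> insert d L" and Nd: "N d \<subseteq> insert c L" using N_V V by blast+
  have finL: "finite L" using finV by (simp add: L_def)
  have "d \<in> N c"
  proof (rule ccontr)
    assume n: "d \<notin> N c"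
    then have "N c \<subseteq> L" using Nc by blast
    then have "N c = L" using card_subset_eq[OF finL] cL cd(6) by metis
    moreover have "N d \<subseteq> L" using Nd n N_sym by blast
    moreover obtain l where "l \<in> N d" using cd(7) by fastforce
    ultimately show False using leaf[of l c d] N_sym cd(3) by blast
  qed
  have "card (N c - {d}) = 2" using \<open>d \<in> N c\<close> cd(6) by simp
  then obtain a b where ab: "N c - {d} = {a, b}" "a \<noteq> b" by (auto simp: card_2_iff)
  have "card (N d - {c}) = 1" using \<open>d \<in> N c\<close> N_sym[of c d] cd(7) by simp
  then obtain e where e: "N d - {c} = {e}" by (auto simp: card_1_singleton_iff)
  have abL: "a \<in> L" "b \<in> L" "a \<in> N c" "b \<in> N c" using ab Nc by auto
  have eL: "e \<in> L" "e \<in> N d" using e Nd by auto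
  have "e \<noteq> a" "e \<noteq> b" using leaf[of e c d] abL eL N_sym cd(3) by blast+
  then have L: "L = {a, b, e}"
    using card_subset_eq[OF finL, of "{a, b, e}"] abL eL cL ab(2) by auto
  have NN: "N c = {d, a, b}" "N d = {c, e}" using ab e \<open>d \<in> N c\<close> N_sym[of c d] by blast+
  have "E = {{c, d}, {c, a}, {c, b}, {d, e}}"
  proof (intro equalityI subsetI)
    fix g assume "g \<in> E"
    then obtain u v where g: "g = {u, v}" "v \<in> N u" using edge by blast
    have "u \<in> {c, d} \<or> v \<in> {c, d}"
    proof (rule ccontr)
      assume n: "\<not> (u \<in> {c, d} \<or> v \<in> {c, d})"
      then have "u \<in> L" using N_V[OF g(2)] V by blast
      then have "N u \<subseteq> {c, d}" using leaf L abL eL N_sym[of u] by blast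
      then show False using g(2) n by blast
    qed
    moreover have key: "{w, z} \<in> {{c, d}, {c, a}, {c, b}, {d, e}}" if "z \<in> N w" "w \<in> {c, d}" for w z
      using that NN by (auto simp: doubleton_eq_iff)
    moreover have "g = {v, u}" "u \<in> N v" using g N_sym by auto
    ultimately show "g \<in> {{c, d}, {c, a}, {c, b}, {d, e}}" using g by metis
  next
    fix g assume "g \<in> {{c, d}, {c, a}, {c, b}, {d, e}}"
    then show "g \<in> E" using \<open>d \<in> N c\<close> abL eL by (auto simp: N_def)
  qed
  moreover have "distinct [c, d, a, b, e]"
    using cd abL eL \<open>e \<noteq> a\<close> \<open>e \<noteq> b\<close> ab(2) by auto
  ultimately have "chair c d a b e Y" using V L by (auto simp: chair_def V_def E_def)
  then show ?thesis by blast
qed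

lemma edge_connected_cut:
  assumes "edge_connected k G" and "S \<subseteq> uverts G" and "S \<noteq> {}" and "S \<noteq> uverts G"
  shows "k \<le> card {e \<in> uedges G. e \<inter> S \<noteq> {} \<and> \<not> e \<subseteq> S}"
proof (rule ccontr)
  let ?C = "{e \<in> uedges G. e \<inter> S \<noteq> {} \<and> \<not> e \<subseteq> S}"
  assume "\<not> k \<le> card ?C"
  then have con: "graph_connected (uverts G, uedges G - ?C)"
    using assms(1) by (auto simp: edge_connected_def)
  obtain u where u: "u \<in> S" using assms(3) by blast
  obtain v where v: "v \<in> uverts G" "v \<notin> S" using assms(2,4) by blast
  have "(u, v) \<in> {(x, y). {x, y} \<in> uedges G - ?C}\<^sup>*"
    using con u v assms(2) by (auto simp: graph_connected_def)
  then have "v \<in> S" using u by (induction rule: rtrancl_induct) auto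
  then show False using v by blast
qed

theorem theorem5:
  fixes Y :: "'b ugraph" and G :: "'a ugraph"
  assumes "is_tree Y" and "degree_sequence Y = {#1, 1, 1, 2, 3#}"
    and "simple_graph G" and "edge_connected 191 G" and "4 dvd card (uedges G)"
  shows "has_decomposition Y G"
proof (cases "uedges G = {}")
  case True
  then have "is_decomposition Y G {}" by (simp add: is_decomposition_def disjoint_family_on_def)
  then show ?thesis by (auto simp: has_decomposition_def)
next
  case False
  define V where "V = uverts G"
  define E where "E = uedges G"
  have finV: "finite V" and E: "\<And>e. e \<in> E \<Longrightarrow> e \<subseteq> V \<and> card e = 2"
    using assms(3) by (auto simp: simple_graph_def V_def E_def)
  have "E \<subseteq> Pow V" using E by blast
  then have finE: "finite E" using finV finite_subset by blast
  obtain e\<^sub>0 where "e\<^sub>0 \<in> E" using False by (auto simp: E_def)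
  then have V2: "2 \<le> card V" using E[of e\<^sub>0] card_mono[OF finV, of e\<^sub>0] by simp
  have "\<forall>e\<in>E. \<exists>p. e = {fst p, snd p} \<and> fst p \<noteq> snd p" using E by (fastforce simp: card_2_iff)
  from bchoice[OF this] obtain p where p: "\<forall>e\<in>E. e = {fst (p e), snd (p e)} \<and> fst (p e) \<noteq> snd (p e)"
    by (rule exE) (rule that)
  define s where "s e = fst (p e)" for e
  define t where "t e = snd (p e)" for e
  have st: "e = {s e, t e}" "s e \<noteq> t e" if "e \<in> E" for e
    using bspec[OF p that] by (simp_all add: s_def t_def)
  interpret mg: mgraph s t .
  have ends: "s e \<in> V \<and> t e \<in> V" if "e \<in> E" for e using E[OF that] st(1)[OF that] by blast
  have cuts: "191 \<le> card (mg.cut E S)" if S: "S \<subseteq> V" "S \<noteq> {}" "S \<noteq> V" for S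
  proof -
    have "(e \<inter> S \<noteq> {} \<and> \<not> e \<subseteq> S) \<longleftrightarrow> (s e \<in> S) \<noteq> (t e \<in> S)" if "e \<in> E" for e
    proof -
      have "(g \<inter> S \<noteq> {} \<and> \<not> g \<subseteq> S) \<longleftrightarrow> (s e \<in> S) \<noteq> (t e \<in> S)" if "g = {s e, t e}" for g
        using that by auto
      then show ?thesis using st(1)[OF that] by blast
    qed
    then have "{e \<in> E. e \<inter> S \<noteq> {} \<and> \<not> e \<subseteq> S} = mg.cut E S"
      unfolding mg.cut_def by blast
    then show ?thesis using edge_connected_cut[OF assms(4), of S] S by (simp add: V_def E_def)
  qed
  obtain F own where FE: "F \<subseteq> E" and own_st: "\<And>e. e \<in> E \<Longrightarrow> own e \<in> {s e, t e}"
    and own_card: "\<And>v. v \<in> V \<Longrightarrow> int (card {e \<in> E. own e = v}) = 2 * mg.vol F {v}"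
    and degF: "\<And>v. v \<in> V \<Longrightarrow> 11 \<le> mg.vol F {v}"
    by (rule mg.quarter[OF finV finE ends V2 cuts assms(5)[folded E_def]]) (assumption | rule that)+
  have own: "own e \<in> e" if "e \<in> E" for e using own_st[OF that] st(1)[OF that] by blast
  have finF: "finite F" using FE finE finite_subset by blast
  define N where "N v = {u. {v, u} \<in> F}" for v
  define Tg where "Tg v = {x. {v, x} \<in> E - F \<and> own {v, x} = v}" for v
  \<comment> \<open>The owner of a selected edge becomes the vertex of degree 2 in its copy: the
    edge itself is one of its two, so one more is received. The other end becomes the centre and
    receives two.\<close>
  define m where "m v u = (if own {v, u} = v then 1 else 2 :: nat)" for v u
  have pair: "u \<noteq> v \<and> u \<in> V \<and> v \<in> V" if "{u, v} \<in> E" for u v using E[OF that] by auto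
  have inj: "inj_on (\<lambda>u. {v, u}) M" for v :: 'a and M by (auto simp: inj_on_def doubleton_eq_iff)
  have edge: "\<exists>x. e = {v, x}" if "e \<in> E" "v \<in> e" for e v using E[OF that(1)] that(2) by (auto simp: card_2_iff)
  have N_img: "{e \<in> F. v \<in> e} = (\<lambda>u. {v, u}) ` N v" for v using edge FE by (fastforce simp: N_def)
  have volF: "mg.vol F {v} = int (card (N v))" for v
  proof -
    have "mg.vol F {v} = (\<Sum>e\<in>F. of_bool (v \<in> e))"
      unfolding mg.vol_def
    proof (intro sum.cong refl)
      fix e assume "e \<in> F"
      then have e: "e \<in> E" using FE by blast
      have "v \<in> g \<longleftrightarrow> v = s e \<or> v = t e" if "g = {s e, t e}" for g using that by auto
      then have "v \<in> e \<longleftrightarrow> v = s e \<or> v = t e" using st(1)[OF e] by blast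
      then show "of_bool (s e \<in> {v}) + of_bool (t e \<in> {v}) = (of_bool (v \<in> e) :: int)"
        using st(2)[OF e] by auto
    qed
    also have "\<dots> = int (card {e \<in> F. v \<in> e})"
      using finF by (simp add: of_bool_def sum.inter_filter[symmetric])
    finally show ?thesis unfolding N_img by (simp add: card_image inj)
  qed
  interpret slot_system V N Tg m
  proof
    show "finite V" by (rule finV)
    show "N v \<subseteq> V" for v using pair FE by (auto simp: N_def)
    show "v \<in> N u" if "u \<in> N v" for u v using that by (simp add: N_def insert_commute)
    show "v \<notin> N v" for v using pair[of v v] FE by (auto simp: N_def)
    show "finite (Tg v)" if "v \<in> V" for v
      using finV pair by (auto simp: Tg_def intro: finite_subset[of _ V])
    show "m v u \<in> {1, 2}" if "u \<in> N v" for u v by (simp add: m_def)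
    fix v assume v: "v \<in> V"
    have finN: "finite (N v)" using pair FE finV by (auto simp: N_def intro: finite_subset[of _ V])
    \<comment> \<open>The selected edges owned by \<open>v\<close> count towards what
      \<open>v\<close> owns, and they are those with one slot less at \<open>v\<close>; so the
      numbers of slots and targets agree.\<close>
    let ?O = "{u \<in> N v. own {v, u} = v}"
    have "{e \<in> E. own e = v} = (\<lambda>u. {v, u}) ` (Tg v \<union> ?O)"
    proof (intro equalityI subsetI)
      fix e assume e: "e \<in> {e \<in> E. own e = v}"
      then obtain x where "e = {v, x}" using edge own by blast
      then show "e \<in> (\<lambda>u. {v, u}) ` (Tg v \<union> ?O)" using e by (auto simp: Tg_def N_def)
    qed (use FE in \<open>auto simp: Tg_def N_def\<close>)
    then have "card {e \<in> E. own e = v} = card (Tg v \<union> ?O)" by (simp add: card_image inj)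
    also have "\<dots> = card (Tg v) + card ?O"
      using finN finV pair by (intro card_Un_disjoint) (auto simp: Tg_def N_def intro: finite_subset[of _ V])
    finally have "2 * card (N v) = card (Tg v) + card ?O" using own_card[OF v] volF[of v] by simp
    moreover have "(\<Sum>u\<in>N v. m v u) + card ?O = 2 * card (N v)"
    proof -
      have "card ?O = (\<Sum>u\<in>N v. if own {v, u} = v then 1 else 0)"
        using finN by (simp add: sum.inter_filter[symmetric])
      then have "(\<Sum>u\<in>N v. m v u) + card ?O = (\<Sum>u\<in>N v. 2)"
        by (simp only: sum.distrib[symmetric]) (intro sum.cong, auto simp: m_def)
      then show ?thesis by simp
    qed
    ultimately show "(\<Sum>u\<in>N v. m v u) = card (Tg v)" by simp
  qed
  have "11 \<le> card (N v)" if "v \<in> V" for v using degF[OF that] volF[of v] by simp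
  then obtain \<psi> where \<psi>: "valid \<psi> V" "free \<psi> V" using conflict_free_assignment by blast
  \<comment> \<open>\<open>\<phi> e\<close> is the edge of \<open>F\<close> to whose copy of \<open>Y\<close> the edge \<open>e\<close> is added.\<close>
  define \<phi> where "\<phi> e = {own e, \<psi> (own e) (THE x. e = {own e, x})}" for e
  have \<phi>: "\<phi> {v, x} = {v, \<psi> v x}" if "x \<in> Tg v" for v x
  proof -
    have "own {v, x} = v" using that by (simp add: Tg_def)
    moreover have "(THE y. {v, x} = {v, y}) = x" by (rule the_equality) (auto simp: doubleton_eq_iff)
    ultimately show ?thesis by (simp add: \<phi>_def)
  qed
  have rest: "\<exists>v x. e = {v, x} \<and> v \<in> V \<and> x \<in> Tg v" if e: "e \<in> E - F" for e
  proof -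
    obtain x where x: "e = {own e, x}" using edge[of e "own e"] own e by blast
    then show ?thesis using e pair[of "own e" x] by (intro exI[of _ "own e"] exI[of _ x]) (auto simp: Tg_def)
  qed
  define Ed where "Ed f = insert f {e \<in> E - F. \<phi> e = f}" for f
  have chair_Ed: "\<exists>c d a b e. chair c d a b e (\<Union>(Ed f), Ed f)" if f: "f \<in> F" for f
  proof -
    have fE: "f \<in> E" using f FE by blast
    define d where "d = own f"
    obtain c where c: "f = {d, c}" using edge[OF fE own[OF fE]] by (auto simp: d_def)
    have dc: "d \<noteq> c" "d \<in> V" "c \<in> V" using pair[of d c] fE c by auto
    have N: "c \<in> N d" "d \<in> N c" using f c by (auto simp: N_def insert_commute)
    have "own {d, c} = d" "own {c, d} = d" using c by (auto simp: d_def insert_commute)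
    then have "card (tau \<psi> d c) = 1" "card (tau \<psi> c d) = 2"
      using \<psi>(1) N dc by (auto simp: valid_def m_def)
    then obtain a b e where te: "tau \<psi> d c = {e}" and tab: "tau \<psi> c d = {a, b}" "a \<noteq> b"
      by (auto simp: card_1_singleton_iff card_2_iff)
    \<comment> \<open>This rules out the triangle: the leaf at \<open>d\<close> differs from those
      at \<open>c\<close>.\<close>
    have "tau \<psi> c d \<inter> tau \<psi> d c = {}" using \<psi>(2) dc N by (auto simp: free_def)
    then have eab: "e \<noteq> a" "e \<noteq> b" using te tab by auto
    have T: "e \<in> Tg d" "a \<in> Tg c" "b \<in> Tg c" "\<psi> d e = c" "\<psi> c a = d" "\<psi> c b = d"
      using te tab by (auto simp: tau_def)
    have nF: "{d, e} \<in> E - F" "{c, a} \<in> E - F" "{c, b} \<in> E - F" using T by (auto simp: Tg_def)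
    \<comment> \<open>For instance \<open>a \<noteq> d\<close>, because \<open>{c, a}\<close> lies
      outside \<open>F\<close> while \<open>{c, d}\<close> is \<open>f\<close>.\<close>
    have ne: "e \<noteq> d" "e \<noteq> c" "a \<noteq> c" "a \<noteq> d" "b \<noteq> c" "b \<noteq> d"
      using nF pair[of d e] pair[of c a] pair[of c b] f c by (auto simp: insert_commute)
    have "{g \<in> E - F. \<phi> g = f} = {{c, a}, {c, b}, {d, e}}"
    proof (intro equalityI subsetI)
      fix g assume g: "g \<in> {g \<in> E - F. \<phi> g = f}"
      then obtain v x where vx: "g = {v, x}" "v \<in> V" "x \<in> Tg v" using rest by blast
      then have "{v, \<psi> v x} = {d, c}" using g \<phi>[OF vx(3)] c by simp
      then have "v = d \<and> x \<in> tau \<psi> d c \<or> v = c \<and> x \<in> tau \<psi> c d"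
        using vx(3) by (auto simp: doubleton_eq_iff tau_def)
      then show "g \<in> {{c, a}, {c, b}, {d, e}}" using te tab vx(1) by auto
    next
      fix g assume "g \<in> {{c, a}, {c, b}, {d, e}}"
      then show "g \<in> {g \<in> E - F. \<phi> g = f}"
        using nF \<phi>[OF T(1)] \<phi>[OF T(2)] \<phi>[OF T(3)] T c by (auto simp: insert_commute)
    qed
    then have "Ed f = {{c, d}, {c, a}, {c, b}, {d, e}}" using c by (simp add: Ed_def insert_commute)
    moreover from this have "\<Union>(Ed f) = {c, d, a, b, e}" by auto
    ultimately have "chair c d a b e (\<Union>(Ed f), Ed f)"
      using dc ne eab tab(2) by (auto simp: chair_def)
    then show ?thesis by blast
  qed
  obtain c' d' a' b' e' where Y: "chair c' d' a' b' e' Y"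
    using chair_exists assms(1,2) by (metis is_tree_def)
  define D where "D = (\<lambda>f. (\<Union>(Ed f), Ed f)) ` F"
  have EdE: "Ed f \<subseteq> E" if "f \<in> F" for f using that FE by (auto simp: Ed_def)
  have "subgraph_of H G \<and> graph_iso H Y" if H: "H \<in> D" for H
  proof -
    obtain f where f: "f \<in> F" "H = (\<Union>(Ed f), Ed f)" using H by (auto simp: D_def)
    have sub: "\<Union>(Ed f) \<subseteq> V" using EdE[OF f(1)] E by blast
    have "simple_graph H"
      using EdE[OF f(1)] E finite_subset[OF sub finV] by (auto simp: simple_graph_def f(2))
    then have "subgraph_of H G"
      using sub EdE[OF f(1)] by (simp add: subgraph_of_def f(2) V_def E_def)
    moreover have "graph_iso H Y" using chair_Ed[OF f(1)] Y unfolding f(2) by (elim exE) (rule chair_iso)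
    ultimately show ?thesis ..
  qed
  moreover have "disjoint_family_on uedges D"
    unfolding disjoint_family_on_def
  proof (intro ballI impI)
    fix H H' assume "H \<in> D" "H' \<in> D" "H \<noteq> H'"
    then obtain f f' where "f \<in> F" "f' \<in> F" "f \<noteq> f'" "H = (\<Union>(Ed f), Ed f)" "H' = (\<Union>(Ed f'), Ed f')"
      by (auto simp: D_def)
    then show "uedges H \<inter> uedges H' = {}" by (auto simp: Ed_def)
  qed
  moreover have "(\<Union>H\<in>D. uedges H) = uedges G"
  proof -
    have "e \<in> (\<Union>f\<in>F. Ed f)" if e: "e \<in> E" for e
    proof (cases "e \<in> F")
      case False
      then obtain v x where vx: "e = {v, x}" "v \<in> V" "x \<in> Tg v" using rest e by blast
      then have "\<psi> v x \<in> N v" using \<psi>(1) by (auto simp: valid_def)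
      then have "\<phi> e \<in> F" using \<phi>[OF vx(3)] vx(1) by (simp add: N_def)
      then show ?thesis using e False by (auto simp: Ed_def)
    qed (auto simp: Ed_def)
    then have "(\<Union>f\<in>F. Ed f) = E" using EdE by blast
    then show ?thesis by (simp add: D_def E_def)
  qed
  ultimately have "is_decomposition Y G D" unfolding is_decomposition_def by blast
  then show ?thesis unfolding has_decomposition_def by blast
qed

end
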